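(* Let $(A,\mu,E,\Delta,\epsilon)$ be a regular weak multiplier bialgebra over a field. There is a bijective correspondence between the following data: (1) linear maps $R_1,R_2:A\otimes A\to A\otimes A$ such that $R_iT_i=G_i$, $T_iR_i=E_i$ and $R_iT_iR_i=R_i$ for $i\in\{1,2\}$; (2) linear maps $S:A\to\mathbb M(A)$ satisfying, for all $a,b,c\in A$, (vii) $T_1\big[((\mathrm{id}\otimes S)T_2(a\otimes b))(1\otimes c)\big]=\Delta(a)(b\otimes c)$, (viii) $T_2\big[(a\otimes1)((S\otimes\mathrm{id})T_1(b\otimes c))\big]=(a\otimes b)\Delta(c)$, (ix) $\mu(S\otimes\mathrm{id})[E(a\otimes1)]=S(a)$ (equivalently, $\mu(\mathrm{id}\otimes S)[(1\otimes a)E]=S(a)$).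
   Context: Let $k$ be a field; $\langle X\rangle$ is linear span; $\mathsf{tw}(x\otimes y)=y\otimes x$. A non-unital $k$-algebra $A$ is idempotent if its multiplication $\mu$ is surjective and has non-degenerate multiplication if ($ab=0\ \forall a$)$\Rightarrow b=0$ and ($ba=0\ \forall a$)$\Rightarrow b=0$. $\mathbb M(A)$ is its multiplier algebra (pairs $(\lambda,\rho)$ of linear maps $A\to A$ with $a\lambda(b)=\rho(a)b$), a unital algebra containing $A$ as a dense ideal; $A\otimes A\subseteq\mathbb M(A)\otimes\mathbb M(A)\subseteq\mathbb M(A\otimes A)$; $\mu$ also denotes multiplication of $\mathbb M(A)$. Multiplicative $\gamma:A\to\mathbb M(B)$ with idempotent $e\in\mathbb M(B)$, $\langle\gamma(a)b\rangle=eB$, $\langle b\gamma(a)\rangle=Be$ extends uniquely to multiplicative $\overline\gamma:\mathbb M(A)\to\mathbb M(B)$ with $\overline\gamma(1)=e$. A weak multiplier bialgebra: idempotent $A$ with non-degenerate multiplication, idempotent $E\in\mathbb M(A\otimes A)$, multiplicative linear $\Delta:A\to\mathbb M(A\otimes A)$, linear $\epsilon:A\to k$ with: (i) $T_1(a\otimes b):=\Delta(a)(1\otimes b)$, $T_2(a\otimes b):=(a\otimes1)\Delta(b)$ lie in $A\otimes A$; (ii) $(T_2\otimes\mathrm{id})(\mathrm{id}\otimes T_1)=(\mathrm{id}\otimes T_1)(T_2\otimes\mathrm{id})$; (iii) $(\epsilon\otimes\mathrm{id})T_1=\mu=(\mathrm{id}\otimes\epsilon)T_2$; (iv) $\langle\Delta(a)(b\otimes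 b')\rangle=\langle E(b\otimes b')\rangle$, $\langle(b\otimes b')\Delta(a)\rangle=\langle(b\otimes b')E\rangle$; (v) $(E\otimes1)(1\otimes E)=E^{(3)}=(1\otimes E)(E\otimes1)$ with $E^{(3)}:=(\overline{\mathrm{id}\otimes\Delta})(E)=(\overline{\Delta\otimes\mathrm{id}})(E)$; (vi) $(\epsilon\otimes\mathrm{id})((1\otimes a)E(b\otimes c))=(\epsilon\otimes\mathrm{id})(\Delta(a)(b\otimes c))$ and $(\epsilon\otimes\mathrm{id})((a\otimes b)E(1\otimes c))=(\epsilon\otimes\mathrm{id})((a\otimes b)\Delta(c))$. Regular: also $T_3(a\otimes b):=(1\otimes b)\Delta(a)$ and $T_4(a\otimes b):=\Delta(b)(a\otimes1)$ lie in $A\otimes A$. Multipliers for $a\in A$: $\overline\sqcap^L(a)$ with $\overline\sqcap^L(a)b=(\epsilon\otimes\mathrm{id})((a\otimes1)\Delta(b))$, $b\overline\sqcap^L(a)=(\epsilon\otimes\mathrm{id})((a\otimes b)E)$; $\overline\sqcap^R(a)$ with $b\overline\sqcap^R(a)=(\mathrm{id}\otimes\epsilon)(\Delta(b)(1\otimes a))$, $\overline\sqcap^R(a)b=(\mathrm{id}\otimes\epsilon)(E(b\otimes a))$. Maps $A\otimes A\to A\otimes A$: $E_1(a\otimes b)=E(a\otimes b)$; $E_2(a\otimes b)=(a\otimes b)E$; $G_1$ the well-defined linear map with $G_1(a\otimes bc)=(a\otimes1)\big((\overline\sqcap^R\otimes\mathrm{id})(\mathsf{tw}\,T_4(c\otimes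 b))\big)$; $G_2$ the well-defined linear map with $G_2(ab\otimes c)=\big((\mathrm{id}\otimes\overline\sqcap^L)(\mathsf{tw}\,T_3(b\otimes a))\big)(1\otimes c)$. In (vii)–(ix), $(\mathrm{id}\otimes S)$, $(S\otimes\mathrm{id})$ are applied to elements of $A\otimes A$, and $E(a\otimes1)\in A\otimes\mathbb M(A)$, $(1\otimes a)E\in\mathbb M(A)\otimes A$. *)

theory Defs
  imports Main "HOL.Vector_Spaces" "HOL-Library.Function_Algebras" "HOL-Library.Product_Plus"
begin

text \<open>
Concrete model of tensor products of vector spaces over a field.
A k-vector space is a carrier set in a type with a scalar multiplication.
For spaces V and W (carrier sets X, Y), an element of V \<otimes> W is represented by the
bilinear form it induces on pairs of linear functionals (V* \<times> W* \<rightarrow> k); since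
linear functionals separate points over a field, this is the usual algebraic
tensor product.  A multiplier of a (non-unital) algebra with carrier X is a pair
(lambda, rho) of linear maps X \<rightarrow> X with a*lambda(b) = rho(a)*b (extended by 0
outside X).  Linear maps out of a tensor product are obtained from bilinear maps
via a chosen representation as a finite sum of simple tensors (tlift).
\<close>

type_synonym ('k,'v,'w) tensor = "('v \<Rightarrow> 'k) \<Rightarrow> ('w \<Rightarrow> 'k) \<Rightarrow> 'k"
type_synonym 'v mult = "('v \<Rightarrow> 'v) \<times> ('v \<Rightarrow> 'v)"

definition lfun :: "('k::field \<Rightarrow> 'v::plus \<Rightarrow> 'v) \<Rightarrow> ('v \<Rightarrow> 'k) \<Rightarrow> bool" where
  "lfun sv f \<longleftrightarrow> (\<forall>x y. f (x + y) = f x + f y) \<and> (\<forall>c x. f (sv c x) = c * f x)"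

definition lin_on :: "('k \<Rightarrow> 'x::plus \<Rightarrow> 'x) \<Rightarrow> ('k \<Rightarrow> 'y::plus \<Rightarrow> 'y) \<Rightarrow> 'x set \<Rightarrow> ('x \<Rightarrow> 'y) \<Rightarrow> bool" where
  "lin_on sx sy X f \<longleftrightarrow> (\<forall>x\<in>X. \<forall>y\<in>X. f (x + y) = f x + f y) \<and> (\<forall>c. \<forall>x\<in>X. f (sx c x) = sy c (f x))"

definition tens :: "('k::field \<Rightarrow> 'v::plus \<Rightarrow> 'v) \<Rightarrow> ('k \<Rightarrow> 'w::plus \<Rightarrow> 'w) \<Rightarrow> 'v \<Rightarrow> 'w \<Rightarrow> ('k,'v,'w) tensor" where
  "tens sv sw v w = (\<lambda>f g. if lfun sv f \<and> lfun sw g then f v * g w else 0)"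

definition tsc :: "'k::field \<Rightarrow> ('k,'v,'w) tensor \<Rightarrow> ('k,'v,'w) tensor" where
  "tsc c u = (\<lambda>f g. c * u f g)"

definition psum :: "('x \<Rightarrow> 'y \<Rightarrow> 'z::monoid_add) \<Rightarrow> ('x \<times> 'y) list \<Rightarrow> 'z" where
  "psum f xs = sum_list (map (case_prod f) xs)"

definition lspan :: "('k \<Rightarrow> 'x::monoid_add \<Rightarrow> 'x) \<Rightarrow> 'x set \<Rightarrow> 'x set" where
  "lspan sc X = {psum sc xs | xs. set (map snd xs) \<subseteq> X}"

definition tsp :: "('k::field \<Rightarrow> 'v::plus \<Rightarrow> 'v) \<Rightarrow> ('k \<Rightarrow> 'w::plus \<Rightarrow> 'w) \<Rightarrow> 'v set \<Rightarrow> 'w set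
    \<Rightarrow> ('k,'v,'w) tensor set" where
  "tsp sv sw X Y = {psum (tens sv sw) xs | xs. set xs \<subseteq> X \<times> Y}"

definition trep :: "('k::field \<Rightarrow> 'v::plus \<Rightarrow> 'v) \<Rightarrow> ('k \<Rightarrow> 'w::plus \<Rightarrow> 'w) \<Rightarrow> 'v set \<Rightarrow> 'w set
    \<Rightarrow> ('k,'v,'w) tensor \<Rightarrow> ('v \<times> 'w) list" where
  "trep sv sw X Y u = (SOME xs. set xs \<subseteq> X \<times> Y \<and> u = psum (tens sv sw) xs)"

definition tlift :: "('k::field \<Rightarrow> 'v::plus \<Rightarrow> 'v) \<Rightarrow> ('k \<Rightarrow> 'w::plus \<Rightarrow> 'w) \<Rightarrow> 'v set \<Rightarrow> 'w set
    \<Rightarrow> ('v \<Rightarrow> 'w \<Rightarrow> 'z::monoid_add) \<Rightarrow> ('k,'v,'w) tensor \<Rightarrow> 'z" where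
  "tlift sv sw X Y \<beta> u = psum \<beta> (trep sv sw X Y u)"

definition tmul :: "('k::field \<Rightarrow> 'v::plus \<Rightarrow> 'v) \<Rightarrow> ('k \<Rightarrow> 'w::plus \<Rightarrow> 'w) \<Rightarrow> 'v set \<Rightarrow> 'w set
    \<Rightarrow> ('v \<Rightarrow> 'v \<Rightarrow> 'v) \<Rightarrow> ('w \<Rightarrow> 'w \<Rightarrow> 'w) \<Rightarrow> ('k,'v,'w) tensor \<Rightarrow> ('k,'v,'w) tensor \<Rightarrow> ('k,'v,'w) tensor" where
  "tmul sv sw X Y mv mw u v =
     psum (\<lambda>a b. psum (\<lambda>c d. tens sv sw (mv a c) (mw b d)) (trep sv sw X Y v)) (trep sv sw X Y u)"

definition rst :: "'x set \<Rightarrow> ('x \<Rightarrow> 'y::zero) \<Rightarrow> 'x \<Rightarrow> 'y" where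
  "rst X f = (\<lambda>x. if x \<in> X then f x else 0)"

definition multipliers :: "('k \<Rightarrow> 'x::monoid_add \<Rightarrow> 'x) \<Rightarrow> ('x \<Rightarrow> 'x \<Rightarrow> 'x) \<Rightarrow> 'x set \<Rightarrow> 'x mult set" where
  "multipliers sx mx X = {(l, r). (\<forall>x. x \<notin> X \<longrightarrow> l x = 0 \<and> r x = 0) \<and> l ` X \<subseteq> X \<and> r ` X \<subseteq> X
      \<and> lin_on sx sx X l \<and> lin_on sx sx X r \<and> (\<forall>a\<in>X. \<forall>b\<in>X. mx a (l b) = mx (r a) b)}"

definition mmul :: "'x mult \<Rightarrow> 'x mult \<Rightarrow> 'x mult" where
  "mmul x y = (fst x \<circ> fst y, snd y \<circ> snd x)"

definition munit :: "'x::zero set \<Rightarrow> 'x mult" where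
  "munit X = (rst X id, rst X id)"

definition memb :: "('x \<Rightarrow> 'x \<Rightarrow> 'x::zero) \<Rightarrow> 'x set \<Rightarrow> 'x \<Rightarrow> 'x mult" where
  "memb mx X a = (rst X (mx a), rst X (\<lambda>b. mx b a))"

definition msc :: "('k \<Rightarrow> 'x \<Rightarrow> 'x) \<Rightarrow> 'k \<Rightarrow> 'x mult \<Rightarrow> 'x mult" where
  "msc sc c x = (\<lambda>z. sc c (fst x z), \<lambda>z. sc c (snd x z))"

type_synonym ('k,'a) AA = "('k,'a,'a) tensor"
type_synonym ('k,'a) AAA = "('k,('k,'a) AA,'a) tensor"

definition AA :: "('k::field \<Rightarrow> 'a::ab_group_add \<Rightarrow> 'a) \<Rightarrow> ('k,'a) AA set" where
  "AA s = tsp s s UNIV UNIV"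

definition ten :: "('k::field \<Rightarrow> 'a::ab_group_add \<Rightarrow> 'a) \<Rightarrow> 'a \<Rightarrow> 'a \<Rightarrow> ('k,'a) AA" where
  "ten s a b = tens s s a b"

definition tlA :: "('k::field \<Rightarrow> 'a::ab_group_add \<Rightarrow> 'a) \<Rightarrow> ('a \<Rightarrow> 'a \<Rightarrow> 'z::monoid_add) \<Rightarrow> ('k,'a) AA \<Rightarrow> 'z" where
  "tlA s \<beta> u = tlift s s UNIV UNIV \<beta> u"

definition mulAA :: "('k::field \<Rightarrow> 'a::ab_group_add \<Rightarrow> 'a) \<Rightarrow> ('a \<Rightarrow> 'a \<Rightarrow> 'a) \<Rightarrow> ('k,'a) AA \<Rightarrow> ('k,'a) AA \<Rightarrow> ('k,'a) AA" where
  "mulAA s m = tmul s s UNIV UNIV m m"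

definition MA :: "('k::field \<Rightarrow> 'a::ab_group_add \<Rightarrow> 'a) \<Rightarrow> ('a \<Rightarrow> 'a \<Rightarrow> 'a) \<Rightarrow> 'a mult set" where
  "MA s m = multipliers s m UNIV"

definition MAA :: "('k::field \<Rightarrow> 'a::ab_group_add \<Rightarrow> 'a) \<Rightarrow> ('a \<Rightarrow> 'a \<Rightarrow> 'a) \<Rightarrow> ('k,'a) AA mult set" where
  "MAA s m = multipliers tsc (mulAA s m) (AA s)"

definition AAA :: "('k::field \<Rightarrow> 'a::ab_group_add \<Rightarrow> 'a) \<Rightarrow> ('k,'a) AAA set" where
  "AAA s = tsp tsc s (AA s) UNIV"

definition tlAAA :: "('k::field \<Rightarrow> 'a::ab_group_add \<Rightarrow> 'a) \<Rightarrow> (('k,'a) AA \<Rightarrow> 'a \<Rightarrow> 'z::monoid_add) \<Rightarrow> ('k,'a) AAA \<Rightarrow> 'z" where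
  "tlAAA s \<beta> u = tlift tsc s (AA s) UNIV \<beta> u"

definition mulAAA :: "('k::field \<Rightarrow> 'a::ab_group_add \<Rightarrow> 'a) \<Rightarrow> ('a \<Rightarrow> 'a \<Rightarrow> 'a) \<Rightarrow> ('k,'a) AAA \<Rightarrow> ('k,'a) AAA \<Rightarrow> ('k,'a) AAA" where
  "mulAAA s m = tmul tsc s (AA s) UNIV (mulAA s m) m"

definition MAAA :: "('k::field \<Rightarrow> 'a::ab_group_add \<Rightarrow> 'a) \<Rightarrow> ('a \<Rightarrow> 'a \<Rightarrow> 'a) \<Rightarrow> ('k,'a) AAA mult set" where
  "MAAA s m = multipliers tsc (mulAAA s m) (AAA s)"

definition embAA :: "('k::field \<Rightarrow> 'a::ab_group_add \<Rightarrow> 'a) \<Rightarrow> ('a \<Rightarrow> 'a \<Rightarrow> 'a) \<Rightarrow> ('k,'a) AA \<Rightarrow> ('k,'a) AA mult" where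
  "embAA s m u = memb (mulAA s m) (AA s) u"

definition embA :: "('a \<Rightarrow> 'a \<Rightarrow> 'a::ab_group_add) \<Rightarrow> 'a \<Rightarrow> 'a mult" where
  "embA m a = memb m UNIV a"

definition oneA :: "'a::ab_group_add mult" where
  "oneA = munit UNIV"

definition tmapA :: "('k::field \<Rightarrow> 'a::ab_group_add \<Rightarrow> 'a) \<Rightarrow> ('a \<Rightarrow> 'a) \<Rightarrow> ('a \<Rightarrow> 'a) \<Rightarrow> ('k,'a) AA \<Rightarrow> ('k,'a) AA" where
  "tmapA s \<phi> \<psi> = rst (AA s) (tlA s (\<lambda>x y. ten s (\<phi> x) (\<psi> y)))"

definition mtA :: "('k::field \<Rightarrow> 'a::ab_group_add \<Rightarrow> 'a) \<Rightarrow> 'a mult \<Rightarrow> 'a mult \<Rightarrow> ('k,'a) AA mult" where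
  "mtA s x y = (tmapA s (fst x) (fst y), tmapA s (snd x) (snd y))"

definition inAA :: "('k::field \<Rightarrow> 'a::ab_group_add \<Rightarrow> 'a) \<Rightarrow> ('a \<Rightarrow> 'a \<Rightarrow> 'a) \<Rightarrow> ('k,'a) AA mult \<Rightarrow> ('k,'a) AA" where
  "inAA s m X = (THE w. w \<in> AA s \<and> embAA s m w = X)"

definition T1 :: "('k::field \<Rightarrow> 'a::ab_group_add \<Rightarrow> 'a) \<Rightarrow> ('a \<Rightarrow> 'a \<Rightarrow> 'a) \<Rightarrow> ('a \<Rightarrow> ('k,'a) AA mult) \<Rightarrow> ('k,'a) AA \<Rightarrow> ('k,'a) AA" where
  "T1 s m \<Delta> = tlA s (\<lambda>a b. inAA s m (mmul (\<Delta> a) (mtA s oneA (embA m b))))"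

definition T2 :: "('k::field \<Rightarrow> 'a::ab_group_add \<Rightarrow> 'a) \<Rightarrow> ('a \<Rightarrow> 'a \<Rightarrow> 'a) \<Rightarrow> ('a \<Rightarrow> ('k,'a) AA mult) \<Rightarrow> ('k,'a) AA \<Rightarrow> ('k,'a) AA" where
  "T2 s m \<Delta> = tlA s (\<lambda>a b. inAA s m (mmul (mtA s (embA m a) oneA) (\<Delta> b)))"

definition T3 :: "('k::field \<Rightarrow> 'a::ab_group_add \<Rightarrow> 'a) \<Rightarrow> ('a \<Rightarrow> 'a \<Rightarrow> 'a) \<Rightarrow> ('a \<Rightarrow> ('k,'a) AA mult) \<Rightarrow> ('k,'a) AA \<Rightarrow> ('k,'a) AA" where
  "T3 s m \<Delta> = tlA s (\<lambda>a b. inAA s m (mmul (mtA s oneA (embA m b)) (\<Delta> a)))"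

definition T4 :: "('k::field \<Rightarrow> 'a::ab_group_add \<Rightarrow> 'a) \<Rightarrow> ('a \<Rightarrow> 'a \<Rightarrow> 'a) \<Rightarrow> ('a \<Rightarrow> ('k,'a) AA mult) \<Rightarrow> ('k,'a) AA \<Rightarrow> ('k,'a) AA" where
  "T4 s m \<Delta> = tlA s (\<lambda>a b. inAA s m (mmul (\<Delta> b) (mtA s (embA m a) oneA)))"

definition epsid :: "('k::field \<Rightarrow> 'a::ab_group_add \<Rightarrow> 'a) \<Rightarrow> ('a \<Rightarrow> 'k) \<Rightarrow> ('k,'a) AA \<Rightarrow> 'a" where
  "epsid s \<epsilon> = tlA s (\<lambda>x y. s (\<epsilon> x) y)"

definition ideps :: "('k::field \<Rightarrow> 'a::ab_group_add \<Rightarrow> 'a) \<Rightarrow> ('a \<Rightarrow> 'k) \<Rightarrow> ('k,'a) AA \<Rightarrow> 'a" where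
  "ideps s \<epsilon> = tlA s (\<lambda>x y. s (\<epsilon> y) x)"

definition muA :: "('k::field \<Rightarrow> 'a::ab_group_add \<Rightarrow> 'a) \<Rightarrow> ('a \<Rightarrow> 'a \<Rightarrow> 'a) \<Rightarrow> ('k,'a) AA \<Rightarrow> 'a" where
  "muA s m = tlA s m"

definition tw :: "('k::field \<Rightarrow> 'a::ab_group_add \<Rightarrow> 'a) \<Rightarrow> ('k,'a) AA \<Rightarrow> ('k,'a) AA" where
  "tw s = tlA s (\<lambda>x y. ten s y x)"

definition Rg :: "('k::field \<Rightarrow> 'a::ab_group_add \<Rightarrow> 'a) \<Rightarrow> (('k,'a) AA \<Rightarrow> ('k,'a) AA) \<Rightarrow> ('a \<Rightarrow> 'a)
    \<Rightarrow> ('k,'a) AAA \<Rightarrow> ('k,'a) AAA" where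
  "Rg s \<phi> \<psi> = rst (AAA s) (tlAAA s (\<lambda>w c. tens tsc s (\<phi> w) (\<psi> c)))"

text \<open>psi \<otimes> phi on A \<otimes> A \<otimes> A, with phi acting on the last two factors\<close>
definition idLg :: "('k::field \<Rightarrow> 'a::ab_group_add \<Rightarrow> 'a) \<Rightarrow> ('a \<Rightarrow> 'a) \<Rightarrow> (('k,'a) AA \<Rightarrow> ('k,'a) AA)
    \<Rightarrow> ('k,'a) AAA \<Rightarrow> ('k,'a) AAA" where
  "idLg s \<psi> \<phi> = rst (AAA s) (tlAAA s (\<lambda>w c. tlA s (\<lambda>a b.
       tlA s (\<lambda>x y. tens tsc s (ten s (\<psi> a) x) y) (\<phi> (ten s b c))) w))"

definition Eone :: "('k::field \<Rightarrow> 'a::ab_group_add \<Rightarrow> 'a) \<Rightarrow> ('k,'a) AA mult \<Rightarrow> ('k,'a) AAA mult" where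
  "Eone s E = (Rg s (fst E) id, Rg s (snd E) id)"

definition oneE :: "('k::field \<Rightarrow> 'a::ab_group_add \<Rightarrow> 'a) \<Rightarrow> ('k,'a) AA mult \<Rightarrow> ('k,'a) AAA mult" where
  "oneE s E = (idLg s id (fst E), idLg s id (snd E))"

definition Dtid :: "('k::field \<Rightarrow> 'a::ab_group_add \<Rightarrow> 'a) \<Rightarrow> ('a \<Rightarrow> 'a \<Rightarrow> 'a) \<Rightarrow> ('a \<Rightarrow> ('k,'a) AA mult)
    \<Rightarrow> ('k,'a) AA \<Rightarrow> ('k,'a) AAA mult" where
  "Dtid s m \<Delta> = tlA s (\<lambda>a b. (Rg s (fst (\<Delta> a)) (m b), Rg s (snd (\<Delta> a)) (\<lambda>c. m c b)))"

definition idtD :: "('k::field \<Rightarrow> 'a::ab_group_add \<Rightarrow> 'a) \<Rightarrow> ('a \<Rightarrow> 'a \<Rightarrow> 'a) \<Rightarrow> ('a \<Rightarrow> ('k,'a) AA mult)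
    \<Rightarrow> ('k,'a) AA \<Rightarrow> ('k,'a) AAA mult" where
  "idtD s m \<Delta> = tlA s (\<lambda>a b. (idLg s (m a) (fst (\<Delta> b)), idLg s (\<lambda>x. m x a) (snd (\<Delta> b))))"

text \<open>the unique extension of gamma : A \<otimes> A \<rightarrow> M(A \<otimes> A \<otimes> A) to M(A \<otimes> A), sending 1 to e\<close>
definition mext :: "('k::field \<Rightarrow> 'a::ab_group_add \<Rightarrow> 'a) \<Rightarrow> ('a \<Rightarrow> 'a \<Rightarrow> 'a) \<Rightarrow> (('k,'a) AA \<Rightarrow> ('k,'a) AAA mult)
    \<Rightarrow> ('k,'a) AAA mult \<Rightarrow> ('k,'a) AA mult \<Rightarrow> ('k,'a) AAA mult" where
  "mext s m \<gamma> e x = (THE y. y \<in> MAAA s m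
      \<and> (\<forall>u\<in>AA s. mmul y (\<gamma> u) = \<gamma> (fst x u) \<and> mmul (\<gamma> u) y = \<gamma> (snd x u))
      \<and> mmul y e = y \<and> mmul e y = y)"

definition wmba :: "('k::field \<Rightarrow> 'a::ab_group_add \<Rightarrow> 'a) \<Rightarrow> ('a \<Rightarrow> 'a \<Rightarrow> 'a) \<Rightarrow> ('k,'a) AA mult
    \<Rightarrow> ('a \<Rightarrow> ('k,'a) AA mult) \<Rightarrow> ('a \<Rightarrow> 'k) \<Rightarrow> bool" where
  "wmba s m E \<Delta> \<epsilon> \<longleftrightarrow>
    \<comment> \<open>A is a (non-unital, associative) k-algebra\<close>
    vector_space s
    \<and> (\<forall>x y z. m (x + y) z = m x z + m y z \<and> m x (y + z) = m x y + m x z)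
    \<and> (\<forall>c x y. m (s c x) y = s c (m x y) \<and> m x (s c y) = s c (m x y))
    \<and> (\<forall>x y z. m (m x y) z = m x (m y z))
    \<comment> \<open>idempotent and non-degenerate\<close>
    \<and> (\<forall>a. \<exists>u\<in>AA s. muA s m u = a)
    \<and> (\<forall>b. (\<forall>a. m a b = 0) \<longrightarrow> b = 0) \<and> (\<forall>b. (\<forall>a. m b a = 0) \<longrightarrow> b = 0)
    \<comment> \<open>E idempotent, Delta multiplicative linear, epsilon linear\<close>
    \<and> E \<in> MAA s m \<and> mmul E E = E
    \<and> (\<forall>a. \<Delta> a \<in> MAA s m) \<and> lin_on s (msc tsc) UNIV \<Delta>
    \<and> (\<forall>a b. \<Delta> (m a b) = mmul (\<Delta> a) (\<Delta> b))
    \<and> lfun s \<epsilon>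
    \<comment> \<open>(i)\<close>
    \<and> (\<forall>a b. mmul (\<Delta> a) (mtA s oneA (embA m b)) \<in> embAA s m ` AA s)
    \<and> (\<forall>a b. mmul (mtA s (embA m a) oneA) (\<Delta> b) \<in> embAA s m ` AA s)
    \<comment> \<open>(ii)\<close>
    \<and> (\<forall>u\<in>AAA s. Rg s (T2 s m \<Delta>) id (idLg s id (T1 s m \<Delta>) u)
                 = idLg s id (T1 s m \<Delta>) (Rg s (T2 s m \<Delta>) id u))
    \<comment> \<open>(iii)\<close>
    \<and> (\<forall>u\<in>AA s. epsid s \<epsilon> (T1 s m \<Delta> u) = muA s m u \<and> ideps s \<epsilon> (T2 s m \<Delta> u) = muA s m u)
    \<comment> \<open>(iv)\<close>
    \<and> lspan tsc {fst (\<Delta> a) (ten s b b') | a b b'. True} = lspan tsc {fst E (ten s b b') | b b'. True}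
    \<and> lspan tsc {snd (\<Delta> a) (ten s b b') | a b b'. True} = lspan tsc {snd E (ten s b b') | b b'. True}
    \<comment> \<open>(v)\<close>
    \<and> mmul (Eone s E) (oneE s E) = mext s m (idtD s m \<Delta>) (oneE s E) E
    \<and> mext s m (idtD s m \<Delta>) (oneE s E) E = mext s m (Dtid s m \<Delta>) (Eone s E) E
    \<and> mmul (oneE s E) (Eone s E) = mext s m (idtD s m \<Delta>) (oneE s E) E
    \<comment> \<open>(vi)\<close>
    \<and> (\<forall>a b c. epsid s \<epsilon> (tmapA s id (m a) (fst E (ten s b c))) = epsid s \<epsilon> (fst (\<Delta> a) (ten s b c)))
    \<and> (\<forall>a b c. epsid s \<epsilon> (tmapA s id (\<lambda>y. m y c) (snd E (ten s a b))) = epsid s \<epsilon> (snd (\<Delta> c) (ten s a b)))"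

definition regular_wmba :: "('k::field \<Rightarrow> 'a::ab_group_add \<Rightarrow> 'a) \<Rightarrow> ('a \<Rightarrow> 'a \<Rightarrow> 'a) \<Rightarrow> ('k,'a) AA mult
    \<Rightarrow> ('a \<Rightarrow> ('k,'a) AA mult) \<Rightarrow> ('a \<Rightarrow> 'k) \<Rightarrow> bool" where
  "regular_wmba s m E \<Delta> \<epsilon> \<longleftrightarrow> wmba s m E \<Delta> \<epsilon>
    \<and> (\<forall>a b. mmul (mtA s oneA (embA m b)) (\<Delta> a) \<in> embAA s m ` AA s)
    \<and> (\<forall>a b. mmul (\<Delta> b) (mtA s (embA m a) oneA) \<in> embAA s m ` AA s)"

definition PiL :: "('k::field \<Rightarrow> 'a::ab_group_add \<Rightarrow> 'a) \<Rightarrow> ('a \<Rightarrow> 'a \<Rightarrow> 'a) \<Rightarrow> ('k,'a) AA mult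
    \<Rightarrow> ('a \<Rightarrow> ('k,'a) AA mult) \<Rightarrow> ('a \<Rightarrow> 'k) \<Rightarrow> 'a \<Rightarrow> 'a mult" where
  "PiL s m E \<Delta> \<epsilon> a = (\<lambda>b. epsid s \<epsilon> (T2 s m \<Delta> (ten s a b)), \<lambda>b. epsid s \<epsilon> (snd E (ten s a b)))"

definition PiR :: "('k::field \<Rightarrow> 'a::ab_group_add \<Rightarrow> 'a) \<Rightarrow> ('a \<Rightarrow> 'a \<Rightarrow> 'a) \<Rightarrow> ('k,'a) AA mult
    \<Rightarrow> ('a \<Rightarrow> ('k,'a) AA mult) \<Rightarrow> ('a \<Rightarrow> 'k) \<Rightarrow> 'a \<Rightarrow> 'a mult" where
  "PiR s m E \<Delta> \<epsilon> a = (\<lambda>b. ideps s \<epsilon> (fst E (ten s b a)), \<lambda>b. ideps s \<epsilon> (T1 s m \<Delta> (ten s b a)))"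

definition G1 :: "('k::field \<Rightarrow> 'a::ab_group_add \<Rightarrow> 'a) \<Rightarrow> ('a \<Rightarrow> 'a \<Rightarrow> 'a) \<Rightarrow> ('k,'a) AA mult
    \<Rightarrow> ('a \<Rightarrow> ('k,'a) AA mult) \<Rightarrow> ('a \<Rightarrow> 'k) \<Rightarrow> ('k,'a) AA \<Rightarrow> ('k,'a) AA" where
  "G1 s m E \<Delta> \<epsilon> = (THE g. lin_on tsc tsc (AA s) g \<and> (\<forall>u. u \<notin> AA s \<longrightarrow> g u = 0)
     \<and> (\<forall>a b c. g (ten s a (m b c))
          = tlA s (\<lambda>x y. ten s (snd (PiR s m E \<Delta> \<epsilon> x) a) y) (tw s (T4 s m \<Delta> (ten s c b)))))"

definition G2 :: "('k::field \<Rightarrow> 'a::ab_group_add \<Rightarrow> 'a) \<Rightarrow> ('a \<Rightarrow> 'a \<Rightarrow> 'a) \<Rightarrow> ('k,'a) AA mult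
    \<Rightarrow> ('a \<Rightarrow> ('k,'a) AA mult) \<Rightarrow> ('a \<Rightarrow> 'k) \<Rightarrow> ('k,'a) AA \<Rightarrow> ('k,'a) AA" where
  "G2 s m E \<Delta> \<epsilon> = (THE g. lin_on tsc tsc (AA s) g \<and> (\<forall>u. u \<notin> AA s \<longrightarrow> g u = 0)
     \<and> (\<forall>a b c. g (ten s (m a b) c)
          = tlA s (\<lambda>x y. ten s x (fst (PiL s m E \<Delta> \<epsilon> y) c)) (tw s (T3 s m \<Delta> (ten s b a)))))"

definition lin_AA_map :: "('k::field \<Rightarrow> 'a::ab_group_add \<Rightarrow> 'a) \<Rightarrow> (('k,'a) AA \<Rightarrow> ('k,'a) AA) \<Rightarrow> bool" where
  "lin_AA_map s R \<longleftrightarrow> lin_on tsc tsc (AA s) R \<and> R ` AA s \<subseteq> AA s \<and> (\<forall>u. u \<notin> AA s \<longrightarrow> R u = 0)"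

definition R_data :: "('k::field \<Rightarrow> 'a::ab_group_add \<Rightarrow> 'a) \<Rightarrow> ('a \<Rightarrow> 'a \<Rightarrow> 'a) \<Rightarrow> ('k,'a) AA mult
    \<Rightarrow> ('a \<Rightarrow> ('k,'a) AA mult) \<Rightarrow> ('a \<Rightarrow> 'k)
    \<Rightarrow> ((('k,'a) AA \<Rightarrow> ('k,'a) AA) \<times> (('k,'a) AA \<Rightarrow> ('k,'a) AA)) set" where
  "R_data s m E \<Delta> \<epsilon> = {(R1, R2). lin_AA_map s R1 \<and> lin_AA_map s R2
     \<and> (\<forall>u\<in>AA s. R1 (T1 s m \<Delta> u) = G1 s m E \<Delta> \<epsilon> u \<and> T1 s m \<Delta> (R1 u) = fst E u
                 \<and> R1 (T1 s m \<Delta> (R1 u)) = R1 u)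
     \<and> (\<forall>u\<in>AA s. R2 (T2 s m \<Delta> u) = G2 s m E \<Delta> \<epsilon> u \<and> T2 s m \<Delta> (R2 u) = snd E u
                 \<and> R2 (T2 s m \<Delta> (R2 u)) = R2 u)}"

definition AMA :: "('k::field \<Rightarrow> 'a::ab_group_add \<Rightarrow> 'a) \<Rightarrow> ('a \<Rightarrow> 'a \<Rightarrow> 'a) \<Rightarrow> ('k,'a,'a mult) tensor set" where
  "AMA s m = tsp s (msc s) UNIV (MA s m)"

definition embAM :: "('k::field \<Rightarrow> 'a::ab_group_add \<Rightarrow> 'a) \<Rightarrow> ('a \<Rightarrow> 'a \<Rightarrow> 'a) \<Rightarrow> ('k,'a,'a mult) tensor \<Rightarrow> ('k,'a) AA mult" where
  "embAM s m v = tlift s (msc s) UNIV (MA s m) (\<lambda>x n. mtA s (embA m x) n) v"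

definition asAM :: "('k::field \<Rightarrow> 'a::ab_group_add \<Rightarrow> 'a) \<Rightarrow> ('a \<Rightarrow> 'a \<Rightarrow> 'a) \<Rightarrow> ('k,'a) AA mult \<Rightarrow> ('k,'a,'a mult) tensor" where
  "asAM s m X = (THE v. v \<in> AMA s m \<and> embAM s m v = X)"

definition S_data :: "('k::field \<Rightarrow> 'a::ab_group_add \<Rightarrow> 'a) \<Rightarrow> ('a \<Rightarrow> 'a \<Rightarrow> 'a) \<Rightarrow> ('k,'a) AA mult
    \<Rightarrow> ('a \<Rightarrow> ('k,'a) AA mult) \<Rightarrow> ('a \<Rightarrow> 'k) \<Rightarrow> ('a \<Rightarrow> 'a mult) set" where
  "S_data s m E \<Delta> \<epsilon> = {S. lin_on s (msc s) UNIV S \<and> (\<forall>a. S a \<in> MA s m)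
     \<comment> \<open>(vii)\<close>
     \<and> (\<forall>a b c. T1 s m \<Delta> (tlA s (\<lambda>x y. ten s x (fst (S y) c)) (T2 s m \<Delta> (ten s a b)))
                = fst (\<Delta> a) (ten s b c))
     \<comment> \<open>(viii)\<close>
     \<and> (\<forall>a b c. T2 s m \<Delta> (tlA s (\<lambda>x y. ten s (snd (S x) a) y) (T1 s m \<Delta> (ten s b c)))
                = snd (\<Delta> c) (ten s a b))
     \<comment> \<open>(ix)\<close>
     \<and> (\<forall>a. tlift s (msc s) UNIV (MA s m) (\<lambda>x n. mmul (S x) n)
              (asAM s m (mmul E (mtA s (embA m a) oneA))) = S a)}"

end

theory Submission
  imports Defs
begin

text \<open>
Both sets have at most one element.  For (1) this is the generalised inverse property:
\<open>R = R T R\<close> depends only on \<open>R T = G\<close> and \<open>T R = E\<close>.  For (2), write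
\<open>E (a \<otimes> b) = T\<^sub>1 (\<Sum> p \<otimes> q)\<close>; then (viii) and (ix) force \<open>S(a) b = \<Sum> \<sqinter>\<^sup>R(p) q\<close>.
So it remains to pass from either side to the other.

Given \<open>R\<^sub>1, R\<^sub>2\<close>, put \<open>S(a) b = (\<epsilon> \<otimes> id) R\<^sub>1 (a \<otimes> b)\<close> and \<open>b S(a) = (id \<otimes> \<epsilon>) R\<^sub>2 (b \<otimes> a)\<close>.
An operator commuting with \<open>T, E, G\<close> commutes with \<open>R\<close>, so \<open>R\<^sub>2 \<otimes> id\<close> commutes with
\<open>id \<otimes> R\<^sub>1\<close>; evaluating \<open>\<mu> (\<mu> \<otimes> id) (R\<^sub>2 \<otimes> id) (id \<otimes> R\<^sub>1)\<close> in two ways shows that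
\<open>S(a)\<close> is a multiplier.
Given \<open>S\<close>, (vii) yields \<open>im E\<^sub>1 \<subseteq> im T\<^sub>1\<close> and (viii) yields \<open>ker T\<^sub>1 \<subseteq> ker G\<^sub>1\<close>, so that
\<open>R\<^sub>1 = G\<^sub>1 T\<^sub>1\<^sup>-\<^sup>1 E\<^sub>1\<close> is well defined.

The statements for index 2 are those for index 1 in the opposite co-opposite structure.
Therefore the argument runs in a locale whose axioms are closed under that duality; they follow
from (i)--(vi) once the extensions in (v) are known to exist.
\<close>

section \<open>Tensor products\<close>

text \<open>In Sweedler notation the model case is \<open>R\<^sub>1 (a \<otimes> b)\<close> = a1
  \<otimes> S(a2) b and \<open>R\<^sub>2 (a \<otimes> b)\<close> = a S(b1) \<otimes> b2. Applying
  \<epsilon> to the untouched leg leaves S(a) b and a S(b), which explains the formulas for S.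
  Likewise \<open>G\<^sub>1 (a \<otimes> b)\<close> = a1 \<otimes>
  \<open>\<sqinter>\<^sup>R(a2)\<close> b. One S serves both indices: for index 1, (vii) gives the
  image condition and (viii) the kernel condition, and for index 2 the roles are exchanged. Two
  obstacles shape the proof. Multipliers cannot be expanded into elements, so identities are
  multiplied by elements of A and the factor is cancelled by non-degeneracy. And (vi) speaks only of
  \<epsilon> \<otimes> id, while reversing the legs also calls for id \<otimes> \<epsilon>. The
  missing half is extracted from (v), by writing E(bc \<otimes> 1) and (da \<otimes> 1)E in terms of
  coproducts and slices of E.\<close>

declare plus_fun_apply [simp del] zero_fun_apply [simp del] uminus_apply [simp del] minus_apply [simp del]

lemma psum_Nil [simp]: "psum f [] = 0"
  by (simp add: psum_def)

lemma psum_Cons [simp]: "psum f (p # xs) = f (fst p) (snd p) + psum f xs"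
  by (simp add: psum_def case_prod_beta)

lemma psum_append [simp]: "psum f (xs @ ys) = psum f xs + psum f ys"
  by (induct xs) (simp_all add: add.assoc)

lemma psum_cong:
  "(\<And>x y. (x, y) \<in> set xs \<Longrightarrow> f x y = g x y) \<Longrightarrow> psum f xs = psum g xs"
  by (induct xs) auto

definition bilin_on where
  "bilin_on sv sw sz X Y \<beta> \<longleftrightarrow>
     (\<forall>y\<in>Y. lin_on sv sz X (\<lambda>x. \<beta> x y)) \<and> (\<forall>x\<in>X. lin_on sw sz Y (\<beta> x))"

text \<open>Tensors are functions and multipliers are pairs of functions, so pointwise evaluation of
  sums is off by default and invoked only where a proof descends to values.\<close>

lemmas fun_apply = plus_fun_apply zero_fun_apply uminus_apply minus_apply

lemma tsc_add: "tsc c (u + v) = tsc c u + tsc c v"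
  by (simp add: tsc_def fun_eq_iff fun_apply algebra_simps)

lemma vector_space_tsc: "vector_space tsc"
  by standard (auto simp: tsc_def fun_eq_iff fun_apply algebra_simps)

lemma vector_space_msc: "vector_space s \<Longrightarrow> vector_space (msc s)"
  by (simp add: vector_space_def msc_def fun_eq_iff fun_apply prod_eq_iff)

lemma lfun_linear:
  assumes "lfun (sv :: 'k::field \<Rightarrow> 'v::ab_group_add \<Rightarrow> 'v) f"
  shows lfun_add: "f (x + y) = f x + f y" and lfun_scale: "f (sv c x) = c * f x"
    and lfun_zero: "f 0 = 0" and lfun_uminus: "f (- x) = - f x"
proof -
  show add: "f (x + y) = f x + f y" for x y using assms by (simp add: lfun_def)
  show "f (sv c x) = c * f x" using assms by (simp add: lfun_def)
  show zero: "f 0 = 0" using add[of 0 0] by (simp only: add_0_left add_cancel_right_right)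
  show um: "f (- x) = - f x" for x using add[of x "- x"] zero by (simp add: eq_neg_iff_add_eq_0 add.commute)
qed

context vector_space
begin

lemma lfun_representation:
  assumes "independent B"
  shows "lfun scale (\<lambda>x. representation (extend_basis B) x b)"
  unfolding lfun_def
  using independent_extend_basis[OF assms] span_extend_basis[OF assms]
  by (auto simp: representation_add representation_scale)

text \<open>A nonzero v extends to a basis, and the coordinate at v is a functional with value 1
  there. This makes the encoding of tensors by values on functionals faithful.\<close>

lemma lfun_separates:
  assumes "\<And>f. lfun scale f \<Longrightarrow> f v = 0"
  shows "v = 0"
proof (rule ccontr)
  assume v: "v \<noteq> 0"
  then have ind: "independent {v}" by simp
  have "representation (extend_basis {v}) v v = 1"
    using representation_basis[OF independent_extend_basis[OF ind], of v]
      extend_basis_superset[OF ind] by auto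
  then show False using assms[OF lfun_representation[OF ind, of v]] by simp
qed

end

section \<open>Universal property of the functional model of V \<otimes> W\<close>

locale tprod = V: vector_space sv + W: vector_space sw
  for sv :: "'k::field \<Rightarrow> 'v::ab_group_add \<Rightarrow> 'v" and sw :: "'k \<Rightarrow> 'w::ab_group_add \<Rightarrow> 'w" +
  fixes X :: "'v set" and Y :: "'w set"
  assumes subX: "V.subspace X" and subY: "W.subspace Y"
begin

abbreviation tn (infixl "\<otimes>" 70) where "v \<otimes> w \<equiv> tens sv sw v w"
abbreviation TT where "TT \<equiv> tsp sv sw X Y"
abbreviation tl where "tl \<equiv> tlift sv sw X Y"
abbreviation bil where "bil sz \<beta> \<equiv> bilin_on sv sw sz X Y \<beta>"

lemma tens_add_left: "(x + x') \<otimes> y = x \<otimes> y + x' \<otimes> y"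
  and tens_add_right: "x \<otimes> (y + y') = x \<otimes> y + x \<otimes> y'"
  and tens_scale_left: "sv c x \<otimes> y = tsc c (x \<otimes> y)"
  and tens_scale_right: "x \<otimes> sw c y = tsc c (x \<otimes> y)"
  by (auto simp: tens_def tsc_def fun_eq_iff fun_apply lfun_def algebra_simps)

lemma tens_zero [simp]: "0 \<otimes> y = 0" "x \<otimes> 0 = 0"
  by (auto simp: tens_def fun_eq_iff fun_apply lfun_zero)

lemma tens_uminus: "(- x) \<otimes> y = - (x \<otimes> y)"
  by (auto simp: tens_def fun_eq_iff fun_apply lfun_uminus)

lemma psum_tens_apply:
  assumes "lfun sv f" "lfun sw g"
  shows "psum (tens sv sw) xs f g = psum (\<lambda>x y. f x * g y) xs"
  using assms by (induct xs) (auto simp: tens_def fun_apply)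

text \<open>Expand the first factors in a basis B of their span. The coordinate functionals isolate,
  for each b in B, a combination \<open>q b\<close> of the second factors. It is killed by all
  functionals, hence zero, and bilinearity gives \<Sum> \<beta>(x, y) = \<Sum> \<beta>(b,
  \<open>q b\<close>) = 0.\<close>

lemma psum_bilin_zero:
  assumes \<beta>: "bil sz \<beta>" and zs: "set zs \<subseteq> X \<times> Y" and z: "psum (tens sv sw) zs = 0"
  shows "psum \<beta> zs = (0::'z::ab_group_add)"
proof -
  \<comment> \<open>B is taken from the first factors themselves, so it stays inside X, where
    \<beta> is bilinear.\<close>
  obtain B where B: "B \<subseteq> fst ` set zs" "V.independent B" "fst ` set zs \<subseteq> V.span B"
    using V.maximal_independent_subset[of "fst ` set zs"] by blast
  have fin: "finite B" using B(1) finite_subset by blast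
  have BX: "B \<subseteq> X"
  proof
    fix b assume "b \<in> B"
    then obtain p where "p \<in> set zs" "b = fst p" using B(1) by auto
    then show "b \<in> X" using zs by (cases p) auto
  qed
  \<comment> \<open>Functionals live on the whole type, so the coordinates refer to an extension of
    B to a basis of that type.\<close>
  define r where "r b x = V.representation (V.extend_basis B) x b" for b x
  have lr: "lfun sv (r b)" for b unfolding r_def using V.lfun_representation[OF B(2)] .
  have rr: "r b x = V.representation B x b" if "x \<in> fst ` set zs" for b x
    unfolding r_def using V.representation_extend[OF V.independent_extend_basis[OF B(2)] _ V.extend_basis_superset[OF B(2)]]
      that B(3) by (metis subsetD)
  have xexp: "(\<Sum>b\<in>B. sv (r b x) b) = x" if "x \<in> fst ` set zs" for x
    using V.sum_representation_eq[OF B(2) _ fin subset_refl, of x] that B(3) rr[OF that] by auto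
  define q where "q b = psum (\<lambda>x y. sw (r b x) y) zs" for b
  have q0: "q b = 0" for b
  proof (rule W.lfun_separates)
    fix g assume g: "lfun sw g"
    have "g (psum (\<lambda>x y. sw (r b x) y) us) = psum (\<lambda>x y. r b x * g y) us" for us
      using g by (induct us) (simp_all add: lfun_zero lfun_add lfun_scale)
    then show "g (q b) = 0"
      using psum_tens_apply[OF lr g, of zs b] z by (simp add: q_def fun_apply)
  qed
  have badd1: "\<beta> (x + x') y = \<beta> x y + \<beta> x' y" if "x \<in> X" "x' \<in> X" "y \<in> Y" for x x' y
    using \<beta> that by (auto simp: bilin_on_def lin_on_def)
  have badd2: "\<beta> x (y + y') = \<beta> x y + \<beta> x y'" if "x \<in> X" "y \<in> Y" "y' \<in> Y" for x y y'
    using \<beta> that by (auto simp: bilin_on_def lin_on_def)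
  have bsc: "\<beta> (sv c x) y = \<beta> x (sw c y)" if "x \<in> X" "y \<in> Y" for c x y
    using \<beta> that by (auto simp: bilin_on_def lin_on_def)
  have z1: "\<beta> 0 y = 0" if "y \<in> Y" for y
    using badd1[of 0 0 y] that subX by (simp add: V.subspace_0)
  have z2: "\<beta> x 0 = 0" if "x \<in> X" for x
    using badd2[of x 0 0] that subY by (simp add: W.subspace_0)
  have e1: "\<beta> (\<Sum>b\<in>C. sv (c b) b) y = (\<Sum>b\<in>C. \<beta> b (sw (c b) y))"
    if C: "C \<subseteq> B" and y: "y \<in> Y" for C c y
    using finite_subset[OF C fin] C
  proof (induct C rule: finite_induct)
    case empty
    then show ?case by (simp add: z1 y)
  next
    case (insert d C)
    have "sv (c d) d \<in> X" using insert BX V.subspace_scale[OF subX] by auto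
    moreover have "(\<Sum>b\<in>C. sv (c b) b) \<in> X"
      using insert BX by (intro V.subspace_sum[OF subX] V.subspace_scale[OF subX]) auto
    ultimately show ?case using insert BX y by (auto simp: badd1 bsc)
  qed
  have psY: "psum (\<lambda>x y. sw (r b x) y) us \<in> Y" if "set us \<subseteq> X \<times> Y" for us b
    using that by (induct us) (auto simp: W.subspace_0[OF subY] W.subspace_add[OF subY] W.subspace_scale[OF subY])
  have "psum \<beta> us = (\<Sum>b\<in>B. \<beta> b (psum (\<lambda>x y. sw (r b x) y) us))" if "set us \<subseteq> set zs" for us
    using that
  proof (induct us)
    case Nil
    then show ?case using BX by (simp add: z2 subset_eq)
  next
    case (Cons p us)
    obtain x y where p: "p = (x, y)" by fastforce
    have y: "y \<in> Y" and x: "x \<in> fst ` set zs" using Cons.prems p zs by force+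
    have "\<beta> x y = (\<Sum>b\<in>B. \<beta> b (sw (r b x) y))"
      using e1[OF subset_refl y, of "\<lambda>b. r b x"] xexp[OF x] by simp
    moreover have "\<beta> b (sw (r b x) y + psum (\<lambda>x y. sw (r b x) y) us)
        = \<beta> b (sw (r b x) y) + \<beta> b (psum (\<lambda>x y. sw (r b x) y) us)" if "b \<in> B" for b
      using that BX y Cons.prems zs
      by (intro badd2) (auto simp: W.subspace_scale[OF subY] intro!: psY)
    ultimately show ?case using Cons by (simp add: p sum.distrib)
  qed
  from this[OF subset_refl] show ?thesis
    using q0 BX by (simp add: q_def[symmetric] z2 subset_eq)
qed

text \<open>With the minus sign moved into the first factors, the difference of the two lists is
  again a list, and it represents zero. Hence \<open>tlift\<close> does not depend on the chosen
  representation.\<close>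

lemma psum_bilin_cong:
  assumes \<beta>: "bil sz \<beta>" and xs: "set xs \<subseteq> X \<times> Y" and ys: "set ys \<subseteq> X \<times> Y"
    and e: "psum (tens sv sw) xs = psum (tens sv sw) ys"
  shows "psum \<beta> xs = (psum \<beta> ys :: 'z::ab_group_add)"
proof -
  define n :: "('v \<times> 'w) list \<Rightarrow> ('v \<times> 'w) list" where "n = map (\<lambda>(x, y). (- x, y))"
  have 1: "psum (tens sv sw) (n ys) = - psum (tens sv sw) ys"
    unfolding n_def by (induct ys) (auto simp: tens_uminus)
  have um: "\<beta> (- x) y = - \<beta> x y" if "x \<in> X" "y \<in> Y" for x y
  proof -
    have "\<beta> (x' + x'') y = \<beta> x' y + \<beta> x'' y" if "x' \<in> X" "x'' \<in> X" for x' x''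
      using \<beta> that \<open>y \<in> Y\<close> by (auto simp: bilin_on_def lin_on_def)
    from this[of 0 0] this[of x "- x"] show ?thesis
      using that by (simp add: V.subspace_0[OF subX] V.subspace_neg[OF subX] eq_neg_iff_add_eq_0 add.commute)
  qed
  have 2: "psum \<beta> (n ys) = - psum \<beta> ys" using ys
    unfolding n_def by (induct ys) (auto simp: um)
  have "psum \<beta> (xs @ n ys) = 0"
  proof (rule psum_bilin_zero[OF \<beta>])
    show "set (xs @ n ys) \<subseteq> X \<times> Y"
      using xs ys by (auto simp: n_def V.subspace_neg[OF subX])
    show "psum (tens sv sw) (xs @ n ys) = 0" by (simp add: 1 e)
  qed
  then show ?thesis by (simp add: 2)
qed

lemma trep:
  assumes "u \<in> TT"
  shows "set (trep sv sw X Y u) \<subseteq> X \<times> Y" "psum (tens sv sw) (trep sv sw X Y u) = u"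
proof -
  have "\<exists>xs. set xs \<subseteq> X \<times> Y \<and> u = psum (tens sv sw) xs" using assms by (auto simp: tsp_def)
  from someI_ex[OF this]
  show "set (trep sv sw X Y u) \<subseteq> X \<times> Y" "psum (tens sv sw) (trep sv sw X Y u) = u"
    unfolding trep_def by simp_all
qed

lemma tl_psum:
  assumes "bil sz \<beta>" "set xs \<subseteq> X \<times> Y"
  shows "tl \<beta> (psum (tens sv sw) xs) = (psum \<beta> xs :: 'z::ab_group_add)"
proof -
  have "psum (tens sv sw) xs \<in> TT" using assms by (auto simp: tsp_def)
  from trep[OF this] show ?thesis
    unfolding tlift_def using psum_bilin_cong[OF assms(1)] assms(2) by blast
qed

lemma tl_tens:
  "bil sz \<beta> \<Longrightarrow> x \<in> X \<Longrightarrow> y \<in> Y \<Longrightarrow> tl \<beta> (x \<otimes> y) = (\<beta> x y :: 'z::ab_group_add)"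
  using tl_psum[of sz \<beta> "[(x, y)]"] by simp

lemma tl_add:
  assumes "bil sz \<beta>" "u \<in> TT" "v \<in> TT"
  shows "tl \<beta> (u + v) = (tl \<beta> u + tl \<beta> v :: 'z::ab_group_add)"
proof -
  obtain xs ys where "u = psum (tens sv sw) xs" "set xs \<subseteq> X \<times> Y"
    "v = psum (tens sv sw) ys" "set ys \<subseteq> X \<times> Y" using assms by (auto simp: tsp_def)
  then show ?thesis using tl_psum[OF assms(1), of "xs @ ys"] tl_psum[OF assms(1)] by simp
qed

lemma tens_in [simp, intro]: "x \<in> X \<Longrightarrow> y \<in> Y \<Longrightarrow> x \<otimes> y \<in> TT"
  by (auto simp: tsp_def intro!: exI[of _ "[(x, y)]"])

lemma TT_add [simp, intro]: "u \<in> TT \<Longrightarrow> v \<in> TT \<Longrightarrow> u + v \<in> TT"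
  unfolding tsp_def by clarsimp (metis psum_append set_append Un_subset_iff)

lemma TT_induct [consumes 1, case_names tens add]:
  assumes u: "u \<in> TT" and 1: "\<And>x y. x \<in> X \<Longrightarrow> y \<in> Y \<Longrightarrow> P (x \<otimes> y)"
    and 2: "\<And>u v. u \<in> TT \<Longrightarrow> v \<in> TT \<Longrightarrow> P u \<Longrightarrow> P v \<Longrightarrow> P (u + v)"
  shows "P u"
proof -
  \<comment> \<open>Zero is the simple tensor 0 \<otimes> 0, so the first case also covers the empty
    list.\<close>
  have z: "P 0" using 1[OF V.subspace_0[OF subX] W.subspace_0[OF subY]] by simp
  obtain xs where xs: "u = psum (tens sv sw) xs" "set xs \<subseteq> X \<times> Y" using u by (auto simp: tsp_def)
  have "P (psum (tens sv sw) ys) \<and> psum (tens sv sw) ys \<in> TT" if "set ys \<subseteq> X \<times> Y" for ys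
    using that
  proof (induct ys)
    case Nil
    have "0 \<otimes> 0 \<in> TT" by (intro tens_in V.subspace_0[OF subX] W.subspace_0[OF subY])
    then show ?case using z by simp
  next
    case (Cons p ys)
    then show ?case by (auto intro!: 2 1)
  qed
  then show ?thesis using xs by blast
qed

lemma TT_zero [simp, intro]: "0 \<in> TT"
  using tens_in[OF V.subspace_0[OF subX] W.subspace_0[OF subY]] by simp

lemma TT_scale [simp, intro]: "u \<in> TT \<Longrightarrow> tsc c u \<in> TT"
proof (induct rule: TT_induct)
  case (tens x y)
  then show ?case using tens_in[OF V.subspace_scale[OF subX], of x y c] by (simp add: tens_scale_left)
next
  case (add u v)
  then show ?case by (simp add: tsc_add)
qed

lemma subspace_TT: "module.subspace tsc TT"
proof -
  interpret vector_space "tsc :: 'k \<Rightarrow> ('k,'v,'w) tensor \<Rightarrow> _" by (rule vector_space_tsc)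
  show ?thesis by (auto simp: subspace_def)
qed

lemma tl_scale:
  assumes \<beta>: "bil sz \<beta>" and sz: "\<And>z z'. sz c (z + z') = sz c z + sz c z'" and u: "u \<in> TT"
  shows "tl \<beta> (tsc c u) = (sz c (tl \<beta> u) :: 'z::ab_group_add)"
  using u
proof (induct rule: TT_induct)
  case (tens x y)
  have "tl \<beta> (sv c x \<otimes> y) = \<beta> (sv c x) y"
    using tens by (intro tl_tens[OF \<beta>]) (auto simp: V.subspace_scale[OF subX])
  then show ?case using tens \<beta> by (simp add: tens_scale_left tl_tens[OF \<beta>] bilin_on_def lin_on_def)
next
  case (add u v)
  then show ?case by (simp add: tsc_add tl_add[OF \<beta>] sz)
qed

end

section \<open>Non-degenerate algebras and extension of multipliers\<close>

lemma lin_onD: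
  assumes "lin_on sx sy X f"
  shows lin_on_add: "x \<in> X \<Longrightarrow> y \<in> X \<Longrightarrow> f (x + y) = f x + f y"
    and lin_on_scale: "x \<in> X \<Longrightarrow> f (sx c x) = sy c (f x)"
  using assms by (auto simp: lin_on_def)

lemma bilin_onD:
  assumes "bilin_on sv sw sz X Y \<beta>"
  shows bilin_add_left: "x \<in> X \<Longrightarrow> x' \<in> X \<Longrightarrow> y \<in> Y \<Longrightarrow> \<beta> (x + x') y = \<beta> x y + \<beta> x' y"
    and bilin_add_right: "x \<in> X \<Longrightarrow> y \<in> Y \<Longrightarrow> y' \<in> Y \<Longrightarrow> \<beta> x (y + y') = \<beta> x y + \<beta> x y'"
    and bilin_scale_left: "x \<in> X \<Longrightarrow> y \<in> Y \<Longrightarrow> \<beta> (sv c x) y = sz c (\<beta> x y)"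
    and bilin_scale_right: "x \<in> X \<Longrightarrow> y \<in> Y \<Longrightarrow> \<beta> x (sw c y) = sz c (\<beta> x y)"
  using assms by (auto simp: bilin_on_def lin_on_def)

context vector_space
begin

lemma lin_on_zero:
  assumes "subspace X" "lin_on scale sy X f"
  shows "f 0 = (0::'z::ab_group_add)"
proof -
  have "0 \<in> X" using assms subspace_0 by blast
  then show ?thesis using lin_on_add[OF assms(2), of 0 0] by simp
qed

lemma lin_on_diff:
  assumes "subspace X" "lin_on scale sy X f" "x \<in> X" "y \<in> X"
  shows "f (x - y) = (f x - f y :: 'z::ab_group_add)"
  using lin_on_add[OF assms(2), of "x - y" y] assms subspace_diff by (simp add: eq_diff_eq)

lemma psum_in_subspace:
  "subspace X \<Longrightarrow> (\<And>p. p \<in> set xs \<Longrightarrow> h (fst p) (snd p) \<in> X) \<Longrightarrow> psum h xs \<in> X"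
  by (induct xs) (auto simp: subspace_0 subspace_add)

lemma lin_on_psum:
  assumes "subspace X" "lin_on scale sy X f" "\<And>p. p \<in> set xs \<Longrightarrow> h (fst p) (snd p) \<in> X"
  shows "f (psum h xs) = (psum (\<lambda>x y. f (h x y)) xs :: 'z::ab_group_add)"
  using assms(3)
proof (induct xs)
  case Nil
  then show ?case using lin_on_zero[OF assms(1,2)] by simp
next
  case (Cons p xs)
  then show ?case using psum_in_subspace[OF assms(1), of xs h]
    by (simp add: lin_on_add[OF assms(2)])
qed

end

locale nondeg_alg = vector_space sx for sx :: "'k::field \<Rightarrow> 'x::ab_group_add \<Rightarrow> 'x" +
  fixes X :: "'x set" and mx :: "'x \<Rightarrow> 'x \<Rightarrow> 'x" (infixl "\<cdot>" 70)
  assumes sub: "subspace X"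
    and mul_in [simp, intro]: "a \<in> X \<Longrightarrow> b \<in> X \<Longrightarrow> a \<cdot> b \<in> X"
    and mul_bilin: "bilin_on sx sx sx X X mx"
    and mul_assoc: "a \<in> X \<Longrightarrow> b \<in> X \<Longrightarrow> c \<in> X \<Longrightarrow> a \<cdot> b \<cdot> c = a \<cdot> (b \<cdot> c)"
    and nondeg_left: "b \<in> X \<Longrightarrow> (\<And>a. a \<in> X \<Longrightarrow> a \<cdot> b = 0) \<Longrightarrow> b = 0"
    and nondeg_right: "b \<in> X \<Longrightarrow> (\<And>a. a \<in> X \<Longrightarrow> b \<cdot> a = 0) \<Longrightarrow> b = 0"
    and idem: "a \<in> X \<Longrightarrow> \<exists>xs. set xs \<subseteq> X \<times> X \<and> a = psum mx xs"
begin

lemmas mul_simps = bilin_onD[OF mul_bilin]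

lemma in_simps [simp, intro]:
  "0 \<in> X" "a \<in> X \<Longrightarrow> b \<in> X \<Longrightarrow> a + b \<in> X" "a \<in> X \<Longrightarrow> b \<in> X \<Longrightarrow> a - b \<in> X" "a \<in> X \<Longrightarrow> sx c a \<in> X"
  using sub by (auto simp: subspace_0 subspace_add subspace_diff subspace_scale)

lemma lin_mul_left: "a \<in> X \<Longrightarrow> lin_on sx sx X (mx a)"
  and lin_mul_right: "a \<in> X \<Longrightarrow> lin_on sx sx X (\<lambda>b. b \<cdot> a)"
  using mul_bilin by (auto simp: bilin_on_def)

lemma cancel_left:
  assumes "b \<in> X" "c \<in> X" "\<And>a. a \<in> X \<Longrightarrow> a \<cdot> b = a \<cdot> c"
  shows "b = c"
  using nondeg_left[of "b - c"] assms by (simp add: lin_on_diff[OF sub lin_mul_left])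

lemma cancel_right:
  assumes "b \<in> X" "c \<in> X" "\<And>a. a \<in> X \<Longrightarrow> b \<cdot> a = c \<cdot> a"
  shows "b = c"
  using nondeg_right[of "b - c"] assms by (simp add: lin_on_diff[OF sub lin_mul_right])

abbreviation M where "M \<equiv> multipliers sx mx X"

lemma multD:
  assumes "x \<in> M"
  shows mult_out: "a \<notin> X \<Longrightarrow> fst x a = 0" "a \<notin> X \<Longrightarrow> snd x a = 0"
    and mult_in [simp]: "a \<in> X \<Longrightarrow> fst x a \<in> X" "a \<in> X \<Longrightarrow> snd x a \<in> X"
    and mult_lin: "lin_on sx sx X (fst x)" "lin_on sx sx X (snd x)"
    and mult_link: "a \<in> X \<Longrightarrow> b \<in> X \<Longrightarrow> a \<cdot> fst x b = snd x a \<cdot> b"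
  using assms by (auto simp: multipliers_def)

text \<open>Linearity comes for free: both sides of the link are linear in the argument not acted
  upon, and non-degeneracy cancels the other one.\<close>

lemma multI:
  assumes out: "\<And>a. a \<notin> X \<Longrightarrow> l a = 0" "\<And>a. a \<notin> X \<Longrightarrow> r a = 0"
    and l: "\<And>a. a \<in> X \<Longrightarrow> l a \<in> X" and r: "\<And>a. a \<in> X \<Longrightarrow> r a \<in> X"
    and link: "\<And>a b. a \<in> X \<Longrightarrow> b \<in> X \<Longrightarrow> a \<cdot> l b = r a \<cdot> b"
  shows "(l, r) \<in> M"
proof -
  have "l (a + b) = l a + l b" if "a \<in> X" "b \<in> X" for a b
    by (rule cancel_left) (use that l r link in \<open>auto simp: mul_simps\<close>)
  moreover have "l (sx c a) = sx c (l a)" if "a \<in> X" for a c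
    by (rule cancel_left) (use that l r link in \<open>auto simp: mul_simps\<close>)
  moreover have "r (a + b) = r a + r b" if "a \<in> X" "b \<in> X" for a b
    by (rule cancel_right) (use that l r link[symmetric] in \<open>auto simp: mul_simps\<close>)
  moreover have "r (sx c a) = sx c (r a)" if "a \<in> X" for a c
    by (rule cancel_right) (use that l r link[symmetric] in \<open>auto simp: mul_simps\<close>)
  ultimately show ?thesis using assms unfolding multipliers_def lin_on_def by auto
qed

lemma mult_mul_left: "x \<in> M \<Longrightarrow> a \<in> X \<Longrightarrow> b \<in> X \<Longrightarrow> fst x (a \<cdot> b) = fst x a \<cdot> b"
  by (rule cancel_left) (simp_all add: mult_link mul_assoc[symmetric])

lemma mult_mul_right: "x \<in> M \<Longrightarrow> a \<in> X \<Longrightarrow> b \<in> X \<Longrightarrow> snd x (a \<cdot> b) = a \<cdot> snd x b"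
  by (rule cancel_right) (simp_all add: mult_link[symmetric] mul_assoc)

text \<open>With a in front, both sides become \<open>snd y (snd x a \<cdot> w)\<close>. Applied to
  E on legs 2, 3 and E on legs 1, 2, this gives one of the interchange laws needed later.\<close>

lemma mult_commute: "x \<in> M \<Longrightarrow> y \<in> M \<Longrightarrow> w \<in> X \<Longrightarrow> fst x (snd y w) = snd y (fst x w)"
  by (rule cancel_left) (simp_all add: mult_link mult_mul_right[symmetric])

lemma mult_eqI:
  assumes "x \<in> M" "y \<in> M" "\<And>a. a \<in> X \<Longrightarrow> fst x a = fst y a"
  shows "x = y"
proof (rule prod_eqI)
  show "fst x = fst y" using assms mult_out by (metis ext)
  have "snd x a = snd y a" if "a \<in> X" for a
    by (rule cancel_right) (use assms that in \<open>auto simp: mult_link[symmetric]\<close>)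
  then show "snd x = snd y" using assms mult_out by (metis ext)
qed

lemma mmul_in [simp]: "x \<in> M \<Longrightarrow> y \<in> M \<Longrightarrow> mmul x y \<in> M"
  unfolding mmul_def
  by (rule multI) (auto simp: mult_out mult_link lin_on_zero[OF sub mult_lin(1)] lin_on_zero[OF sub mult_lin(2)])

lemma memb_inj: "a \<in> X \<Longrightarrow> b \<in> X \<Longrightarrow> memb mx X a = memb mx X b \<Longrightarrow> a = b"
  by (rule cancel_right) (auto simp: memb_def rst_def fun_eq_iff split: if_splits)

lemma mult_psum:
  assumes "x \<in> M" "\<And>p. p \<in> set xs \<Longrightarrow> h (fst p) (snd p) \<in> X"
  shows "fst x (psum h xs) = psum (\<lambda>a b. fst x (h a b)) xs"
    "snd x (psum h xs) = psum (\<lambda>a b. snd x (h a b)) xs"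
  by (rule lin_on_psum[OF sub mult_lin(1)[OF assms(1)]], erule assms(2))
    (rule lin_on_psum[OF sub mult_lin(2)[OF assms(1)]], erule assms(2))

text \<open>Here g is one component of \<gamma>, and p, q are the two components of the multiplier
  to be extended, in either order. If e z = \<Sum> g(u) w, the candidate value at z is \<Sum> g(p u)
  w. Applying g(v) to it gives g(q v) z, which no longer refers to the chosen sum.\<close>

lemma extension_half:
  assumes g: "\<And>u. u \<in> U \<Longrightarrow> lin_on sx sx X (g u)" "\<And>u w. u \<in> U \<Longrightarrow> w \<in> X \<Longrightarrow> g u w \<in> X"
    and e: "lin_on sx sx X e"
    and pq: "\<And>u. u \<in> U \<Longrightarrow> p u \<in> U" "\<And>u. u \<in> U \<Longrightarrow> q u \<in> U"
    and eg: "\<And>u w. u \<in> U \<Longrightarrow> e (g u w) = g u w" "\<And>u w. u \<in> U \<Longrightarrow> g u (e w) = g u w"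
    and gpq: "\<And>u v w. u \<in> U \<Longrightarrow> v \<in> U \<Longrightarrow> g v (g (p u) w) = g (q v) (g u w)"
    and xs: "set xs \<subseteq> U \<times> X" "e z = psum g xs"
  shows "psum (\<lambda>u. g (p u)) xs \<in> X \<and> e (psum (\<lambda>u. g (p u)) xs) = psum (\<lambda>u. g (p u)) xs
    \<and> (\<forall>v\<in>U. g v (psum (\<lambda>u. g (p u)) xs) = g (q v) z)" (is "?t \<in> X \<and> _")
proof (intro conjI ballI)
  have xs': "fst p \<in> U" "snd p \<in> X" if "p \<in> set xs" for p using xs(1) that by auto
  show "?t \<in> X" by (rule psum_in_subspace[OF sub]) (use xs' pq g in auto)
  show "e ?t = ?t"
    by (subst lin_on_psum[OF sub e]) (use xs' pq g eg in \<open>auto intro!: psum_cong\<close>)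
  fix v assume v: "v \<in> U"
  have "g v ?t = psum (\<lambda>u w. g v (g (p u) w)) xs"
    by (subst lin_on_psum[OF sub g(1)[OF v]]) (use xs' pq g in auto)
  also have "\<dots> = psum (\<lambda>u w. g (q v) (g u w)) xs"
    by (rule psum_cong) (use xs(1) v gpq in auto)
  also have "\<dots> = g (q v) (e z)" unfolding xs(2)
    by (subst lin_on_psum[OF sub g(1)[OF pq(2)[OF v]]]) (use xs' g in auto)
  finally show "g v ?t = g (q v) z" using eg v pq by simp
qed

text \<open>The value at z is characterised as the t in the range of e with \<gamma>(v) t =
  \<gamma>(v x) z for all v. \<open>extension_half\<close> provides such a t, and the operators
  \<gamma>(v) separate the range of e because X e is spanned by the X \<gamma>(u). The right
  component is built in the same way, and the two are linked afterwards.\<close>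

lemma multiplier_extension:
  fixes U :: "'u::ab_group_add set" and \<gamma> :: "'u \<Rightarrow> 'x mult"
  assumes U: "nondeg_alg su U mu" and x: "x \<in> multipliers su mu U"
    and \<gamma>: "\<And>u. u \<in> U \<Longrightarrow> \<gamma> u \<in> M"
    and mult: "\<And>u v. u \<in> U \<Longrightarrow> v \<in> U \<Longrightarrow> \<gamma> (mu u v) = mmul (\<gamma> u) (\<gamma> v)"
    and e: "e \<in> M" "mmul e e = e"
    and e\<gamma>: "\<And>u. u \<in> U \<Longrightarrow> mmul e (\<gamma> u) = \<gamma> u" "\<And>u. u \<in> U \<Longrightarrow> mmul (\<gamma> u) e = \<gamma> u"
    and eL: "\<And>w. w \<in> X \<Longrightarrow> \<exists>xs. set xs \<subseteq> U \<times> X \<and> fst e w = psum (\<lambda>u. fst (\<gamma> u)) xs"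
    and eR: "\<And>w. w \<in> X \<Longrightarrow> \<exists>xs. set xs \<subseteq> U \<times> X \<and> snd e w = psum (\<lambda>u. snd (\<gamma> u)) xs"
  shows "\<exists>!y. y \<in> M \<and> (\<forall>u\<in>U. mmul y (\<gamma> u) = \<gamma> (fst x u) \<and> mmul (\<gamma> u) y = \<gamma> (snd x u))
      \<and> mmul y e = y \<and> mmul e y = y" (is "\<exists>!y. ?P y")
proof -
  interpret U: nondeg_alg su U mu by (rule U)
  have ap: "fst (mmul p q) w = fst p (fst q w)" "snd (mmul p q) w = snd q (snd p w)" for p q :: "'z mult" and w
    by (simp_all add: mmul_def)
  have mf: "fst (\<gamma> (mu u v)) w = fst (\<gamma> u) (fst (\<gamma> v) w)"
      and ms: "snd (\<gamma> (mu u v)) w = snd (\<gamma> v) (snd (\<gamma> u) w)" if "u \<in> U" "v \<in> U" for u v w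
    using mult[OF that] by (simp_all add: mmul_def)
  define L where "L z t \<longleftrightarrow> t \<in> X \<and> fst e t = t \<and> (\<forall>v\<in>U. fst (\<gamma> v) t = fst (\<gamma> (snd x v)) z)" for z t
  define R where "R z t \<longleftrightarrow> t \<in> X \<and> snd e t = t \<and> (\<forall>v\<in>U. snd (\<gamma> v) t = snd (\<gamma> (fst x v)) z)" for z t
  have efst: "fst e (fst (\<gamma> u) w) = fst (\<gamma> u) w" "fst (\<gamma> u) (fst e w) = fst (\<gamma> u) w"
       "snd e (snd (\<gamma> u) w) = snd (\<gamma> u) w" "snd (\<gamma> u) (snd e w) = snd (\<gamma> u) w" if "u \<in> U" for u w
    using e\<gamma>[OF that] by (metis mmul_def comp_apply fst_conv snd_conv)+
  have eidem: "fst e (fst e w) = fst e w" "snd e (snd e w) = snd e w" for w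
    using e(2) by (metis mmul_def comp_apply fst_conv snd_conv)+
  note [simp] = U.mult_in[OF x] \<gamma> mult_in[OF \<gamma>] mult_in[OF e(1)]
  have Lh: "L z (psum (\<lambda>u. fst (\<gamma> (fst x u))) xs)"
    if "set xs \<subseteq> U \<times> X" "fst e z = psum (\<lambda>u. fst (\<gamma> u)) xs" for z xs
    unfolding L_def
    by (rule extension_half[where g = "\<lambda>u. fst (\<gamma> u)" and p = "fst x" and q = "snd x" and e = "fst e" and U = U])
      (simp_all add: that mult_lin[OF \<gamma>] mult_lin[OF e(1)] efst mf[symmetric] U.mult_link[OF x])
  have Rh: "R z (psum (\<lambda>u. snd (\<gamma> (snd x u))) xs)"
    if "set xs \<subseteq> U \<times> X" "snd e z = psum (\<lambda>u. snd (\<gamma> u)) xs" for z xs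
    unfolding R_def
    by (rule extension_half[where g = "\<lambda>u. snd (\<gamma> u)" and p = "snd x" and q = "fst x" and e = "snd e" and U = U])
      (simp_all add: that mult_lin[OF \<gamma>] mult_lin[OF e(1)] efst ms[symmetric] U.mult_link[OF x])
  have L1: "\<exists>t. L z t" if "z \<in> X" for z using Lh eL[OF that] by blast
  have R1: "\<exists>t. R z t" if "z \<in> X" for z using Rh eR[OF that] by blast
  define l where "l z = (if z \<in> X then SOME t. L z t else 0)" for z
  define r where "r z = (if z \<in> X then SOME t. R z t else 0)" for z
  have l: "l z \<in> X" "fst e (l z) = l z" "\<And>v. v \<in> U \<Longrightarrow> fst (\<gamma> v) (l z) = fst (\<gamma> (snd x v)) z" if "z \<in> X" for z
    using someI_ex[OF L1[OF that]] that unfolding l_def L_def by auto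
  have r: "r z \<in> X" "snd e (r z) = r z" "\<And>v. v \<in> U \<Longrightarrow> snd (\<gamma> v) (r z) = snd (\<gamma> (fst x v)) z" if "z \<in> X" for z
    using someI_ex[OF R1[OF that]] that unfolding r_def R_def by auto
  \<comment> \<open>Write a e as a sum of terms w \<gamma>(u); then a d = (a e) d depends only on
    the vectors \<gamma>(u) d.\<close>
  have eqL: "t = t'" if "t \<in> X" "t' \<in> X" "fst e t = t" "fst e t' = t'"
      "\<And>v. v \<in> U \<Longrightarrow> fst (\<gamma> v) t = fst (\<gamma> v) t'" for t t'
  proof (rule cancel_left)
    fix a assume a: "a \<in> X"
    obtain xs where xs: "set xs \<subseteq> U \<times> X" "snd e a = psum (\<lambda>u. snd (\<gamma> u)) xs" using eR[OF a] by blast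
    have "a \<cdot> d = psum (\<lambda>u w. w \<cdot> fst (\<gamma> u) d) xs" if d: "d \<in> X" "fst e d = d" for d
    proof -
      have "a \<cdot> d = snd e a \<cdot> d" using a d mult_link[OF e(1), of a d] by simp
      also have "\<dots> = psum (\<lambda>u w. snd (\<gamma> u) w \<cdot> d) xs" unfolding xs(2)
        by (rule lin_on_psum[OF sub lin_mul_right]) (use d xs(1) in auto)
      also have "\<dots> = psum (\<lambda>u w. w \<cdot> fst (\<gamma> u) d) xs"
        by (rule psum_cong) (use xs(1) d in \<open>auto simp: mult_link[OF \<gamma>]\<close>)
      finally show ?thesis .
    qed
    moreover have "psum (\<lambda>u w. w \<cdot> fst (\<gamma> u) t) xs = psum (\<lambda>u w. w \<cdot> fst (\<gamma> u) t') xs"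
      by (rule psum_cong) (use xs(1) that(5) in auto)
    ultimately show "a \<cdot> t = a \<cdot> t'" using that by simp
  qed (use that in auto)
  have eqR: "t = t'" if "t \<in> X" "t' \<in> X" "snd e t = t" "snd e t' = t'"
      "\<And>v. v \<in> U \<Longrightarrow> snd (\<gamma> v) t = snd (\<gamma> v) t'" for t t'
  proof (rule cancel_right)
    fix a assume a: "a \<in> X"
    obtain xs where xs: "set xs \<subseteq> U \<times> X" "fst e a = psum (\<lambda>u. fst (\<gamma> u)) xs" using eL[OF a] by blast
    have "d \<cdot> a = psum (\<lambda>u w. snd (\<gamma> u) d \<cdot> w) xs" if d: "d \<in> X" "snd e d = d" for d
    proof -
      have "d \<cdot> a = d \<cdot> fst e a" using a d mult_link[OF e(1), of d a] by simp
      also have "\<dots> = psum (\<lambda>u w. d \<cdot> fst (\<gamma> u) w) xs" unfolding xs(2)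
        by (rule lin_on_psum[OF sub lin_mul_left]) (use d xs(1) in auto)
      also have "\<dots> = psum (\<lambda>u w. snd (\<gamma> u) d \<cdot> w) xs"
        by (rule psum_cong) (use xs(1) d in \<open>auto simp: mult_link[OF \<gamma>]\<close>)
      finally show ?thesis .
    qed
    moreover have "psum (\<lambda>u w. snd (\<gamma> u) t \<cdot> w) xs = psum (\<lambda>u w. snd (\<gamma> u) t' \<cdot> w) xs"
      by (rule psum_cong) (use xs(1) that(5) in auto)
    ultimately show "t \<cdot> a = t' \<cdot> a" using that by simp
  qed (use that in auto)
  \<comment> \<open>Expanding a e = \<Sum> w \<gamma>(u) brings both sides to \<Sum> w \<gamma>(u x)
    b.\<close>
  have link: "a \<cdot> l b = r a \<cdot> b" if a: "a \<in> X" and b: "b \<in> X" for a b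
  proof -
    obtain xs where xs: "set xs \<subseteq> U \<times> X" "snd e a = psum (\<lambda>u. snd (\<gamma> u)) xs" using eR[OF a] by blast
    have ra: "r a = psum (\<lambda>u. snd (\<gamma> (snd x u))) xs"
      by (rule eqR) (use Rh[OF xs] r[OF a] in \<open>simp_all add: R_def\<close>)
    have "a \<cdot> l b = snd e a \<cdot> l b" using a b l mult_link[OF e(1), of a "l b"] by simp
    also have "\<dots> = psum (\<lambda>u w. snd (\<gamma> u) w \<cdot> l b) xs" unfolding xs(2)
      by (rule lin_on_psum[OF sub lin_mul_right]) (use l b xs(1) in auto)
    also have "\<dots> = psum (\<lambda>u w. snd (\<gamma> (snd x u)) w \<cdot> b) xs"
      by (rule psum_cong) (use xs(1) b l in \<open>auto simp: mult_link[OF \<gamma>, symmetric]\<close>)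
    also have "\<dots> = r a \<cdot> b" unfolding ra
      by (rule lin_on_psum[OF sub lin_mul_right, symmetric]) (use b xs(1) in auto)
    finally show ?thesis .
  qed
  define y where "y = (l, r)"
  have lr: "fst y = l" "snd y = r" by (simp_all add: y_def)
  have yM: "y \<in> M" unfolding y_def by (rule multI) (use l r link in \<open>auto simp: l_def r_def\<close>)
  have y1: "mmul (\<gamma> u) y = \<gamma> (snd x u)" if "u \<in> U" for u
    by (rule mult_eqI) (use that yM in \<open>auto simp: ap lr l\<close>)
  have y2: "mmul y (\<gamma> u) = \<gamma> (fst x u)" if u: "u \<in> U" for u
  proof (rule mult_eqI)
    fix w assume w: "w \<in> X"
    have "l (fst (\<gamma> u) w) = fst (\<gamma> (fst x u)) w"
    proof (rule eqL)
      fix v assume v: "v \<in> U"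
      have "fst (\<gamma> v) (l (fst (\<gamma> u) w)) = fst (\<gamma> (snd x v)) (fst (\<gamma> u) w)" using u v w l by simp
      also have "\<dots> = fst (\<gamma> v) (fst (\<gamma> (fst x u)) w)"
        using u v by (simp add: mf[symmetric] U.mult_link[OF x])
      finally show "fst (\<gamma> v) (l (fst (\<gamma> u) w)) = fst (\<gamma> v) (fst (\<gamma> (fst x u)) w)" .
    qed (use u w l efst in auto)
    then show "fst (mmul y (\<gamma> u)) w = fst (\<gamma> (fst x u)) w" by (simp add: y_def mmul_def)
  qed (use u yM in auto)
  have y3: "mmul e y = y" by (rule mult_eqI) (use e yM in \<open>auto simp: ap lr l\<close>)
  have y4: "mmul y e = y"
  proof (rule mult_eqI)
    fix w assume w: "w \<in> X"
    have "l (fst e w) = l w" by (rule eqL) (use w l efst in auto)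
    then show "fst (mmul y e) w = fst y w" by (simp add: y_def mmul_def)
  qed (use e yM in auto)
  show ?thesis
  proof (rule ex1I)
    show "?P y" using yM y1 y2 y3 y4 by blast
    fix y' assume y': "?P y'"
    \<comment> \<open>Any solution z satisfies z w = z (e w), and z \<gamma>(u) = \<gamma>(x u)
      expresses this without z.\<close>
    have key: "fst z w = psum (\<lambda>u. fst (\<gamma> (fst x u))) xs"
      if "?P z" "w \<in> X" "set xs \<subseteq> U \<times> X" "fst e w = psum (\<lambda>u. fst (\<gamma> u)) xs" for z w xs
    proof -
      have "fst z w = fst z (fst e w)" using that(1) by (metis mmul_def comp_apply fst_conv)
      also have "\<dots> = psum (\<lambda>u w. fst z (fst (\<gamma> u) w)) xs" unfolding that(4)
        by (rule mult_psum) (use that in auto)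
      also have "\<dots> = psum (\<lambda>u. fst (\<gamma> (fst x u))) xs"
      proof (rule psum_cong)
        fix u w assume "(u, w) \<in> set xs"
        then have "mmul z (\<gamma> u) = \<gamma> (fst x u)" using that by auto
        then show "fst z (fst (\<gamma> u) w) = fst (\<gamma> (fst x u)) w" by (metis mmul_def comp_apply fst_conv)
      qed
      finally show ?thesis .
    qed
    show "y' = y"
    proof (rule mult_eqI)
      fix w assume w: "w \<in> X"
      obtain xs where "set xs \<subseteq> U \<times> X" "fst e w = psum (\<lambda>u. fst (\<gamma> u)) xs" using eL[OF w] by blast
      then show "fst y' w = fst y w" using key[OF y' w] key[of y w] yM y1 y2 y3 y4 w by simp
    qed (use y' yM in auto)
  qed
qed

end

section \<open>Separating families on tensor products\<close>

lemma lfun_psum_scale: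
  fixes sv :: "'k::field \<Rightarrow> 'v::ab_group_add \<Rightarrow> 'v"
  shows "lfun sv h \<Longrightarrow> h (psum (\<lambda>x y. sv (p x y) (q x y)) ys) = psum (\<lambda>x y. h (q x y) * p x y) ys"
  by (induct ys) (simp_all add: lfun_zero lfun_add lfun_scale mult.commute)

context vector_space
begin

text \<open>Collect the sum into the vector v = \<Sum> c q. Functionals kill every \<phi> v, so v =
  0, and f(v) is the sum in question. In a tensor this treats one factor while the other is frozen
  in the scalars c.\<close>

lemma psum_separates:
  assumes X: "subspace X"
    and \<Phi>: "\<And>\<phi>. \<phi> \<in> \<Phi> \<Longrightarrow> lin_on scale scale X \<phi>" "\<And>x. x \<in> X \<Longrightarrow> (\<And>\<phi>. \<phi> \<in> \<Phi> \<Longrightarrow> \<phi> x = 0) \<Longrightarrow> x = 0"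
    and q: "\<And>p. p \<in> set xs \<Longrightarrow> q (fst p) (snd p) \<in> X"
    and z: "\<And>h \<phi>. lfun scale h \<Longrightarrow> \<phi> \<in> \<Phi> \<Longrightarrow> psum (\<lambda>x y. h (\<phi> (q x y)) * c x y) xs = 0"
    and f: "lfun scale f"
  shows "psum (\<lambda>x y. f (q x y) * c x y) xs = 0"
proof -
  define v where "v = psum (\<lambda>x y. scale (c x y) (q x y)) xs"
  have "\<phi> v = 0" if \<phi>: "\<phi> \<in> \<Phi>" for \<phi>
  proof (rule lfun_separates)
    fix h assume h: "lfun scale h"
    have "\<phi> v = psum (\<lambda>x y. \<phi> (scale (c x y) (q x y))) xs" unfolding v_def
      by (rule lin_on_psum[OF X \<Phi>(1)[OF \<phi>]]) (use q in \<open>auto simp: subspace_scale[OF X]\<close>)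
    also have "\<dots> = psum (\<lambda>x y. scale (c x y) (\<phi> (q x y))) xs"
      by (rule psum_cong) (use q in \<open>force simp: lin_onD[OF \<Phi>(1)[OF \<phi>]]\<close>)
    also have "h \<dots> = psum (\<lambda>x y. h (\<phi> (q x y)) * c x y) xs" by (rule lfun_psum_scale[OF h])
    finally show "h (\<phi> v) = 0" using z[OF h \<phi>] by simp
  qed
  moreover have "v \<in> X" unfolding v_def
    by (rule psum_in_subspace[OF X]) (use q in \<open>auto simp: subspace_scale[OF X]\<close>)
  ultimately have "v = 0" using \<Phi>(2) by blast
  then show ?thesis using lfun_psum_scale[OF f, of c q xs] lfun_zero[OF f] by (simp add: v_def)
qed

end

context tprod
begin

lemma bil_tens:
  assumes "lin_on sv sv X \<phi>" "lin_on sw sw Y \<psi>"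
  shows "bil tsc (\<lambda>x y. \<phi> x \<otimes> \<psi> y)"
  unfolding bilin_on_def
  by (intro conjI ballI; unfold lin_on_def;
      simp add: lin_onD[OF assms(1)] lin_onD[OF assms(2)]
        tens_add_left tens_add_right tens_scale_left tens_scale_right)

abbreviation tmap where "tmap \<phi> \<psi> \<equiv> tl (\<lambda>x y. \<phi> x \<otimes> \<psi> y)"

text \<open>The families are removed one factor at a time: the sums of f(\<phi> x) g(\<psi> y)
  vanish, hence those of f(x) g(\<psi> y), hence those of f(x) g(y), and the last ones determine
  u.\<close>

lemma tmap_separates:
  assumes \<Phi>: "\<And>\<phi>. \<phi> \<in> \<Phi> \<Longrightarrow> lin_on sv sv X \<phi>" "\<And>x. x \<in> X \<Longrightarrow> (\<And>\<phi>. \<phi> \<in> \<Phi> \<Longrightarrow> \<phi> x = 0) \<Longrightarrow> x = 0"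
    and \<Psi>: "\<And>\<psi>. \<psi> \<in> \<Psi> \<Longrightarrow> lin_on sw sw Y \<psi>" "\<And>y. y \<in> Y \<Longrightarrow> (\<And>\<psi>. \<psi> \<in> \<Psi> \<Longrightarrow> \<psi> y = 0) \<Longrightarrow> y = 0"
    and u: "u \<in> TT" "\<And>\<phi> \<psi>. \<phi> \<in> \<Phi> \<Longrightarrow> \<psi> \<in> \<Psi> \<Longrightarrow> tmap \<phi> \<psi> u = 0"
  shows "u = 0"
proof -
  obtain xs where xs: "u = psum (tens sv sw) xs" "set xs \<subseteq> X \<times> Y" using u(1) by (auto simp: tsp_def)
  have 1: "psum (\<lambda>x y. f (\<phi> x) * g (\<psi> y)) xs = 0"
    if "lfun sv f" "lfun sw g" "\<phi> \<in> \<Phi>" "\<psi> \<in> \<Psi>" for f g \<phi> \<psi>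
  proof -
    have "psum (\<lambda>x y. \<phi> x \<otimes> \<psi> y) xs = 0"
      using u(2)[OF that(3,4)] tl_psum[OF bil_tens[OF \<Phi>(1)[OF that(3)] \<Psi>(1)[OF that(4)]] xs(2)] xs(1) by simp
    moreover
    have "psum (\<lambda>x y. \<phi> x \<otimes> \<psi> y) ys f g = psum (\<lambda>x y. f (\<phi> x) * g (\<psi> y)) ys" for ys
      using that by (induct ys) (auto simp: tens_def fun_apply)
    from this[of xs] calculation show ?thesis by (simp add: zero_fun_apply)
  qed
  have 2: "psum (\<lambda>x y. f x * g (\<psi> y)) xs = 0" if "lfun sv f" "lfun sw g" "\<psi> \<in> \<Psi>" for f g \<psi>
    by (rule V.psum_separates[OF subX \<Phi> _ _ that(1)]) (use 1 that xs(2) in auto)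
  have 3: "psum (\<lambda>x y. f x * g y) xs = 0" if f: "lfun sv f" and g: "lfun sw g" for f g
  proof -
    have "psum (\<lambda>x y. g y * f x) xs = 0"
      by (rule W.psum_separates[OF subY \<Psi> _ _ g]) (use 2[OF f] xs(2) in \<open>auto simp: mult.commute\<close>)
    then show ?thesis by (simp add: mult.commute)
  qed
  have nol: "psum (tens sv sw) ys f g = 0" if "\<not> (lfun sv f \<and> lfun sw g)" for ys f g
    using that by (induct ys) (auto simp: tens_def fun_apply)
  show ?thesis
  proof (intro ext)
    fix f g show "u f g = 0 f g"
      using 3[of f g] nol[of f g xs] psum_tens_apply[of f g xs] xs(1)
      by (cases "lfun sv f \<and> lfun sw g") (auto simp: fun_apply)
  qed
qed

end

section \<open>Tensor products of non-degenerate algebras\<close>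

locale nondeg_alg_pair = A: nondeg_alg sv X mv + B: nondeg_alg sw Y mw
  for sv :: "'k::field \<Rightarrow> 'v::ab_group_add \<Rightarrow> 'v" and X mv
    and sw :: "'k \<Rightarrow> 'w::ab_group_add \<Rightarrow> 'w" and Y mw
begin

sublocale tprod sv sw X Y
  by unfold_locales (rule A.sub B.sub)+

abbreviation tm (infixl "\<bullet>" 70) where "u \<bullet> v \<equiv> tmul sv sw X Y mv mw u v"

lemma tmul_tl: "u \<bullet> v = tl (\<lambda>a b. tl (\<lambda>c d. mv a c \<otimes> mw b d) v) u"
  by (simp add: tmul_def tlift_def)

lemma bil_inner:
  assumes "a \<in> X" "b \<in> Y" shows "bil tsc (\<lambda>c d. mv a c \<otimes> mw b d)"
  by (rule bil_tens) (use assms in \<open>auto simp: A.lin_mul_left B.lin_mul_left\<close>)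

lemmas inner = tl_tens[OF bil_inner] tl_add[OF bil_inner]

lemma bil_outer:
  assumes v: "v \<in> TT" shows "bil tsc (\<lambda>a b. tl (\<lambda>c d. mv a c \<otimes> mw b d) v)"
proof -
  have "tl (\<lambda>c d. mv (a + a') c \<otimes> mw b d) v = tl (\<lambda>c d. mv a c \<otimes> mw b d) v + tl (\<lambda>c d. mv a' c \<otimes> mw b d) v"
    if "a \<in> X" "a' \<in> X" "b \<in> Y" for a a' b
    using v that by (induct rule: TT_induct) (simp_all add: inner A.mul_simps tens_add_left)
  moreover have "tl (\<lambda>c d. mv a c \<otimes> mw (b + b') d) v = tl (\<lambda>c d. mv a c \<otimes> mw b d) v + tl (\<lambda>c d. mv a c \<otimes> mw b' d) v"
    if "a \<in> X" "b \<in> Y" "b' \<in> Y" for a b b'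
    using v that by (induct rule: TT_induct) (simp_all add: inner B.mul_simps tens_add_right)
  moreover have "tl (\<lambda>c d. mv (sv k a) c \<otimes> mw b d) v = tsc k (tl (\<lambda>c d. mv a c \<otimes> mw b d) v)"
    if "a \<in> X" "b \<in> Y" for k a b
    using v that by (induct rule: TT_induct) (simp_all add: inner A.mul_simps tens_scale_left tsc_add)
  moreover have "tl (\<lambda>c d. mv a c \<otimes> mw (sw k b) d) v = tsc k (tl (\<lambda>c d. mv a c \<otimes> mw b d) v)"
    if "a \<in> X" "b \<in> Y" for k a b
    using v that by (induct rule: TT_induct) (simp_all add: inner B.mul_simps tens_scale_right tsc_add)
  ultimately show ?thesis unfolding bilin_on_def lin_on_def by simp
qed

lemma tmul_tens [simp]:
  assumes "a \<in> X" "b \<in> Y" "c \<in> X" "d \<in> Y"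
  shows "(a \<otimes> b) \<bullet> (c \<otimes> d) = mv a c \<otimes> mw b d"
  using assms by (simp add: tmul_tl tl_tens[OF bil_outer] inner)

lemma tmul_add_left [simp]: "u \<in> TT \<Longrightarrow> u' \<in> TT \<Longrightarrow> v \<in> TT \<Longrightarrow> (u + u') \<bullet> v = u \<bullet> v + u' \<bullet> v"
  by (simp add: tmul_tl tl_add[OF bil_outer])

lemma tmul_scale_left: "u \<in> TT \<Longrightarrow> v \<in> TT \<Longrightarrow> tsc c u \<bullet> v = tsc c (u \<bullet> v)"
  by (simp add: tmul_tl tl_scale[OF bil_outer] tsc_add)

lemma tmul_tens_add:
  "a \<in> X \<Longrightarrow> b \<in> Y \<Longrightarrow> v \<in> TT \<Longrightarrow> v' \<in> TT \<Longrightarrow> (a \<otimes> b) \<bullet> (v + v') = (a \<otimes> b) \<bullet> v + (a \<otimes> b) \<bullet> v'"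
  by (simp add: tmul_tl tl_tens[OF bil_outer] inner)

lemma tmul_add_right [simp]:
  assumes "u \<in> TT" "v \<in> TT" "v' \<in> TT" shows "u \<bullet> (v + v') = u \<bullet> v + u \<bullet> v'"
  using assms by (induct rule: TT_induct) (simp_all add: tmul_tens_add)

lemma tmul_in [simp, intro]:
  assumes "u \<in> TT" "v \<in> TT" shows "u \<bullet> v \<in> TT"
  using assms
proof (induct rule: TT_induct)
  case (tens x y)
  from tens(3) show ?case by (induct rule: TT_induct) (use tens in auto)
qed auto

lemma tmul_scale_right:
  assumes u: "u \<in> TT" and v: "v \<in> TT" shows "u \<bullet> tsc c v = tsc c (u \<bullet> v)"
  using u
proof (induct rule: TT_induct)
  case (tens x y)
  from v show ?case
  proof (induct rule: TT_induct)
    case (tens x' y')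
    then show ?case using \<open>x \<in> X\<close> \<open>y \<in> Y\<close>
      by (simp add: tens_scale_left[symmetric] A.mul_simps)
  next
    case (add u v)
    then show ?case using \<open>x \<in> X\<close> \<open>y \<in> Y\<close> by (simp add: tsc_add)
  qed
qed (simp add: v tsc_add)

lemma tmul_assoc:
  assumes "u \<in> TT" "v \<in> TT" "w \<in> TT" shows "u \<bullet> v \<bullet> w = u \<bullet> (v \<bullet> w)"
  using assms(1)
proof (induct rule: TT_induct)
  case u: (tens x y)
  from assms(2) show ?case
  proof (induct rule: TT_induct)
    case v: (tens x' y')
    from assms(3) show ?case
      by (induct rule: TT_induct) (use u v in \<open>auto simp: A.mul_assoc B.mul_assoc\<close>)
  qed (use u assms(3) in simp)
qed (use assms in simp)

lemma idem_tensor: "u \<in> TT \<Longrightarrow> \<exists>xs. set xs \<subseteq> TT \<times> TT \<and> u = psum (\<bullet>) xs"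
proof (induct rule: TT_induct)
  case (tens x y)
  obtain xs where xs: "set xs \<subseteq> X \<times> X" "x = psum mv xs" using A.idem tens by blast
  obtain ys where ys: "set ys \<subseteq> Y \<times> Y" "y = psum mw ys" using B.idem tens by blast
  have 1: "\<exists>zs. set zs \<subseteq> TT \<times> TT \<and> psum mv us \<otimes> mw c d = psum (\<bullet>) zs"
    if "set us \<subseteq> X \<times> X" "c \<in> Y" "d \<in> Y" for us c d
    using that(1)
  proof (induct us)
    case Nil
    show ?case by (rule exI[of _ "[]"]) simp
  next
    case (Cons p us)
    then obtain zs where zs: "set zs \<subseteq> TT \<times> TT" "psum mv us \<otimes> mw c d = psum (\<bullet>) zs" by auto
    show ?case
      by (rule exI[of _ "(fst p \<otimes> c, snd p \<otimes> d) # zs"]) (use zs Cons that in \<open>auto simp: tens_add_left\<close>)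
  qed
  have "\<exists>zs. set zs \<subseteq> TT \<times> TT \<and> x \<otimes> psum mw us = psum (\<bullet>) zs"
    if "set us \<subseteq> Y \<times> Y" for us
    using that
  proof (induct us)
    case Nil
    show ?case by (rule exI[of _ "[]"]) simp
  next
    case (Cons p us)
    then obtain zs where zs: "set zs \<subseteq> TT \<times> TT" "x \<otimes> psum mw us = psum (\<bullet>) zs" by auto
    obtain zs' where zs': "set zs' \<subseteq> TT \<times> TT" "x \<otimes> mw (fst p) (snd p) = psum (\<bullet>) zs'"
      using 1[OF xs(1), of "fst p" "snd p"] xs(2) Cons.prems by auto
    show ?case by (rule exI[of _ "zs' @ zs"]) (use zs zs' in \<open>auto simp: tens_add_right\<close>)
  qed
  from this[OF ys(1)] show ?case using ys(2) by simp
next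
  case (add u v)
  then obtain xs ys where "set xs \<subseteq> TT \<times> TT" "u = psum (\<bullet>) xs" "set ys \<subseteq> TT \<times> TT" "v = psum (\<bullet>) ys" by blast
  then show ?case by (intro exI[of _ "xs @ ys"]) auto
qed

text \<open>One-sided multiplication by x \<otimes> y is a \<open>tmap\<close> of one-sided
  multiplications, so non-degeneracy of the factors turns into \<open>tmap_separates\<close>. The
  conclusion has the form of the hypotheses, so the construction can be iterated to three
  factors.\<close>

lemma nondeg_alg_tensor: "nondeg_alg tsc TT (\<bullet>)"
proof -
  interpret T: vector_space "tsc :: 'k \<Rightarrow> ('k,'v,'w) tensor \<Rightarrow> _" by (rule vector_space_tsc)
  have L: "tmap (mv x) (mw y) u = (x \<otimes> y) \<bullet> u" if "x \<in> X" "y \<in> Y" "u \<in> TT" for x y u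
    using that by (simp add: tmul_tl tl_tens[OF bil_outer])
  have Rb: "bil tsc (\<lambda>a b. mv a x \<otimes> mw b y)" if "x \<in> X" "y \<in> Y" for x y
    by (rule bil_tens) (use that in \<open>auto simp: A.lin_mul_right B.lin_mul_right\<close>)
  have R: "tmap (\<lambda>a. mv a x) (\<lambda>b. mw b y) u = u \<bullet> (x \<otimes> y)" if "x \<in> X" "y \<in> Y" "u \<in> TT" for x y u
    using that(3) by (induct rule: TT_induct) (simp_all add: that tl_tens[OF Rb] tl_add[OF Rb])
  show ?thesis
  proof (unfold_locales, goal_cases)
    case 1 then show ?case by (rule subspace_TT)
  next
    case (2 a b) then show ?case by simp
  next
    case 3 show ?case
      unfolding bilin_on_def lin_on_def by (simp add: tmul_scale_left tmul_scale_right)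
  next
    case (4 a b c) then show ?case by (rule tmul_assoc)
  next
    case (5 u)
    show ?case
      by (rule tmap_separates[where \<Phi> = "mv ` X" and \<Psi> = "mw ` Y"])
        (use 5 A.nondeg_left B.nondeg_left in \<open>auto simp: A.lin_mul_left B.lin_mul_left L\<close>)
  next
    case (6 u)
    show ?case
    proof (rule tmap_separates[where \<Phi> = "(\<lambda>x a. mv a x) ` X" and \<Psi> = "(\<lambda>y b. mw b y) ` Y"])
      fix x assume "x \<in> X" and x: "\<And>\<phi>. \<phi> \<in> (\<lambda>x a. mv a x) ` X \<Longrightarrow> \<phi> x = 0"
      then show "x = 0" using A.nondeg_right x[OF imageI] by blast
    next
      fix y assume "y \<in> Y" and y: "\<And>\<psi>. \<psi> \<in> (\<lambda>y b. mw b y) ` Y \<Longrightarrow> \<psi> y = 0"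
      then show "y = 0" using B.nondeg_right y[OF imageI] by blast
    qed (use 6 in \<open>auto simp: A.lin_mul_right B.lin_mul_right R\<close>)
  next
    case (7 u) then show ?case by (rule idem_tensor)
  qed
qed

end

section \<open>Threefold tensors\<close>

locale tens3 = vector_space s for s :: "'k::field \<Rightarrow> 'a::ab_group_add \<Rightarrow> 'a"
begin

sublocale P: tprod s s UNIV UNIV
  by unfold_locales auto

lemma AA_tsp: "P.TT = AA s"
  by (simp add: AA_def)

sublocale T: vector_space "tsc :: 'k \<Rightarrow> ('k,'a) AA \<Rightarrow> _"
  by (rule vector_space_tsc)

sublocale Q: tprod tsc s "AA s" UNIV
  by unfold_locales (use P.subspace_TT AA_tsp in auto)

lemma AAA_tsp: "Q.TT = AAA s"
  by (simp add: AAA_def)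

abbreviation ten2 :: "'a \<Rightarrow> 'a \<Rightarrow> ('k,'a) AA" (infixl "\<otimes>" 70) where "a \<otimes> b \<equiv> ten s a b"
abbreviation ten3 :: "('k,'a) AA \<Rightarrow> 'a \<Rightarrow> ('k,'a) AAA" (infixl "\<otimes>\<^sub>3" 70) where "w \<otimes>\<^sub>3 c \<equiv> tens tsc s w c"
abbreviation lA :: "('a \<Rightarrow> 'a) \<Rightarrow> bool" where "lA \<equiv> lin_on s s UNIV"
definition lAA :: "(('k,'a) AA \<Rightarrow> ('k,'a) AA) \<Rightarrow> bool" where
  "lAA \<phi> \<longleftrightarrow> lin_on tsc tsc (AA s) \<phi> \<and> \<phi> ` AA s \<subseteq> AA s"
abbreviation bl where "bl sz \<beta> \<equiv> bilin_on s s sz UNIV UNIV \<beta>"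

lemma ten_simps:
  shows ten_add_left: "(x + x') \<otimes> y = x \<otimes> y + x' \<otimes> y"
    and ten_add_right: "x \<otimes> (y + y') = x \<otimes> y + x \<otimes> y'"
    and ten_scale_left: "s c x \<otimes> y = tsc c (x \<otimes> y)"
    and ten_scale_right: "x \<otimes> s c y = tsc c (x \<otimes> y)"
    and ten_zero [simp]: "0 \<otimes> y = 0" "x \<otimes> 0 = 0"
  by (simp_all add: ten_def P.tens_add_left P.tens_add_right P.tens_scale_left P.tens_scale_right)

lemma AA_simps [simp, intro]:
  shows ten_in: "a \<otimes> b \<in> AA s"
    and AA_add: "u \<in> AA s \<Longrightarrow> v \<in> AA s \<Longrightarrow> u + v \<in> AA s"
    and AA_zero: "0 \<in> AA s"
    and AA_scale: "u \<in> AA s \<Longrightarrow> tsc c u \<in> AA s"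
  using P.tens_in P.TT_add P.TT_zero P.TT_scale by (auto simp: AA_tsp ten_def)

lemma AAA_simps [simp, intro]:
  shows ten3_in: "w \<in> AA s \<Longrightarrow> w \<otimes>\<^sub>3 b \<in> AAA s"
    and AAA_add: "x \<in> AAA s \<Longrightarrow> y \<in> AAA s \<Longrightarrow> x + y \<in> AAA s"
    and AAA_zero: "0 \<in> AAA s"
    and AAA_scale: "x \<in> AAA s \<Longrightarrow> tsc c x \<in> AAA s"
  using Q.tens_in Q.TT_add Q.TT_zero Q.TT_scale by (auto simp: AAA_tsp)

lemmas ten3_simps = Q.tens_add_left Q.tens_add_right Q.tens_scale_left Q.tens_scale_right

lemma AA_induct [consumes 1, case_names ten add]:
  assumes "u \<in> AA s" "\<And>x y. P (x \<otimes> y)"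
    "\<And>u v. u \<in> AA s \<Longrightarrow> v \<in> AA s \<Longrightarrow> P u \<Longrightarrow> P v \<Longrightarrow> P (u + v)"
  shows "P u"
  using P.TT_induct[of u P] assms by (auto simp: AA_tsp ten_def)

lemma AAA_induct [consumes 1, case_names ten add]:
  assumes "x \<in> AAA s" "\<And>a b c. P (a \<otimes> b \<otimes>\<^sub>3 c)"
    "\<And>x y. x \<in> AAA s \<Longrightarrow> y \<in> AAA s \<Longrightarrow> P x \<Longrightarrow> P y \<Longrightarrow> P (x + y)"
  shows "P x"
  using assms(1)[folded AAA_tsp]
proof (induct rule: Q.TT_induct)
  case (tens w c)
  from tens(1) show ?case
    by (induct rule: AA_induct) (auto simp: assms(2) Q.tens_add_left intro!: assms(3))
qed (auto simp: AAA_tsp intro: assms(3))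

lemma blI:
  assumes "\<And>x x' y. \<beta> (x + x') y = \<beta> x y + \<beta> x' y" "\<And>x y y'. \<beta> x (y + y') = \<beta> x y + \<beta> x y'"
    "\<And>c x y. \<beta> (s c x) y = sz c (\<beta> x y)" "\<And>c x y. \<beta> x (s c y) = sz c (\<beta> x y)"
  shows "bl sz \<beta>"
  using assms by (simp add: bilin_on_def lin_on_def)

lemma blD:
  assumes "bl sz \<beta>"
  shows "\<beta> (x + x') y = \<beta> x y + \<beta> x' y" "\<beta> x (y + y') = \<beta> x y + \<beta> x y'"
    "\<beta> (s c x) y = sz c (\<beta> x y)" "\<beta> x (s c y) = sz c (\<beta> x y)"
  using assms by (simp_all add: bilin_on_def lin_on_def)

lemma bl_tlA:
  assumes "bl sz \<beta>"
  shows tlA_ten: "tlA s \<beta> (a \<otimes> b) = (\<beta> a b :: 'z::ab_group_add)"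
    and tlA_add: "u \<in> AA s \<Longrightarrow> v \<in> AA s \<Longrightarrow> tlA s \<beta> (u + v) = tlA s \<beta> u + tlA s \<beta> v"
    and tlA_scale: "(\<And>c z z'. sz c (z + z') = sz c z + sz c z') \<Longrightarrow> u \<in> AA s \<Longrightarrow> tlA s \<beta> (tsc c u) = sz c (tlA s \<beta> u)"
  using P.tl_tens[OF assms] P.tl_add[OF assms] P.tl_scale[OF assms, of c] by (auto simp: AA_tsp ten_def tlA_def)

lemma tlA_in:
  assumes "bl sz \<beta>" "u \<in> AA s" "\<And>a b. \<beta> a b \<in> Z" "\<And>z z'. z \<in> Z \<Longrightarrow> z' \<in> Z \<Longrightarrow> z + z' \<in> Z"
  shows "(tlA s \<beta> u :: 'z::ab_group_add) \<in> Z"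
  using assms(2) by (induct rule: AA_induct) (simp_all add: bl_tlA[OF assms(1)] assms(3,4))

lemma lAD:
  assumes "lA \<phi>" shows "\<phi> (x + y) = \<phi> x + \<phi> y" "\<phi> (s c x) = s c (\<phi> x)" "\<phi> 0 = 0"
  using assms lin_on_zero[OF subspace_UNIV assms] by (auto simp: lin_on_def)

lemma lAAD:
  assumes "lAA \<phi>"
  shows "u \<in> AA s \<Longrightarrow> v \<in> AA s \<Longrightarrow> \<phi> (u + v) = \<phi> u + \<phi> v"
    "u \<in> AA s \<Longrightarrow> \<phi> (tsc c u) = tsc c (\<phi> u)" "u \<in> AA s \<Longrightarrow> \<phi> u \<in> AA s" "\<phi> 0 = 0"
  using assms T.lin_on_zero[of "AA s" tsc \<phi>] Q.subX by (auto simp: lin_on_def lAA_def)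

lemma lAAI:
  assumes "\<And>u v. u \<in> AA s \<Longrightarrow> v \<in> AA s \<Longrightarrow> \<phi> (u + v) = \<phi> u + \<phi> v"
    "\<And>c u. u \<in> AA s \<Longrightarrow> \<phi> (tsc c u) = tsc c (\<phi> u)" "\<And>u. u \<in> AA s \<Longrightarrow> \<phi> u \<in> AA s"
  shows "lAA \<phi>"
  using assms by (auto simp: lin_on_def lAA_def)

lemma lA_id [simp]: "lA id" "lA (\<lambda>x. x)"
  by (simp_all add: lin_on_def)

lemma lAA_id [simp]: "lAA id" "lAA (\<lambda>x. x)"
  by (simp_all add: lin_on_def lAA_def)

lemma bl_ten: "lA \<phi> \<Longrightarrow> lA \<psi> \<Longrightarrow> bl tsc (\<lambda>x y. \<phi> x \<otimes> \<psi> y)"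
  by (rule blI) (simp_all add: lAD ten_simps)

lemma lAA_tlA: "bl tsc \<beta> \<Longrightarrow> (\<And>x y. \<beta> x y \<in> AA s) \<Longrightarrow> lAA (tlA s \<beta>)"
  by (rule lAAI) (auto simp: tlA_add tlA_scale tsc_add intro: tlA_in)

lemma tmapA_simps [simp]:
  assumes "lA \<phi>" "lA \<psi>"
  shows tmapA_ten: "tmapA s \<phi> \<psi> (a \<otimes> b) = \<phi> a \<otimes> \<psi> b"
    and tmapA_add: "u \<in> AA s \<Longrightarrow> v \<in> AA s \<Longrightarrow> tmapA s \<phi> \<psi> (u + v) = tmapA s \<phi> \<psi> u + tmapA s \<phi> \<psi> v"
    and tmapA_in: "u \<in> AA s \<Longrightarrow> tmapA s \<phi> \<psi> u \<in> AA s"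
    and lAA_tmapA: "lAA (tmapA s \<phi> \<psi>)"
proof -
  show 1: "tmapA s \<phi> \<psi> (a \<otimes> b) = \<phi> a \<otimes> \<psi> b" for a b
    by (simp add: tmapA_def rst_def bl_tlA[OF bl_ten[OF assms]])
  show 2: "tmapA s \<phi> \<psi> (u + v) = tmapA s \<phi> \<psi> u + tmapA s \<phi> \<psi> v" if "u \<in> AA s" "v \<in> AA s" for u v
    using that by (simp add: tmapA_def rst_def bl_tlA[OF bl_ten[OF assms]])
  show 3: "tmapA s \<phi> \<psi> u \<in> AA s" if "u \<in> AA s" for u
    using that by (induct rule: AA_induct) (simp_all add: 1 2)
  show "lAA (tmapA s \<phi> \<psi>)"
    by (rule lAAI) (simp_all add: 2 3, simp add: tmapA_def rst_def tlA_scale[OF bl_ten[OF assms]] tsc_add)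
qed

text \<open>\<open>J a u\<close> is \<open>a \<otimes> u\<close> for \<open>u \<in> A \<otimes> A\<close>, re-bracketed as an element of \<open>(A \<otimes> A) \<otimes> A\<close>.\<close>

definition J :: "'a \<Rightarrow> ('k,'a) AA \<Rightarrow> ('k,'a) AAA" where
  "J a = tlA s (\<lambda>x y. a \<otimes> x \<otimes>\<^sub>3 y)"

lemma bl_J: "bl tsc (\<lambda>x y. a \<otimes> x \<otimes>\<^sub>3 y)"
  by (rule blI) (simp_all add: ten_simps ten3_simps)

lemma J_simps [simp]:
  shows J_ten: "J a (x \<otimes> y) = a \<otimes> x \<otimes>\<^sub>3 y"
    and J_add: "u \<in> AA s \<Longrightarrow> v \<in> AA s \<Longrightarrow> J a (u + v) = J a u + J a v"
    and J_in: "u \<in> AA s \<Longrightarrow> J a u \<in> AAA s"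
  by (auto simp: J_def bl_tlA[OF bl_J] intro!: tlA_in[OF bl_J])

lemma J_scale: "u \<in> AA s \<Longrightarrow> J a (tsc c u) = tsc c (J a u)"
  by (simp add: J_def tlA_scale[OF bl_J] tsc_add)

lemma J_add_left: "u \<in> AA s \<Longrightarrow> J (a + b) u = J a u + J b u"
  by (induct rule: AA_induct) (simp_all add: ten_simps ten3_simps)

lemma J_scale_left: "u \<in> AA s \<Longrightarrow> J (s c a) u = tsc c (J a u)"
  by (induct rule: AA_induct) (simp_all add: ten_simps ten3_simps tsc_add)

lemma AAA_induct_J [consumes 1, case_names J add]:
  assumes "x \<in> AAA s" "\<And>a u. u \<in> AA s \<Longrightarrow> P (J a u)"
    "\<And>x y. x \<in> AAA s \<Longrightarrow> y \<in> AAA s \<Longrightarrow> P x \<Longrightarrow> P y \<Longrightarrow> P (x + y)"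
  shows "P x"
  using assms(1)
proof (induct rule: AAA_induct)
  case (ten a b c)
  show ?case using assms(2)[of "b \<otimes> c" a] by simp
qed (rule assms(3))

lemma AAA_induct_3 [consumes 1, case_names ten add]:
  assumes "x \<in> AAA s" "\<And>w c. w \<in> AA s \<Longrightarrow> P (w \<otimes>\<^sub>3 c)"
    "\<And>x y. x \<in> AAA s \<Longrightarrow> y \<in> AAA s \<Longrightarrow> P x \<Longrightarrow> P y \<Longrightarrow> P (x + y)"
  shows "P x"
  using assms(1) by (induct rule: AAA_induct) (simp_all add: assms(2,3))

abbreviation bl3 where "bl3 sz \<beta> \<equiv> bilin_on tsc s sz (AA s) UNIV \<beta>"

lemma bl3I:
  assumes "\<And>x x' y. x \<in> AA s \<Longrightarrow> x' \<in> AA s \<Longrightarrow> \<beta> (x + x') y = \<beta> x y + \<beta> x' y"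
    "\<And>x y y'. x \<in> AA s \<Longrightarrow> \<beta> x (y + y') = \<beta> x y + \<beta> x y'"
    "\<And>c x y. x \<in> AA s \<Longrightarrow> \<beta> (tsc c x) y = sz c (\<beta> x y)" "\<And>c x y. x \<in> AA s \<Longrightarrow> \<beta> x (s c y) = sz c (\<beta> x y)"
  shows "bl3 sz \<beta>"
  using assms by (simp add: bilin_on_def lin_on_def)

lemma bl3_tlAAA:
  assumes "bl3 sz \<beta>"
  shows tlAAA_ten: "w \<in> AA s \<Longrightarrow> tlAAA s \<beta> (w \<otimes>\<^sub>3 b) = (\<beta> w b :: 'z::ab_group_add)"
    and tlAAA_add: "x \<in> AAA s \<Longrightarrow> y \<in> AAA s \<Longrightarrow> tlAAA s \<beta> (x + y) = tlAAA s \<beta> x + tlAAA s \<beta> y"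
  using Q.tl_tens[OF assms] Q.tl_add[OF assms] by (auto simp: AAA_tsp tlAAA_def)

lemma Rg_simps [simp]:
  assumes "lAA \<phi>" "lA \<psi>"
  shows Rg_ten: "w \<in> AA s \<Longrightarrow> Rg s \<phi> \<psi> (w \<otimes>\<^sub>3 c) = \<phi> w \<otimes>\<^sub>3 \<psi> c"
    and Rg_add: "x \<in> AAA s \<Longrightarrow> y \<in> AAA s \<Longrightarrow> Rg s \<phi> \<psi> (x + y) = Rg s \<phi> \<psi> x + Rg s \<phi> \<psi> y"
    and Rg_in: "x \<in> AAA s \<Longrightarrow> Rg s \<phi> \<psi> x \<in> AAA s"
proof -
  have b: "bl3 tsc (\<lambda>w c. \<phi> w \<otimes>\<^sub>3 \<psi> c)"
    by (rule bl3I) (simp_all add: lAAD[OF assms(1)] lAD[OF assms(2)] ten3_simps)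
  show 1: "Rg s \<phi> \<psi> (w \<otimes>\<^sub>3 c) = \<phi> w \<otimes>\<^sub>3 \<psi> c" if "w \<in> AA s" for w c
    using that by (simp add: Rg_def rst_def bl3_tlAAA[OF b])
  show 2: "Rg s \<phi> \<psi> (x + y) = Rg s \<phi> \<psi> x + Rg s \<phi> \<psi> y" if "x \<in> AAA s" "y \<in> AAA s" for x y
    using that by (simp add: Rg_def rst_def bl3_tlAAA[OF b])
  show "Rg s \<phi> \<psi> x \<in> AAA s" if "x \<in> AAA s" for x
    using that by (induct rule: AAA_induct_3) (simp_all add: 1 2 lAAD[OF assms(1)])
qed

lemma idLg_simps [simp]:
  assumes "lA \<psi>" "lAA \<phi>"
  shows idLg_ten: "idLg s \<psi> \<phi> (a \<otimes> b \<otimes>\<^sub>3 c) = J (\<psi> a) (\<phi> (b \<otimes> c))"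
    and idLg_J: "u \<in> AA s \<Longrightarrow> idLg s \<psi> \<phi> (J a u) = J (\<psi> a) (\<phi> u)"
    and idLg_add: "x \<in> AAA s \<Longrightarrow> y \<in> AAA s \<Longrightarrow> idLg s \<psi> \<phi> (x + y) = idLg s \<psi> \<phi> x + idLg s \<psi> \<phi> y"
    and idLg_in: "x \<in> AAA s \<Longrightarrow> idLg s \<psi> \<phi> x \<in> AAA s"
proof -
  have b: "bl tsc (\<lambda>a b. J (\<psi> a) (\<phi> (b \<otimes> c)))" for c
    by (rule blI) (simp_all add: lAAD[OF assms(2)] lAD[OF assms(1)] ten_simps J_add_left J_scale_left J_scale)
  define \<beta> where "\<beta> w c = tlA s (\<lambda>a b. J (\<psi> a) (\<phi> (b \<otimes> c))) w" for w c
  have \<beta>: "\<beta> (x \<otimes> y) c = J (\<psi> x) (\<phi> (y \<otimes> c))" "u \<in> AA s \<Longrightarrow> v \<in> AA s \<Longrightarrow> \<beta> (u + v) c = \<beta> u c + \<beta> v c"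
    "u \<in> AA s \<Longrightarrow> \<beta> (tsc k u) c = tsc k (\<beta> u c)" for x y c u v k
    by (simp_all add: \<beta>_def bl_tlA[OF b] tlA_scale[OF b] tsc_add)
  have "\<beta> w (c + c') = \<beta> w c + \<beta> w c'" if "w \<in> AA s" for w c c'
    using that by (induct rule: AA_induct) (simp_all add: \<beta> lAAD[OF assms(2)] ten_simps)
  moreover have "\<beta> w (s k c) = tsc k (\<beta> w c)" if "w \<in> AA s" for w k c
    using that by (induct rule: AA_induct) (simp_all add: \<beta> lAAD[OF assms(2)] ten_simps tsc_add J_scale)
  ultimately have "bl3 tsc \<beta>"
    by (intro bl3I) (simp_all add: \<beta>)
  then have b3: "bl3 tsc (\<lambda>w c. tlA s (\<lambda>a b. J (\<psi> a) (\<phi> (b \<otimes> c))) w)"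
    by (simp add: \<beta>_def[abs_def])
  have def: "idLg s \<psi> \<phi> x = (if x \<in> AAA s then tlAAA s (\<lambda>w c. tlA s (\<lambda>a b. J (\<psi> a) (\<phi> (b \<otimes> c))) w) x else 0)" for x
    by (simp add: idLg_def J_def rst_def)
  show 1: "idLg s \<psi> \<phi> (a \<otimes> b \<otimes>\<^sub>3 c) = J (\<psi> a) (\<phi> (b \<otimes> c))" for a b c
    by (simp add: def bl3_tlAAA[OF b3] bl_tlA[OF b])
  show 2: "idLg s \<psi> \<phi> (x + y) = idLg s \<psi> \<phi> x + idLg s \<psi> \<phi> y" if "x \<in> AAA s" "y \<in> AAA s" for x y
    using that by (simp add: def bl3_tlAAA[OF b3])
  show "idLg s \<psi> \<phi> (J a u) = J (\<psi> a) (\<phi> u)" if "u \<in> AA s" for a u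
    using that by (induct rule: AA_induct) (simp_all add: 1 2 lAAD[OF assms(2)])
  show "idLg s \<psi> \<phi> x \<in> AAA s" if "x \<in> AAA s" for x
    using that by (induct rule: AAA_induct) (simp_all add: 1 2 lAAD[OF assms(2)])
qed

lemma AA_diff [simp, intro]: "u \<in> AA s \<Longrightarrow> v \<in> AA s \<Longrightarrow> u - v \<in> AA s"
  using T.subspace_diff Q.subX by blast

lemma lAA_diff: "lAA \<phi> \<Longrightarrow> u \<in> AA s \<Longrightarrow> v \<in> AA s \<Longrightarrow> \<phi> (u - v) = \<phi> u - \<phi> v"
  using T.lin_on_diff[OF Q.subX] by (auto simp: lAA_def)

lemma tmapA_separates:
  assumes \<Phi>: "\<And>i. lA (\<phi> i)" "\<And>x. (\<And>i. \<phi> i x = 0) \<Longrightarrow> x = 0"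
    and \<Psi>: "\<And>j. lA (\<psi> j)" "\<And>x. (\<And>j. \<psi> j x = 0) \<Longrightarrow> x = 0"
    and uv: "u \<in> AA s" "v \<in> AA s" "\<And>i j. tmapA s (\<phi> i) (\<psi> j) u = tmapA s (\<phi> i) (\<psi> j) v"
  shows "u = v"
proof -
  have t: "tmapA s (\<phi> i) (\<psi> j) w = P.tmap (\<phi> i) (\<psi> j) w" if "w \<in> AA s" for i j w
    using that by (simp add: tmapA_def rst_def ten_def tlA_def)
  have "u - v = 0"
  proof (rule P.tmap_separates[where \<Phi> = "range \<phi>" and \<Psi> = "range \<psi>"])
    fix f g assume "f \<in> range \<phi>" "g \<in> range \<psi>"
    then show "P.tmap f g (u - v) = 0"
      using uv lAA_diff[OF lAA_tmapA[OF \<Phi>(1) \<Psi>(1)] uv(1,2)]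
      by (auto simp: t[symmetric])
  next
    fix x assume "\<And>f. f \<in> range \<phi> \<Longrightarrow> f x = 0"
    then have "\<phi> i x = 0" for i by simp
    then show "x = 0" by (rule \<Phi>(2))
  next
    fix x assume "\<And>f. f \<in> range \<psi> \<Longrightarrow> f x = 0"
    then have "\<psi> i x = 0" for i by simp
    then show "x = 0" by (rule \<Psi>(2))
  qed (use \<Phi>(1) \<Psi>(1) uv(1,2) in \<open>auto simp: AA_tsp\<close>)
  then show ?thesis by simp
qed

lemma bl_tw: "bl tsc (\<lambda>x y. y \<otimes> x)"
  by (rule blI) (simp_all add: ten_simps)

lemma lAA_tw [simp]: "lAA (tw s)"
  unfolding tw_def by (rule lAA_tlA[OF bl_tw]) simp

lemma tw_simps [simp]:
  shows tw_ten: "tw s (a \<otimes> b) = b \<otimes> a"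
    and tw_add: "u \<in> AA s \<Longrightarrow> v \<in> AA s \<Longrightarrow> tw s (u + v) = tw s u + tw s v"
    and tw_in: "u \<in> AA s \<Longrightarrow> tw s u \<in> AA s"
  by (simp_all add: lAAD, simp add: tw_def tlA_ten[OF bl_tw])

lemma tw_tw [simp]: "u \<in> AA s \<Longrightarrow> tw s (tw s u) = u"
  by (induct rule: AA_induct) simp_all

lemma tmapA_tw: "lA \<phi> \<Longrightarrow> lA \<psi> \<Longrightarrow> u \<in> AA s \<Longrightarrow> tmapA s \<phi> \<psi> (tw s u) = tw s (tmapA s \<psi> \<phi> u)"
  by (rotate_tac 2, induct rule: AA_induct) simp_all

lemma lAA_comp: "lAA \<phi> \<Longrightarrow> lAA \<psi> \<Longrightarrow> lAA (\<lambda>u. \<phi> (\<psi> u))"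
  by (rule lAAI) (simp_all add: lAAD)

lemma tlA_tw:
  assumes "bl sz \<beta>" "u \<in> AA s"
  shows "tlA s \<beta> (tw s u) = (tlA s (\<lambda>x y. \<beta> y x) u :: 'z::ab_group_add)"
proof -
  have b: "bl sz (\<lambda>x y. \<beta> y x)" by (rule blI) (simp_all add: blD[OF assms(1)])
  from assms(2) show ?thesis
    by (induct rule: AA_induct) (simp_all add: bl_tlA[OF assms(1)] bl_tlA[OF b])
qed

text \<open>In leg notation, \<phi> on legs 2, 3 and \<phi> on legs 1, 2. Only the former crosses
  the bracketing of (A \<otimes> A) \<otimes> A.\<close>

abbreviation KK where "KK \<phi> \<equiv> idLg s (\<lambda>x. x) \<phi>"
abbreviation LL where "LL \<phi> \<equiv> Rg s \<phi> (\<lambda>x. x)"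

section \<open>Operators on adjacent legs: composition, reversal, contraction\<close>

lemma KK_comp:
  assumes "lAA \<phi>" "lAA \<psi>" "lAA \<chi>" "\<And>u. u \<in> AA s \<Longrightarrow> \<phi> (\<psi> u) = \<chi> u" "x \<in> AAA s"
  shows "KK \<phi> (KK \<psi> x) = KK \<chi> x"
  using assms(5) by (induct rule: AAA_induct_J) (simp_all add: assms lAAD)

lemma LL_comp:
  assumes "lAA \<phi>" "lAA \<psi>" "lAA \<chi>" "\<And>u. u \<in> AA s \<Longrightarrow> \<phi> (\<psi> u) = \<chi> u" "x \<in> AAA s"
  shows "LL \<phi> (LL \<psi> x) = LL \<chi> x"
  using assms(5) by (induct rule: AAA_induct_3) (simp_all add: assms lAAD)

text \<open>The reversal a \<otimes> b \<otimes> c \<mapsto> c \<otimes> b \<otimes> a. Conjugation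
  with it exchanges \<open>KK\<close> and \<open>LL\<close> up to \<open>tw\<close>, which
  implements the passage to the dual structure.\<close>

definition flip3 :: "('k,'a) AAA \<Rightarrow> ('k,'a) AAA" where
  "flip3 = tlAAA s (\<lambda>w c. J c (tw s w))"

lemma bl3_flip3: "bl3 tsc (\<lambda>w c. J c (tw s w))"
  by (rule bl3I) (simp_all add: J_add_left J_scale_left lAAD J_scale)

lemma flip3_simps [simp]:
  shows flip3_ten: "w \<in> AA s \<Longrightarrow> flip3 (w \<otimes>\<^sub>3 c) = J c (tw s w)"
    and flip3_add: "x \<in> AAA s \<Longrightarrow> y \<in> AAA s \<Longrightarrow> flip3 (x + y) = flip3 x + flip3 y"
  by (simp_all add: flip3_def bl3_tlAAA[OF bl3_flip3])

lemma flip3_J [simp]: "u \<in> AA s \<Longrightarrow> flip3 (J a u) = tw s u \<otimes>\<^sub>3 a"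
  by (induct rule: AA_induct) (simp_all add: ten3_simps)

lemma flip3_in [simp]: "x \<in> AAA s \<Longrightarrow> flip3 x \<in> AAA s"
  by (induct rule: AAA_induct_3) simp_all

lemma flip3_flip3 [simp]: "x \<in> AAA s \<Longrightarrow> flip3 (flip3 x) = x"
  by (induct rule: AAA_induct_3) simp_all

lemma lAA_conj_tw: "lAA \<phi> \<Longrightarrow> lAA (\<lambda>u. tw s (\<phi> (tw s u)))"
  using lAA_comp[OF lAA_comp[OF lAA_tw] lAA_tw] .

lemma LL_flip:
  assumes "lAA \<phi>" "x \<in> AAA s"
  shows "LL (\<lambda>u. tw s (\<phi> (tw s u))) x = flip3 (KK \<phi> (flip3 x))"
  using assms(2) by (induct rule: AAA_induct_3) (simp_all add: lAA_conj_tw lAAD assms(1))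

lemma KK_flip:
  assumes "lAA \<phi>" "x \<in> AAA s"
  shows "KK (\<lambda>u. tw s (\<phi> (tw s u))) x = flip3 (LL \<phi> (flip3 x))"
  using assms(2) by (induct rule: AAA_induct_J) (simp_all add: lAA_conj_tw lAAD assms(1))

text \<open>Contractions of two neighbouring legs. Taking the product for \<beta> gives partial
  multiplications, and putting \<epsilon> into one argument of \<beta> gives slices.\<close>

definition B12 where "B12 \<beta> = tlAAA s (\<lambda>w c. tlA s \<beta> w \<otimes> c)"
definition B23 where "B23 \<beta> = tlAAA s (\<lambda>w c. tmapA s (\<lambda>x. x) (\<lambda>y. \<beta> y c) w)"

lemma lA_bl: "bl s \<beta> \<Longrightarrow> lA (\<beta> x)" "bl s \<beta> \<Longrightarrow> lA (\<lambda>x. \<beta> x y)"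
  by (simp_all add: bilin_on_def)

lemma B12_simps:
  assumes "bl s \<beta>"
  shows B12_ten: "w \<in> AA s \<Longrightarrow> B12 \<beta> (w \<otimes>\<^sub>3 c) = tlA s \<beta> w \<otimes> c"
    and B12_add: "x \<in> AAA s \<Longrightarrow> y \<in> AAA s \<Longrightarrow> B12 \<beta> (x + y) = B12 \<beta> x + B12 \<beta> y"
    and B12_J: "u \<in> AA s \<Longrightarrow> B12 \<beta> (J a u) = tmapA s (\<beta> a) (\<lambda>x. x) u"
    and B12_in: "x \<in> AAA s \<Longrightarrow> B12 \<beta> x \<in> AA s"
proof -
  have b: "bl3 tsc (\<lambda>w c. tlA s \<beta> w \<otimes> c)"
    by (rule bl3I) (simp_all add: bl_tlA[OF assms] tlA_scale[OF assms] ten_simps scale_right_distrib)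
  show 1: "B12 \<beta> (w \<otimes>\<^sub>3 c) = tlA s \<beta> w \<otimes> c" if "w \<in> AA s" for w c
    using that by (simp add: B12_def bl3_tlAAA[OF b])
  show 2: "B12 \<beta> (x + y) = B12 \<beta> x + B12 \<beta> y" if "x \<in> AAA s" "y \<in> AAA s" for x y
    using that by (simp add: B12_def bl3_tlAAA[OF b])
  show "B12 \<beta> (J a u) = tmapA s (\<beta> a) (\<lambda>x. x) u" if "u \<in> AA s"
    using that by (induct rule: AA_induct) (simp_all add: 1 2 lA_bl[OF assms] tlA_ten[OF assms])
  show "B12 \<beta> x \<in> AA s" if "x \<in> AAA s"
    using that by (induct rule: AAA_induct_3) (simp_all add: 1 2)
qed

lemma tmapA_add_right:
  "lA \<phi> \<Longrightarrow> lA \<psi> \<Longrightarrow> lA \<psi>' \<Longrightarrow> lA (\<lambda>x. \<psi> x + \<psi>' x) \<Longrightarrow> u \<in> AA s \<Longrightarrow>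
    tmapA s \<phi> (\<lambda>x. \<psi> x + \<psi>' x) u = tmapA s \<phi> \<psi> u + tmapA s \<phi> \<psi>' u"
  by (rotate_tac 4, induct rule: AA_induct) (simp_all add: ten_simps)

lemma tmapA_scale_right:
  "lA \<phi> \<Longrightarrow> lA \<psi> \<Longrightarrow> lA (\<lambda>x. s c (\<psi> x)) \<Longrightarrow> u \<in> AA s \<Longrightarrow>
    tmapA s \<phi> (\<lambda>x. s c (\<psi> x)) u = tsc c (tmapA s \<phi> \<psi> u)"
  by (rotate_tac 3, induct rule: AA_induct) (simp_all add: ten_simps tsc_add)

lemma lA_add: "lA \<psi> \<Longrightarrow> lA \<psi>' \<Longrightarrow> lA (\<lambda>x. \<psi> x + \<psi>' x)"
  and lA_scale: "lA \<psi> \<Longrightarrow> lA (\<lambda>x. s c (\<psi> x))"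
  by (auto simp: lin_on_def scale_right_distrib algebra_simps scale_left_commute)

lemma B23_simps:
  assumes "bl s \<beta>"
  shows B23_ten: "w \<in> AA s \<Longrightarrow> B23 \<beta> (w \<otimes>\<^sub>3 c) = tmapA s (\<lambda>x. x) (\<lambda>y. \<beta> y c) w"
    and B23_add: "x \<in> AAA s \<Longrightarrow> y \<in> AAA s \<Longrightarrow> B23 \<beta> (x + y) = B23 \<beta> x + B23 \<beta> y"
    and B23_J: "u \<in> AA s \<Longrightarrow> B23 \<beta> (J a u) = a \<otimes> tlA s \<beta> u"
    and B23_in: "x \<in> AAA s \<Longrightarrow> B23 \<beta> x \<in> AA s"
proof -
  have b: "bl3 tsc (\<lambda>w c. tmapA s (\<lambda>x. x) (\<lambda>y. \<beta> y c) w)"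
    by (rule bl3I) (simp_all add: lA_bl[OF assms] blD[OF assms] tmapA_add_right tmapA_scale_right
       lA_add lA_scale lAAD[OF lAA_tmapA])
  show 1: "B23 \<beta> (w \<otimes>\<^sub>3 c) = tmapA s (\<lambda>x. x) (\<lambda>y. \<beta> y c) w" if "w \<in> AA s" for w c
    using that by (simp add: B23_def bl3_tlAAA[OF b])
  show 2: "B23 \<beta> (x + y) = B23 \<beta> x + B23 \<beta> y" if "x \<in> AAA s" "y \<in> AAA s" for x y
    using that by (simp add: B23_def bl3_tlAAA[OF b])
  show "B23 \<beta> (J a u) = a \<otimes> tlA s \<beta> u" if "u \<in> AA s"
    using that by (induct rule: AA_induct) (simp_all add: 1 2 lA_bl[OF assms] bl_tlA[OF assms] ten_simps)
  show "B23 \<beta> x \<in> AA s" if "x \<in> AAA s"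
    using that by (induct rule: AAA_induct_3) (simp_all add: 1 2 lA_bl[OF assms])
qed

end

section \<open>Slices by the counit\<close>

locale tens3_functional = tens3 s for s :: "'k::field \<Rightarrow> 'a::ab_group_add \<Rightarrow> 'a" +
  fixes \<epsilon> :: "'a \<Rightarrow> 'k"
  assumes eps: "lfun s \<epsilon>"
begin

lemmas eps_simps = lfun_linear[OF eps]

lemma bl_eps: "bl s (\<lambda>x y. s (\<epsilon> x) y)" "bl s (\<lambda>x y. s (\<epsilon> y) x)"
  by (rule blI; simp add: eps_simps scale_right_distrib scale_left_distrib scale_left_commute)+

abbreviation ei where "ei \<equiv> epsid s \<epsilon>"
abbreviation ie where "ie \<equiv> ideps s \<epsilon>"

lemma eps_slice [simp]:
  shows ei_ten: "ei (a \<otimes> b) = s (\<epsilon> a) b" and ie_ten: "ie (a \<otimes> b) = s (\<epsilon> b) a"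
    and ei_add: "u \<in> AA s \<Longrightarrow> v \<in> AA s \<Longrightarrow> ei (u + v) = ei u + ei v"
    and ie_add: "u \<in> AA s \<Longrightarrow> v \<in> AA s \<Longrightarrow> ie (u + v) = ie u + ie v"
    and ei_scale: "u \<in> AA s \<Longrightarrow> ei (tsc c u) = s c (ei u)"
    and ie_scale: "u \<in> AA s \<Longrightarrow> ie (tsc c u) = s c (ie u)"
  by (simp_all add: epsid_def ideps_def bl_tlA[OF bl_eps(1)] bl_tlA[OF bl_eps(2)]
     tlA_scale[OF bl_eps(1)] tlA_scale[OF bl_eps(2)] scale_right_distrib)

lemma ei_tw [simp]: "u \<in> AA s \<Longrightarrow> ei (tw s u) = ie u"
  and ie_tw [simp]: "u \<in> AA s \<Longrightarrow> ie (tw s u) = ei u"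
  and eps_ei: "u \<in> AA s \<Longrightarrow> \<epsilon> (ei u) = \<epsilon> (ie u)"
  by (induct rule: AA_induct, simp_all add: eps_simps mult.commute)+

lemma ie_tmapA: "lA \<phi> \<Longrightarrow> u \<in> AA s \<Longrightarrow> ie (tmapA s \<phi> (\<lambda>x. x) u) = \<phi> (ie u)"
  and ei_tmapA: "lA \<phi> \<Longrightarrow> u \<in> AA s \<Longrightarrow> ei (tmapA s (\<lambda>x. x) \<phi> u) = \<phi> (ei u)"
  by (rotate_tac, induct rule: AA_induct, simp_all add: lAD)+

text \<open>The first contraction applies \<epsilon> to the last leg, the second to the middle leg.
  Both bracketings are covered, so that a slice can be evaluated on either side of an interchange of
  \<open>LL\<close> with \<open>KK\<close>.\<close>

lemma B23_eps:
  shows B23_ie_ten: "w \<in> AA s \<Longrightarrow> B23 (\<lambda>x y. s (\<epsilon> y) x) (w \<otimes>\<^sub>3 c) = tsc (\<epsilon> c) w"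
    and B23_ie_J: "u \<in> AA s \<Longrightarrow> B23 (\<lambda>x y. s (\<epsilon> y) x) (J a u) = a \<otimes> ie u"
    and B23_ei_ten: "w \<in> AA s \<Longrightarrow> B23 (\<lambda>x y. s (\<epsilon> x) y) (w \<otimes>\<^sub>3 c) = ie w \<otimes> c"
    and B23_ei_J: "u \<in> AA s \<Longrightarrow> B23 (\<lambda>x y. s (\<epsilon> x) y) (J a u) = a \<otimes> ei u"
proof -
  show "B23 (\<lambda>x y. s (\<epsilon> y) x) (w \<otimes>\<^sub>3 c) = tsc (\<epsilon> c) w" if "w \<in> AA s"
    using that by (induct rule: AA_induct)
      (simp_all add: B23_simps[OF bl_eps(2)] lA_bl[OF bl_eps(2)] ten_simps tsc_add lA_scale)
  show "B23 (\<lambda>x y. s (\<epsilon> x) y) (w \<otimes>\<^sub>3 c) = ie w \<otimes> c" if "w \<in> AA s"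
    using that by (induct rule: AA_induct)
      (simp_all add: B23_simps[OF bl_eps(1)] lA_bl[OF bl_eps(1)] ten_simps)
qed (simp_all add: B23_simps[OF bl_eps(1)] B23_simps[OF bl_eps(2)] ideps_def epsid_def)

end

section \<open>Weak multiplier bialgebras via their structure maps\<close>

text \<open>The maps \<open>t\<^sub>i\<close> are the \<open>T\<^sub>i\<close>, while \<open>e1\<close> and \<open>e2\<close> (\<open>d1 a\<close> and \<open>d2 a\<close>) are the
  multiplications by \<open>E\<close> (by \<open>\<Delta>(a)\<close>) from the left and from the right.  The axioms are invariant
  under passing to the opposite algebra with the flipped coproduct.\<close>

locale wmb_maps = tens3_functional s \<epsilon>
  for s :: "'k::field \<Rightarrow> 'a::ab_group_add \<Rightarrow> 'a" and \<epsilon> +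
  fixes m :: "'a \<Rightarrow> 'a \<Rightarrow> 'a"
    and t1 t2 t3 t4 e1 e2 :: "('k,'a) AA \<Rightarrow> ('k,'a) AA"
    and d1 d2 :: "'a \<Rightarrow> ('k,'a) AA \<Rightarrow> ('k,'a) AA"
  assumes m_bl: "bl s m"
    and m_assoc: "m (m a b) c = m a (m b c)"
    and m_nd1: "(\<And>a. m a b = 0) \<Longrightarrow> b = 0" and m_nd2: "(\<And>a. m b a = 0) \<Longrightarrow> b = 0"
    and m_idem: "\<exists>xs. a = psum m xs"
    and lAA_maps [simp]: "lAA t1" "lAA t2" "lAA t3" "lAA t4" "lAA e1" "lAA e2"
    and lAA_d [simp]: "lAA (d1 a)" "lAA (d2 a)"
    and t12: "tmapA s (m c) (\<lambda>x. x) (t1 (a \<otimes> b)) = tmapA s (\<lambda>x. x) (\<lambda>y. m y b) (t2 (c \<otimes> a))"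
    and weak_t3: "ie (t3 (m b c \<otimes> x)) = ie (tmapA s (\<lambda>x. x) (m x) (t4 (c \<otimes> b)))"
    and weak_t4: "ei (t4 (x \<otimes> m a b)) = ei (tmapA s (\<lambda>y. m y x) (\<lambda>x. x) (t3 (b \<otimes> a)))"
    and coassoc: "z \<in> AAA s \<Longrightarrow> LL t2 (KK t1 z) = KK t1 (LL t2 z)"
    and counit1: "ei (t1 (a \<otimes> b)) = m a b" and counit2: "ie (t2 (a \<otimes> b)) = m a b"
    and counit3: "ei (t3 (b \<otimes> a)) = m a b" and counit4: "ie (t4 (b \<otimes> a)) = m a b"
    and barR_mult: "m (ie (t1 (b \<otimes> x))) y = m b (ie (e1 (y \<otimes> x)))"
    and barL_mult: "m y (ei (t2 (x \<otimes> b))) = m (ei (e2 (x \<otimes> y))) b"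
    and piR_mult: "m (ie (e2 (c \<otimes> x))) y = m c (ie (t3 (y \<otimes> x)))"
    and piL_mult: "m y (ei (e1 (x \<otimes> c))) = m (ei (t4 (x \<otimes> y))) c"
    and e1_t: "u \<in> AA s \<Longrightarrow> e1 (t1 u) = t1 u" "u \<in> AA s \<Longrightarrow> e1 (t4 u) = t4 u"
      "u \<in> AA s \<Longrightarrow> e1 (e1 u) = e1 u"
    and e2_t: "u \<in> AA s \<Longrightarrow> e2 (t2 u) = t2 u" "u \<in> AA s \<Longrightarrow> e2 (t3 u) = t3 u"
      "u \<in> AA s \<Longrightarrow> e2 (e2 u) = e2 u"
    and t2_e1: "z \<in> AAA s \<Longrightarrow> LL t2 (KK e1 z) = KK e1 (LL t2 z)"
    and e2_t1: "z \<in> AAA s \<Longrightarrow> LL e2 (KK t1 z) = KK t1 (LL e2 z)"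
    and e2_e1: "z \<in> AAA s \<Longrightarrow> LL e2 (KK e1 z) = KK e1 (LL e2 z)"
    and d1_t1: "u \<in> AA s \<Longrightarrow> d1 c (t1 u) = t1 (tmapA s (m c) (\<lambda>x. x) u)"
    and d2_t2: "u \<in> AA s \<Longrightarrow> d2 c (t2 u) = t2 (tmapA s (\<lambda>x. x) (\<lambda>y. m y c) u)"
    and d1_e1: "u \<in> AA s \<Longrightarrow> d1 c (e1 u) = d1 c u"
    and d2_e2: "u \<in> AA s \<Longrightarrow> d2 c (e2 u) = d2 c u"
    and e1_span: "u \<in> AA s \<Longrightarrow> \<exists>xs. set xs \<subseteq> UNIV \<times> AA s \<and> e1 u = psum d1 xs"
    and e2_span: "u \<in> AA s \<Longrightarrow> \<exists>xs. set xs \<subseteq> UNIV \<times> AA s \<and> e2 u = psum d2 xs"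
    and d1_ten: "d1 q (p \<otimes> a) = tmapA s (\<lambda>x. x) (\<lambda>y. m y a) (t4 (p \<otimes> q))"
    and d2_ten: "d2 q (a \<otimes> p) = tmapA s (m a) (\<lambda>x. x) (t3 (q \<otimes> p))"
begin

lemma lA_m [simp]: "lA (m c)" "lA (\<lambda>y. m y c)"
  using lA_bl[OF m_bl] by auto

lemma mD: "m (x + x') y = m x y + m x' y" "m x (y + y') = m x y + m x y'"
    "m (s c x) y = s c (m x y)" "m x (s c y) = s c (m x y)" "m 0 y = 0" "m x 0 = 0"
  using blD[OF m_bl] lAD[OF lA_m(1)] lAD[OF lA_m(2)] by auto

abbreviation l1 where "l1 c \<equiv> tmapA s (m c) (\<lambda>x. x)"
abbreviation r2 where "r2 c \<equiv> tmapA s (\<lambda>x. x) (\<lambda>y. m y c)"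
abbreviation l2 where "l2 c \<equiv> tmapA s (\<lambda>x. x) (m c)"
abbreviation r1 where "r1 c \<equiv> tmapA s (\<lambda>y. m y c) (\<lambda>x. x)"

abbreviation co :: "(('k,'a) AA \<Rightarrow> ('k,'a) AA) \<Rightarrow> ('k,'a) AA \<Rightarrow> ('k,'a) AA" where
  "co \<phi> \<equiv> \<lambda>u. tw s (\<phi> (tw s u))"

lemmas maps [simp] = lAA_maps[THEN lAAD(1)] lAA_maps[THEN lAAD(3)] lAA_d[THEN lAAD(1)] lAA_d[THEN lAAD(3)]

lemma co_lAA [simp]: "lAA \<phi> \<Longrightarrow> lAA (co \<phi>)"
  by (rule lAA_conj_tw)

lemma co_comm:
  assumes "lAA \<phi>" "lAA \<psi>" "\<And>x. x \<in> AAA s \<Longrightarrow> LL \<phi> (KK \<psi> x) = KK \<psi> (LL \<phi> x)" "x \<in> AAA s"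
  shows "LL (co \<psi>) (KK (co \<phi>) x) = KK (co \<phi>) (LL (co \<psi>) x)"
  using assms by (simp add: LL_flip KK_flip)

lemma psum_swap: "psum (\<lambda>x y. m y x) xs = psum m (map (\<lambda>p. (snd p, fst p)) xs)"
  by (induct xs) auto

lemma psum_co: "set xs \<subseteq> UNIV \<times> AA s \<Longrightarrow> (\<And>a. lAA (d a)) \<Longrightarrow>
    tw s (psum d xs) = psum (\<lambda>a u. tw s (d a (tw s u))) (map (\<lambda>p. (fst p, tw s (snd p))) xs)
    \<and> psum d xs \<in> AA s"
  by (induct xs) (auto simp: lAAD lAAD[OF lAA_tw])

text \<open>Reversing product and legs exchanges index 1 with 2 and index 3 with 4. The axioms are
  self-dual, like \<open>coassoc\<close>, or come in dual pairs, like \<open>barR_mult\<close> with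
  \<open>barL_mult\<close> and \<open>t2_e1\<close> with \<open>e2_t1\<close>. Every result of the
  locale therefore has a twin.\<close>

lemma mirror:
  "wmb_maps s \<epsilon> (\<lambda>x y. m y x) (co t2) (co t1) (co t4) (co t3) (co e2) (co e1) (\<lambda>a. co (d2 a)) (\<lambda>a. co (d1 a))"
proof (unfold_locales, goal_cases)
  case 1 show ?case by (rule blI) (simp_all add: mD)
next
  case 2 show ?case by (simp add: m_assoc)
next
  case 3 then show ?case by (rule m_nd2)
next
  case 4 then show ?case by (rule m_nd1)
next
  case (5 a)
  obtain xs where "a = psum m xs" using m_idem by blast
  then show ?case
    by (intro exI[of _ "map (\<lambda>p. (snd p, fst p)) xs"], simp add: psum_swap o_def)
next
  case (39 u)
  obtain xs where xs: "set xs \<subseteq> UNIV \<times> AA s" "e2 (tw s u) = psum d2 xs" using e2_span 39 tw_in by blast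
  show ?case
    by (rule exI[of _ "map (\<lambda>p. (fst p, tw s (snd p))) xs"])
     (use xs psum_co[OF xs(1), of d2] in auto)
next
  case (40 u)
  obtain xs where xs: "set xs \<subseteq> UNIV \<times> AA s" "e1 (tw s u) = psum d1 xs" using e1_span 40 tw_in by blast
  show ?case
    by (rule exI[of _ "map (\<lambda>p. (fst p, tw s (snd p))) xs"])
     (use xs psum_co[OF xs(1), of d1] in auto)
qed (simp_all only: lAA_maps lAA_d co_lAA co_comm coassoc t2_e1 e2_t1 e2_e1,
   simp_all add: tmapA_tw t12 weak_t3 weak_t4 counit1 counit2 counit3 counit4
   barR_mult barL_mult piR_mult piL_mult e1_t e2_t d1_t1 d2_t2 d1_e1 d2_e2 d1_ten d2_ten)

text \<open>In the notation of the paper, \<open>piR x q\<close> is \<open>\<sqinter>\<^sup>R(x) q\<close> and \<open>barR a x\<close> is \<open>a\<close> times the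
  barred variant of \<open>\<sqinter>\<^sup>R(x)\<close>; the map \<open>Gg\<close> below is \<open>G\<^sub>1\<close>.\<close>

definition barR where "barR a x = ie (t1 (a \<otimes> x))"
definition piR where "piR x q = ie (t3 (q \<otimes> x))"

lemma bl_barR: "bl s barR" and bl_piR: "bl s piR"
  by (rule blI; simp add: barR_def piR_def ten_simps lAAD)+

lemmas barR_simps [simp] = lA_bl[OF bl_barR] blD[OF bl_barR]
lemmas piR_simps [simp] = lA_bl[OF bl_piR] blD[OF bl_piR]

section \<open>Construction of the map \<open>Gg\<close>\<close>

lemma barR_mult': "m (barR b x) y = m b (ie (e1 (y \<otimes> x)))"
  by (simp add: barR_def barR_mult)

lemma cancel_l1:
  assumes "u \<in> AA s" "v \<in> AA s" "\<And>c. l1 c u = l1 c v" shows "u = v"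
  by (rule tmapA_separates[where \<phi> = m and \<psi> = "\<lambda>_. (\<lambda>x. x)"]) (use assms m_nd1 in auto)

lemma A_induct [case_names mul add]:
  assumes "\<And>b c. P (m b c)" "\<And>x y. P x \<Longrightarrow> P y \<Longrightarrow> P (x + y)"
  shows "P a"
proof -
  obtain xs where xs: "a = psum m xs" using m_idem by blast
  have "P (psum m ys)" for ys
    by (induct ys) (use assms(1)[of 0 0] in \<open>auto simp: mD assms\<close>)
  then show ?thesis using xs by simp
qed

lemma m_barR: "m d (barR a x) = ie (r2 x (t2 (d \<otimes> a)))"
  by (simp add: barR_def t12[symmetric] ie_tmapA)

text \<open>\<open>Ht a (t4 (c \<otimes> b))\<close> is the value prescribed for
  \<open>G\<^sub>1\<close> on a \<otimes> bc; the twist is absorbed in the order of the bound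
  variables.\<close>

definition Ht where "Ht a t = tlA s (\<lambda>y x. barR a x \<otimes> y) t"

lemma bl_Ht: "bl tsc (\<lambda>y x. barR a x \<otimes> y)"
  by (rule blI) (simp_all add: ten_simps)

lemma Ht_simps [simp]:
  shows "Ht a (y \<otimes> x) = barR a x \<otimes> y" "u \<in> AA s \<Longrightarrow> v \<in> AA s \<Longrightarrow> Ht a (u + v) = Ht a u + Ht a v"
    "t \<in> AA s \<Longrightarrow> Ht a t \<in> AA s"
  by (auto simp: Ht_def bl_tlA[OF bl_Ht] intro!: tlA_in[OF bl_Ht])

lemma Ht_add:
  assumes "t \<in> AA s" shows "Ht (a + b) t = Ht a t + Ht b t"
  using assms by (induct rule: AA_induct) (simp_all add: ten_simps add_ac)

lemma Ht_scale:
  assumes "t \<in> AA s" shows "Ht (s c a) t = tsc c (Ht a t)"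
  using assms by (induct rule: AA_induct) (simp_all add: ten_simps tsc_add)

lemmas Ht_left = Ht_add Ht_scale

definition Pi where "Pi q = tmapA s (\<lambda>x. x) (\<lambda>x. piR x q)"

lemma Pi_simps [simp]:
  shows "Pi q (p \<otimes> x) = p \<otimes> piR x q" "u \<in> AA s \<Longrightarrow> v \<in> AA s \<Longrightarrow> Pi q (u + v) = Pi q u + Pi q v"
    "t \<in> AA s \<Longrightarrow> Pi q t \<in> AA s"
  by (simp_all add: Pi_def)

lemma Pi_add:
  assumes "t \<in> AA s" shows "Pi (q + q') t = Pi q t + Pi q' t"
  using assms by (induct rule: AA_induct) (simp_all add: ten_simps add_ac)

lemma Pi_scale:
  assumes "t \<in> AA s" shows "Pi (s c q) t = tsc c (Pi q t)"
  using assms by (induct rule: AA_induct) (simp_all add: ten_simps tsc_add)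

text \<open>Both sides are \<open>\<Sum> d a\<^sub>1 \<otimes> \<epsilon>(a\<^sub>2 b\<^sub>2) b\<^sub>1 c\<close>; the right hand side depends on
  \<open>b c\<close> only, which makes \<open>G\<^sub>1\<close> well defined.\<close>

lemma l1_Ht: "l1 d (Ht a (t4 (c \<otimes> b))) = Pi (m b c) (t2 (d \<otimes> a))"
proof -
  \<comment> \<open>For v = \<Sum> p \<otimes> q and t = \<Sum> y \<otimes> x both sides are \<Sum>
    p \<otimes> \<epsilon>(q x) y; the scalar only changes the leg to which it is attached.\<close>
  have 1: "tlA s (\<lambda>y x. ie (r2 x v) \<otimes> y) t = tmapA s (\<lambda>x. x) (\<lambda>q. ie (l2 q t)) v"
    if "v \<in> AA s" "t \<in> AA s" for v t
  proof -
    have la: "lA (\<lambda>q. ie (l2 q t))" if t: "t \<in> AA s" for t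
    proof -
      have "ie (l2 (q + q') t) = ie (l2 q t) + ie (l2 q' t)" for q q'
        using t by (induct rule: AA_induct)
          (simp_all add: mD eps_simps scale_left_distrib add_ac tmapA_add_right lA_add)
      moreover have "ie (l2 (s k q) t) = s k (ie (l2 q t))" for q k
        using t by (induct rule: AA_induct)
          (simp_all add: mD eps_simps scale_right_distrib tmapA_scale_right lA_scale)
      ultimately
      show ?thesis by (simp add: lin_on_def)
    qed
    have r: "ie (r2 (x + x') v) = ie (r2 x v) + ie (r2 x' v)" for x x'
      using that(1) by (induct rule: AA_induct)
        (simp_all add: mD eps_simps scale_left_distrib add_ac tmapA_add_right lA_add)
    have r': "ie (r2 (s k x) v) = s k (ie (r2 x v))" for x k
      using that(1) by (induct rule: AA_induct)
        (simp_all add: mD eps_simps scale_right_distrib tmapA_scale_right lA_scale)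
    have b: "bl tsc (\<lambda>y x. ie (r2 x v) \<otimes> y)"
      by (rule blI) (simp_all add: ten_simps r r')
    show ?thesis
      using that(2)
    proof (induct rule: AA_induct)
      case (ten y x)
      have "lA (\<lambda>q. s (\<epsilon> (m q x)) y)"
        by (simp add: lin_on_def mD eps_simps scale_left_distrib)
      with that(1) show ?case
        by (simp add: tlA_ten[OF b])
          (induct rule: AA_induct, simp_all add: ten_simps)
    next
      case (add t t')
      have "lA (\<lambda>q. ie (l2 q t) + ie (l2 q t'))"
        by (intro lA_add la add)
      then show ?case using add that(1) la[OF add(1)] la[OF add(2)]
        by (simp add: bl_tlA[OF b] tmapA_add_right)
    qed
  qed
  have 2: "l1 d (Ht a t) = tlA s (\<lambda>y x. m d (barR a x) \<otimes> y) t" if "t \<in> AA s" for t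
  proof -
    have b: "bl tsc (\<lambda>y x. m d (barR a x) \<otimes> y)"
      by (rule blI) (simp_all add: ten_simps mD)
    from that show ?thesis
      by (induct rule: AA_induct) (simp_all add: bl_tlA[OF b])
  qed
  show ?thesis by (simp add: 1 2 m_barR weak_t3[symmetric] piR_def[symmetric] Pi_def)
qed

text \<open>A formula in terms of q = bc would depend on the factorisation. Prescribing all products
  (d \<otimes> 1) g determines g by non-degeneracy, and the prescription is additive in q, so
  existence can be checked on products.\<close>

definition G0 where "G0 a q = (THE g. g \<in> AA s \<and> (\<forall>d. l1 d g = Pi q (t2 (d \<otimes> a))))"

lemma G0_ex: "\<exists>g. g \<in> AA s \<and> (\<forall>d. l1 d g = Pi q (t2 (d \<otimes> a)))"
proof (induct q rule: A_induct)
  case (mul b c)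
  show ?case by (rule exI[of _ "Ht a (t4 (c \<otimes> b))"]) (simp add: l1_Ht)
next
  case (add x y)
  then obtain g h where "g \<in> AA s" "\<forall>d. l1 d g = Pi x (t2 (d \<otimes> a))" "h \<in> AA s" "\<forall>d. l1 d h = Pi y (t2 (d \<otimes> a))"
    by blast
  then show ?case by (intro exI[of _ "g + h"]) (simp add: Pi_add)
qed

lemma G0:
  shows G0_in [simp]: "G0 a q \<in> AA s" and l1_G0: "l1 d (G0 a q) = Pi q (t2 (d \<otimes> a))"
proof -
  obtain g where g: "g \<in> AA s" "\<forall>d. l1 d g = Pi q (t2 (d \<otimes> a))" using G0_ex by blast
  have "G0 a q = g" unfolding G0_def
    by (rule the_equality) (use g cancel_l1 in auto)
  then show "G0 a q \<in> AA s" "l1 d (G0 a q) = Pi q (t2 (d \<otimes> a))" using g by auto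
qed

lemma G0_eqI: "g \<in> AA s \<Longrightarrow> (\<And>d. l1 d g = Pi q (t2 (d \<otimes> a))) \<Longrightarrow> G0 a q = g"
  by (rule cancel_l1) (simp_all add: l1_G0)

lemma G0_mul: "G0 a (m b c) = Ht a (t4 (c \<otimes> b))"
  by (rule G0_eqI) (simp_all add: l1_Ht)

lemma bl_G0: "bl tsc G0"
proof (rule blI)
  note [simp] = lAAD(2)[OF lAA_tmapA]
  show "G0 (x + x') y = G0 x y + G0 x' y" for x x' y
    by (rule G0_eqI) (simp_all add: l1_G0 ten_simps)
  show "G0 x (y + y') = G0 x y + G0 x y'" for x y y'
    by (rule G0_eqI) (simp_all add: l1_G0 Pi_add)
  show "G0 (s c x) y = tsc c (G0 x y)" for c x y
    by (rule G0_eqI) (simp_all add: l1_G0 ten_simps lAAD Pi_def)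
  show "G0 x (s c y) = tsc c (G0 x y)" for c x y
    by (rule G0_eqI) (simp_all add: l1_G0 Pi_scale)
qed

definition Gg where "Gg u = (if u \<in> AA s then tlA s G0 u else 0)"

lemma Gg_simps [simp]:
  shows Gg_lAA: "lAA Gg" and Gg_ten: "Gg (a \<otimes> q) = G0 a q"
    and Gg_add: "u \<in> AA s \<Longrightarrow> v \<in> AA s \<Longrightarrow> Gg (u + v) = Gg u + Gg v"
    and Gg_in: "u \<in> AA s \<Longrightarrow> Gg u \<in> AA s" and Gg_out: "u \<notin> AA s \<Longrightarrow> Gg u = 0"
proof -
  have "lAA (tlA s G0)" by (rule lAA_tlA[OF bl_G0]) simp
  note * = lAAD[OF this]
  show "lAA Gg" by (rule lAAI) (simp_all add: Gg_def *)
qed (auto simp: Gg_def tlA_ten[OF bl_G0] tlA_add[OF bl_G0] intro!: tlA_in[OF bl_G0])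

section \<open>Relations of \<open>G\<^sub>1\<close> with \<open>T\<^sub>1\<close>, the counit and
  operators on the first two legs\<close>

lemma B23_ie_LL:
  assumes "lAA \<phi>" "z \<in> AAA s"
  shows "B23 (\<lambda>x y. s (\<epsilon> y) x) (LL \<phi> z) = \<phi> (B23 (\<lambda>x y. s (\<epsilon> y) x) z)"
  using assms(2) by (induct rule: AAA_induct_3)
    (simp_all add: B23_eps assms(1) lAAD[OF assms(1)] B23_simps[OF bl_eps(2)])

text \<open>Apply \<epsilon> to the third leg of the interchange law at a \<otimes> b \<otimes> x.
  Since \<Phi> acts on the first two legs, it passes through that slice.\<close>

lemma slice_commute:
  assumes "lAA \<Phi>" "lAA \<phi>" "\<And>z. z \<in> AAA s \<Longrightarrow> LL \<Phi> (KK \<phi> z) = KK \<phi> (LL \<Phi> z)"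
  shows "\<Phi> (a \<otimes> ie (\<phi> (b \<otimes> x))) = tmapA s (\<lambda>x. x) (\<lambda>q. ie (\<phi> (q \<otimes> x))) (\<Phi> (a \<otimes> b))"
proof -
  have la: "lA (\<lambda>q. ie (\<phi> (q \<otimes> x)))"
    by (simp add: lin_on_def ten_simps lAAD[OF assms(2)])
  have 1: "B23 (\<lambda>x y. s (\<epsilon> y) x) (KK \<phi> (w \<otimes>\<^sub>3 x)) = tmapA s (\<lambda>x. x) (\<lambda>q. ie (\<phi> (q \<otimes> x))) w" if "w \<in> AA s" for w
    using that by (induct rule: AA_induct)
      (simp_all add: assms la ten3_simps B23_eps lAAD[OF assms(2)] B23_simps[OF bl_eps(2)])
  have "\<Phi> (a \<otimes> ie (\<phi> (b \<otimes> x))) = \<Phi> (B23 (\<lambda>x y. s (\<epsilon> y) x) (KK \<phi> (a \<otimes> b \<otimes>\<^sub>3 x)))"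
    by (simp add: assms(1,2) B23_eps lAAD[OF assms(2)])
  also have "\<dots> = B23 (\<lambda>x y. s (\<epsilon> y) x) (KK \<phi> (LL \<Phi> (a \<otimes> b \<otimes>\<^sub>3 x)))"
    by (simp only: B23_ie_LL[symmetric] assms lA_id idLg_in ten3_in ten_in)
  also have "\<dots> = tmapA s (\<lambda>x. x) (\<lambda>q. ie (\<phi> (q \<otimes> x))) (\<Phi> (a \<otimes> b))"
    by (simp add: 1 assms(1) lAAD[OF assms(1)])
  finally show ?thesis .
qed

text \<open>Let n be the barred multiplier of x. Slicing \<open>coassoc\<close> gives \<Delta>(b n)
  = \<Delta>(b)(1 \<otimes> n), tested by a \<otimes> 1; slicing \<open>e2_t1\<close> gives that 1
  \<otimes> n commutes with E.\<close>

lemma t2_barR: "t2 (a \<otimes> barR b x) = tmapA s (\<lambda>x. x) (\<lambda>q. barR q x) (t2 (a \<otimes> b))"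
  and e2_barR: "e2 (a \<otimes> barR b x) = tmapA s (\<lambda>x. x) (\<lambda>q. barR q x) (e2 (a \<otimes> b))"
  unfolding barR_def using slice_commute[OF _ _ coassoc] slice_commute[OF _ _ e2_t1] by auto

text \<open>For the barred multiplier n of x this is again \<Delta>(a n) = \<Delta>(a)(1 \<otimes>
  n). That law is available for \<open>t2\<close>, so d \<otimes> 1 is multiplied on first and
  \<open>t12\<close> trades \<open>t1\<close> for \<open>t2\<close>.\<close>

lemma t1_barR: "t1 (barR a x \<otimes> y) = t1 (a \<otimes> ie (e1 (y \<otimes> x)))"
proof (rule cancel_l1)
  fix d
  have "r2 y (tmapA s (\<lambda>x. x) (\<lambda>q. barR q x) v) = r2 (ie (e1 (y \<otimes> x))) v" if "v \<in> AA s" for v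
    using that by (induct rule: AA_induct) (simp_all add: barR_mult')
  then show "l1 d (t1 (barR a x \<otimes> y)) = l1 d (t1 (a \<otimes> ie (e1 (y \<otimes> x))))"
    by (simp add: t12 t2_barR)
qed simp_all

text \<open>Move the barred multipliers across \<open>t1\<close>. The second argument becomes (id
  \<otimes> \<epsilon>)(E \<Delta>(b)(c \<otimes> 1)), where E is absorbed and the counit leaves
  bc.\<close>

lemma t1_G0: "t1 (G0 a q) = t1 (a \<otimes> q)"
proof (induct q rule: A_induct)
  case (mul b c)
  have "t1 (Ht a t) = t1 (a \<otimes> ie (e1 t))" if "t \<in> AA s" for t
    using that by (induct rule: AA_induct) (simp_all add: t1_barR ten_simps)
  then show ?case by (simp add: G0_mul e1_t counit4)
qed (simp add: blD[OF bl_G0] ten_simps)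

lemma t1_Gg: "u \<in> AA s \<Longrightarrow> t1 (Gg u) = t1 u"
  by (induct rule: AA_induct) (simp_all add: t1_G0)

text \<open>For the barred multiplier n of z the counit gives \<epsilon>(x n) = \<epsilon>(x z). The
  slice of \<open>Ht\<close> thus becomes (id \<otimes> \<epsilon>)((1 \<otimes> x) \<Delta>(b)(c
  \<otimes> 1)), which \<open>weak_t3\<close> identifies.\<close>

lemma ei_G0: "ei (G0 x q) = piR x q"
proof (induct q rule: A_induct)
  case (mul b c)
  have e: "\<epsilon> (barR x z) = \<epsilon> (m x z)" for z
    unfolding barR_def by (subst eps_ei[symmetric]) (simp_all add: counit1)
  have "ei (Ht x t) = ie (l2 x t)" if "t \<in> AA s" for t
    using that by (induct rule: AA_induct) (simp_all add: e)
  then show ?case by (simp add: G0_mul weak_t3 piR_def)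
qed (simp add: blD[OF bl_G0])

lemma ei_Gg: "u \<in> AA s \<Longrightarrow> ei (Gg u) = tlA s piR u"
  by (induct rule: AA_induct) (simp_all add: ei_G0 bl_tlA[OF bl_piR])

text \<open>\<open>G\<^sub>1\<close> only multiplies the first factor on the right by elements of the image of
  \<open>\<sqinter>\<^sup>R\<close>-type multipliers, so it suffices that \<open>\<Phi>\<close> commutes with those.\<close>

lemma Gg_commute:
  assumes \<Phi>: "lAA \<Phi>" and b: "\<And>a b x. \<Phi> (a \<otimes> barR b x) = tmapA s (\<lambda>x. x) (\<lambda>q. barR q x) (\<Phi> (a \<otimes> b))"
    and z: "z \<in> AAA s"
  shows "LL \<Phi> (KK Gg z) = KK Gg (LL \<Phi> z)"
proof -
  \<comment> \<open>For v = \<Sum> p \<otimes> q and t = \<Sum> y \<otimes> x this is \<Sum> p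
    \<otimes> \<open>barR q x\<close> \<otimes> y. Both orders of composition reduce to it, with t =
    \<open>t4 (e \<otimes> d)\<close> when the third factor is the product of d and e.\<close>
  define N where "N t v = tlA s (\<lambda>p q. J p (Ht q t)) v" for t v
  have bN: "bl tsc (\<lambda>p q. J p (Ht q t))" if "t \<in> AA s" for t
    by (rule blI) (use that in \<open>simp_all add: J_add_left J_scale_left Ht_left J_scale\<close>)
  have N: "N t (p \<otimes> q) = J p (Ht q t)" "u \<in> AA s \<Longrightarrow> v \<in> AA s \<Longrightarrow> N t (u + v) = N t u + N t v"
    if "t \<in> AA s" for t p q u v
    by (simp_all add: N_def bl_tlA[OF bN[OF that]])
  have N1: "N (y \<otimes> x) v = tmapA s (\<lambda>x. x) (\<lambda>q. barR q x) v \<otimes>\<^sub>3 y" if "v \<in> AA s" for x y v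
    using that by (induct rule: AA_induct) (simp_all add: N ten3_simps)
  have N2: "N (t + t') v = N t v + N t' v" if "t \<in> AA s" "t' \<in> AA s" "v \<in> AA s" for t t' v
    using that(3) by (induct rule: AA_induct) (use that(1,2) in \<open>simp_all add: N add_ac\<close>)
  have 1: "LL \<Phi> (J a (Ht b t)) = N t (\<Phi> (a \<otimes> b))" if "t \<in> AA s" for a b t
    using that by (induct rule: AA_induct) (simp_all add: \<Phi> N1 N2 b lAAD[OF \<Phi>])
  have 2: "KK Gg (v \<otimes>\<^sub>3 m d e) = N (t4 (e \<otimes> d)) v" if "v \<in> AA s" for v d e
    using that by (induct rule: AA_induct) (simp_all add: N ten3_simps G0_mul)
  have 3: "LL \<Phi> (KK Gg (a \<otimes> b \<otimes>\<^sub>3 c)) = KK Gg (LL \<Phi> (a \<otimes> b \<otimes>\<^sub>3 c))" for a b c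
  proof (rule A_induct[where P = "\<lambda>c. LL \<Phi> (KK Gg (a \<otimes> b \<otimes>\<^sub>3 c)) = KK Gg (LL \<Phi> (a \<otimes> b \<otimes>\<^sub>3 c))"])
    fix d e
    have "KK Gg (a \<otimes> b \<otimes>\<^sub>3 m d e) = J a (Ht b (t4 (e \<otimes> d)))" by (simp add: G0_mul)
    then show "LL \<Phi> (KK Gg (a \<otimes> b \<otimes>\<^sub>3 m d e)) = KK Gg (LL \<Phi> (a \<otimes> b \<otimes>\<^sub>3 m d e))"
      by (simp add: 1 2 \<Phi> lAAD[OF \<Phi>])
  qed (simp add: ten3_simps \<Phi> lAAD[OF \<Phi>] del: idLg_ten idLg_J Rg_ten)
  show ?thesis
    by (rule AAA_induct[where P = "\<lambda>z. LL \<Phi> (KK Gg z) = KK Gg (LL \<Phi> z)", OF z]) (simp_all only: 3 idLg_add Rg_add idLg_in Rg_in \<Phi> Gg_lAA lA_id)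
qed

lemmas t2_Gg = Gg_commute[OF lAA_maps(2) t2_barR]
lemmas e2_Gg = Gg_commute[OF lAA_maps(6) e2_barR]

end

text \<open>Since G R = R and R E = R, one has X R = X G R = G X R = R T X R = R X T R = R X E = R E
  X = R X.\<close>

lemma commute_inverse:
  assumes V: "\<And>x. x \<in> V \<Longrightarrow> X x \<in> V" "\<And>x. x \<in> V \<Longrightarrow> R x \<in> V" "\<And>x. x \<in> V \<Longrightarrow> T x \<in> V"
    and R: "\<And>x. x \<in> V \<Longrightarrow> R (T x) = G x" "\<And>x. x \<in> V \<Longrightarrow> T (R x) = E x" "\<And>x. x \<in> V \<Longrightarrow> R (T (R x)) = R x"
    and X: "\<And>x. x \<in> V \<Longrightarrow> X (T x) = T (X x)" "\<And>x. x \<in> V \<Longrightarrow> X (G x) = G (X x)" "\<And>x. x \<in> V \<Longrightarrow> X (E x) = E (X x)"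
    and x: "x \<in> V"
  shows "X (R x) = R (X x)"
proof -
  have "X (R x) = X (G (R x))" using V R x by metis
  also have "\<dots> = R (T (X (R x)))" using V R(1) X(2) x by simp
  also have "\<dots> = R (X (E x))" using V R(2) X(1) x by metis
  also have "\<dots> = R (T (R (X x)))" using V R(2) X(3) x by simp
  also have "\<dots> = R (X x)" using V R(3) x by simp
  finally show ?thesis .
qed

section \<open>Generalised inverses of linear maps\<close>

context tens3
begin

lemma J_zero [simp]: "J a 0 = 0"
  using J_ten[of a 0 0] by simp

lemma LL_zero: "lAA \<phi> \<Longrightarrow> LL \<phi> 0 = 0"
  using Rg_ten[of \<phi> "\<lambda>x. x" 0 0] by simp

lemma B23_zero: "bl s \<beta> \<Longrightarrow> B23 \<beta> 0 = 0"
  using B23_J[of \<beta> 0 0] by simp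

definition ginv where
  "ginv t e g r \<longleftrightarrow> lAA r \<and> (\<forall>u\<in>AA s. r (t u) = g u \<and> t (r u) = e u \<and> r (t (r u)) = r u)"

lemma ginv_unique: "ginv t e g r \<Longrightarrow> ginv t e g r' \<Longrightarrow> u \<in> AA s \<Longrightarrow> r u = r' u"
  unfolding ginv_def by (metis lAAD(3))

text \<open>Take r = g p, where p u is any preimage of e u under t. Then r t = g because e t = t, t
  r = e because t g = t, and r t r = r because e e = e.\<close>

lemma ginv_exists:
  assumes t: "lAA t" and e: "lAA e" and g: "lAA g"
    and im: "\<And>u. u \<in> AA s \<Longrightarrow> \<exists>w\<in>AA s. t w = e u"
    and ker: "\<And>u. u \<in> AA s \<Longrightarrow> t u = 0 \<Longrightarrow> g u = 0"
    and tg: "\<And>u. u \<in> AA s \<Longrightarrow> t (g u) = t u"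
    and et: "\<And>u. u \<in> AA s \<Longrightarrow> e (t u) = t u" and ee: "\<And>u. u \<in> AA s \<Longrightarrow> e (e u) = e u"
  shows "\<exists>r. ginv t e g r"
proof -
  define p where "p u = (SOME w. w \<in> AA s \<and> t w = e u)" for u
  have p: "p u \<in> AA s" "t (p u) = e u" if "u \<in> AA s" for u
    using someI_ex[of "\<lambda>w. w \<in> AA s \<and> t w = e u"] im[OF that] by (auto simp: p_def)
  have gp: "g w = g (p u)" if "u \<in> AA s" "w \<in> AA s" "t w = e u" for u w
  proof -
    have "g (w - p u) = 0" by (rule ker) (use that p in \<open>auto simp: lAA_diff[OF t]\<close>)
    then show ?thesis using that p by (simp add: lAA_diff[OF g])
  qed
  have lin: "lAA (\<lambda>u. g (p u))"
  proof (rule lAAI)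
    fix u v assume uv: "u \<in> AA s" "v \<in> AA s"
    show "g (p (u + v)) = g (p u) + g (p v)"
      using gp[of "u + v" "p u + p v"] uv p by (simp add: lAAD[OF t] lAAD[OF e] lAAD[OF g])
  next
    fix c u assume u: "u \<in> AA s"
    show "g (p (tsc c u)) = tsc c (g (p u))"
      using gp[of "tsc c u" "tsc c (p u)"] u p by (simp add: lAAD[OF t] lAAD[OF e] lAAD[OF g])
  qed (simp add: p lAAD[OF g])
  have "g (p (t u)) = g u" "t (g (p u)) = e u" "g (p (t (g (p u)))) = g (p u)" if u: "u \<in> AA s" for u
  proof -
    show "g (p (t u)) = g u" using gp[of "t u" u] u et by (simp add: lAAD[OF t])
    show 1: "t (g (p u)) = e u" using tg p u by simp
    show "g (p (t (g (p u)))) = g (p u)"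
      unfolding 1 using gp[of "e u" "p u"] u p ee by (simp add: lAAD[OF e])
  qed
  then have "ginv t e g (\<lambda>u. g (p u))" using lin by (auto simp: ginv_def)
  then show ?thesis by blast
qed

lemma ginv_co:
  assumes "lAA t" "lAA e" "lAA g" "ginv t e g r"
  shows "ginv (\<lambda>u. tw s (t (tw s u))) (\<lambda>u. tw s (e (tw s u))) (\<lambda>u. tw s (g (tw s u))) (\<lambda>u. tw s (r (tw s u)))"
proof -
  have r: "lAA r" "r (t u) = g u" "t (r u) = e u" "r (e u) = r u" if "u \<in> AA s" for u
    using assms(4) that by (auto simp: ginv_def)
  then show ?thesis
    using assms(1-3) lAA_conj_tw[of r] by (auto simp: ginv_def lAAD)
qed

end

section \<open>From S to generalised inverses\<close>

context wmb_maps
begin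

text \<open>The arguments stand for \<open>\<sigma> a b = S(a) b\<close> and \<open>\<rho> a c = c S(a)\<close>.\<close>

definition S_ok where
  "S_ok \<sigma> \<rho> \<longleftrightarrow> bl s \<sigma> \<and> bl s \<rho> \<and> (\<forall>a b c. m c (\<sigma> a b) = m (\<rho> a c) b)
    \<and> (\<forall>a b c. t1 (tmapA s (\<lambda>x. x) (\<lambda>y. \<sigma> y c) (t2 (a \<otimes> b))) = d1 a (b \<otimes> c))
    \<and> (\<forall>a b c. t2 (tmapA s (\<lambda>x. \<rho> x c) (\<lambda>x. x) (t1 (b \<otimes> a))) = d2 a (c \<otimes> b))"

text \<open>Apply id \<otimes> \<epsilon> to (viii). The counit law for \<open>t2\<close> and the
  link turn the left side into a times the sum, the right side becomes a times the value of
  \<open>piR\<close>, and a is cancelled.\<close>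

lemma S_ok_t1:
  assumes S: "S_ok \<sigma> \<rho>"
  shows "tlA s \<sigma> (t1 (b \<otimes> c)) = piR b c"
proof -
  have bl: "bl s \<sigma>" "bl s \<rho>" and link: "m c (\<sigma> a b) = m (\<rho> a c) b"
    and viii: "t2 (tmapA s (\<lambda>x. \<rho> x c) (\<lambda>x. x) (t1 (b \<otimes> a))) = d2 a (c \<otimes> b)" for a b c
    using S by (auto simp: S_ok_def)
  note [simp] = lA_bl[OF bl(1)] lA_bl[OF bl(2)] bl_tlA[OF bl(1)]
  have 1: "m a (tlA s \<sigma> v) = ie (t2 (tmapA s (\<lambda>x. \<rho> x a) (\<lambda>x. x) v))" if "v \<in> AA s" for a v
    using that by (induct rule: AA_induct) (simp_all add: mD link counit2)
  have "m a (tlA s \<sigma> (t1 (b \<otimes> c)) - piR b c) = 0" for a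
    using lAD[OF lA_m(1)] by (simp add: 1 viii d2_ten ie_tmapA piR_def[symmetric] lin_on_diff[OF subspace_UNIV lA_m(1)])
  then show ?thesis using m_nd1 by (metis right_minus_eq)
qed

lemma S_ok_ginv:
  assumes S: "S_ok \<sigma> \<rho>"
  shows "\<exists>r. ginv t1 e1 Gg r"
proof (rule ginv_exists)
  have bl: "bl s \<sigma>" and vii: "t1 (tmapA s (\<lambda>x. x) (\<lambda>y. \<sigma> y c) (t2 (a \<otimes> b))) = d1 a (b \<otimes> c)" for a b c
    using S by (auto simp: S_ok_def)
  note [simp] = lA_bl[OF bl]
  \<comment> \<open>Image condition: (vii) exhibits a preimage of each \<Delta>(a)(b \<otimes> c),
    and these elements span the image of E.\<close>
  have d: "\<exists>w\<in>AA s. t1 w = d1 a u" if "u \<in> AA s" for a u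
    using that
  proof (induct rule: AA_induct)
    case (ten b c)
    show ?case
      by (rule bexI[where x = "tmapA s (\<lambda>x. x) (\<lambda>y. \<sigma> y c) (t2 (a \<otimes> b))"]) (simp_all add: vii)
  next
    case (add u v)
    then obtain w w' where "w \<in> AA s" "t1 w = d1 a u" "w' \<in> AA s" "t1 w' = d1 a v" by blast
    with add show ?case by (intro bexI[of _ "w + w'"]) auto
  qed
  have "\<exists>w\<in>AA s. t1 w = psum d1 xs" if "set xs \<subseteq> UNIV \<times> AA s" for xs
    using that
  proof (induct xs)
    case Nil
    show ?case by (rule bexI[of _ 0]) (simp_all add: lAAD[OF lAA_maps(1)])
  next
    case (Cons p xs)
    then obtain w w' where "w \<in> AA s" "t1 w = d1 (fst p) (snd p)" "w' \<in> AA s" "t1 w' = psum d1 xs"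
      using d[of "snd p" "fst p"] by (cases p) auto
    then show ?case by (intro bexI[of _ "w + w'"]) auto
  qed
  then show "\<exists>w\<in>AA s. t1 w = e1 u" if "u \<in> AA s" for u
    using e1_span[OF that] by metis
  show "Gg u = 0" if u: "u \<in> AA s" "t1 u = 0" for u
  proof (rule cancel_l1)
    fix c
    have 1: "B23 \<sigma> (KK t1 (v \<otimes>\<^sub>3 q)) = Pi q v" if "v \<in> AA s" for v q
      using that by (induct rule: AA_induct) (simp_all add: ten3_simps B23_simps[OF bl] S_ok_t1[OF S])
    \<comment> \<open>Kernel condition: \<open>coassoc\<close> moves \<open>t2\<close> inside
      \<open>t1\<close>, where \<open>S_ok_t1\<close> turns \<sigma> into \<open>piR\<close>. So (c
      \<otimes> 1) \<open>Gg v\<close> is a function of \<open>t1 v\<close> alone.\<close>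
    have "l1 c (Gg v) = B23 \<sigma> (LL t2 (J c (t1 v)))" if "v \<in> AA s" for v
      using that
    proof (induct rule: AA_induct)
      case (ten p q)
      have "B23 \<sigma> (LL t2 (J c (t1 (p \<otimes> q)))) = B23 \<sigma> (LL t2 (KK t1 (c \<otimes> p \<otimes>\<^sub>3 q)))" by simp
      also have "\<dots> = Pi q (t2 (c \<otimes> p))" by (simp add: coassoc 1 del: idLg_ten)
      finally show ?case by (simp add: l1_G0)
    qed (simp add: B23_simps[OF bl])
    from this[OF u(1)] show "l1 c (Gg u) = l1 c 0"
      using u by (simp add: lAAD(4)[OF lAA_tmapA[OF lA_m(1) lA_id(2)]] LL_zero B23_zero[OF bl])
  qed (use u in auto)
qed (simp_all add: t1_Gg e1_t)

lemma S_ok_unique: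
  assumes S: "S_ok \<sigma> \<rho>" "S_ok \<sigma>' \<rho>'"
    and ix: "\<And>a b. tlA s \<sigma> (e1 (a \<otimes> b)) = \<sigma> a b" "\<And>a b. tlA s \<sigma>' (e1 (a \<otimes> b)) = \<sigma>' a b"
  shows "\<sigma> a b = \<sigma>' a b"
proof -
  have pi: "tlA s \<tau> (t1 w) = tlA s piR w" if "S_ok \<tau> \<theta>" "w \<in> AA s" for \<tau> \<theta> w
  proof -
    have b: "bl s \<tau>" using that by (simp add: S_ok_def)
    from that(2) show ?thesis
      by (induct rule: AA_induct) (simp_all add: bl_tlA[OF bl_piR] bl_tlA[OF b] S_ok_t1[OF that(1)])
  qed
  \<comment> \<open>The map r is built from the first pair, but it only supplies one preimage of E(a
    \<otimes> b) under \<open>t1\<close>, which then serves both pairs.\<close>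
  obtain r where "ginv t1 e1 Gg r" using S_ok_ginv[OF S(1)] by blast
  then have "e1 (a \<otimes> b) = t1 (r (a \<otimes> b))" "r (a \<otimes> b) \<in> AA s" by (auto simp: ginv_def lAAD)
  then show ?thesis using ix pi S by metis
qed

section \<open>The map \<open>G\<^sub>2\<close> and its interchange laws\<close>

lemma LL_co:
  assumes "lAA \<phi>" "z \<in> AAA s"
  shows "LL (co \<phi>) z = flip3 (KK \<phi> (flip3 z))" and "KK (co \<phi>) z = flip3 (LL \<phi> (flip3 z))"
    and "LL \<phi> z = flip3 (KK (co \<phi>) (flip3 z))" and "KK \<phi> z = flip3 (LL (co \<phi>) (flip3 z))"
  using assms by (simp_all add: LL_flip KK_flip)

interpretation mir: wmb_maps s \<epsilon> "\<lambda>x y. m y x" "co t2" "co t1" "co t4" "co t3" "co e2" "co e1"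
    "\<lambda>a. co (d2 a)" "\<lambda>a. co (d1 a)"
  by (rule mirror)

definition Gg2 where "Gg2 = co mir.Gg"

lemma Gg2_simps [simp]:
  shows "lAA Gg2" "u \<in> AA s \<Longrightarrow> v \<in> AA s \<Longrightarrow> Gg2 (u + v) = Gg2 u + Gg2 v"
    "u \<in> AA s \<Longrightarrow> Gg2 u \<in> AA s"
  by (simp_all add: Gg2_def)

text \<open>Reversal of the legs turns the claim into the interchange law assumed for the mirrored
  map, and reversal is an involution.\<close>

lemma Gg2_t1:
  assumes "lAA \<phi>" "\<And>z. z \<in> AAA s \<Longrightarrow> LL (co \<phi>) (KK mir.Gg z) = KK mir.Gg (LL (co \<phi>) z)" "z \<in> AAA s"
  shows "LL Gg2 (KK \<phi> z) = KK \<phi> (LL Gg2 z)"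
proof -
  have 1: "flip3 (LL Gg2 z) = KK mir.Gg (flip3 z)" if "z \<in> AAA s" for z
    using that by (simp add: Gg2_def LL_co(1)[OF mir.Gg_lAA])
  have 2: "flip3 (KK \<phi> z) = LL (co \<phi>) (flip3 z)" if "z \<in> AAA s" for z
    using that assms(1) by (simp add: LL_co(1))
  have "flip3 (LL Gg2 (KK \<phi> z)) = flip3 (KK \<phi> (LL Gg2 z))"
    using assms by (simp add: 1 2)
  then have "flip3 (flip3 (LL Gg2 (KK \<phi> z))) = flip3 (flip3 (KK \<phi> (LL Gg2 z)))" by simp
  then show ?thesis using assms(1,3) by simp
qed

text \<open>\<open>Gg2\<close> affects the second factor only through left multiplications, and
  these commute with right multiplication by the barred multiplier of x, by \<open>t2_barR\<close>.
  This is what \<open>Gg_commute\<close> asks of \<Phi> = \<open>Gg2\<close>.\<close>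

lemma Gg2_barR: "Gg2 (a \<otimes> barR b x) = tmapA s (\<lambda>x. x) (\<lambda>q. barR q x) (Gg2 (a \<otimes> b))"
proof (rule A_induct[where a = a])
  fix c d
  have bar: "mir.barR (barR b x) z = barR (mir.barR b z) x" for z
    by (simp add: mir.barR_def t2_barR ei_tmapA)
  have 1: "tw s (mir.Ht (barR b x) t) = tmapA s (\<lambda>x. x) (\<lambda>q. barR q x) (tw s (mir.Ht b t))"
    if "t \<in> AA s" for t
    using that by (induct rule: AA_induct) (simp_all add: bar)
  show "Gg2 (m c d \<otimes> barR b x) = tmapA s (\<lambda>x. x) (\<lambda>q. barR q x) (Gg2 (m c d \<otimes> b))"
    by (simp add: Gg2_def mir.G0_mul 1)
next
  fix c d
  assume "Gg2 (c \<otimes> barR b x) = tmapA s (\<lambda>x. x) (\<lambda>q. barR q x) (Gg2 (c \<otimes> b))"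
    "Gg2 (d \<otimes> barR b x) = tmapA s (\<lambda>x. x) (\<lambda>q. barR q x) (Gg2 (d \<otimes> b))"
  then show "Gg2 ((c + d) \<otimes> barR b x) = tmapA s (\<lambda>x. x) (\<lambda>q. barR q x) (Gg2 ((c + d) \<otimes> b))"
    by (simp add: ten_simps)
qed

lemmas Gg2_Gg = Gg_commute[OF Gg2_simps(1) Gg2_barR]

lemma commute_KK:
  assumes r: "ginv t1 e1 Gg r" and \<Phi>: "lAA \<Phi>"
    and c: "\<And>z. z \<in> AAA s \<Longrightarrow> LL \<Phi> (KK t1 z) = KK t1 (LL \<Phi> z)"
      "\<And>z. z \<in> AAA s \<Longrightarrow> LL \<Phi> (KK e1 z) = KK e1 (LL \<Phi> z)"
      "\<And>z. z \<in> AAA s \<Longrightarrow> LL \<Phi> (KK Gg z) = KK Gg (LL \<Phi> z)"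
    and z: "z \<in> AAA s"
  shows "LL \<Phi> (KK r z) = KK r (LL \<Phi> z)"
proof -
  have R: "lAA r" "r (t1 u) = Gg u" "t1 (r u) = e1 u" "r (e1 u) = r u" if "u \<in> AA s" for u
    using r that by (auto simp: ginv_def)
  have r': "lAA r" using r by (simp add: ginv_def)
  show ?thesis
    by (rule commute_inverse[where V = "AAA s" and X = "LL \<Phi>" and R = "KK r" and T = "KK t1" and G = "KK Gg" and E = "KK e1"])
      (simp_all add: r' \<Phi> c z R KK_comp[where \<phi> = r and \<psi> = t1 and \<chi> = Gg]
        KK_comp[where \<phi> = t1 and \<psi> = r and \<chi> = e1] KK_comp[where \<phi> = r and \<psi> = e1 and \<chi> = r])
qed

end

lemma (in tens3) ginv_cong:
  assumes "ginv t e g r" "\<And>u. u \<in> AA s \<Longrightarrow> t u = t' u" "\<And>u. u \<in> AA s \<Longrightarrow> e u = e' u"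
    "\<And>u. u \<in> AA s \<Longrightarrow> g u = g' u"
  shows "ginv t' e' g' r"
proof -
  have "lAA r" and r: "r (t u) = g u \<and> t (r u) = e u \<and> r (t (r u)) = r u" if "u \<in> AA s" for u
    using assms(1) that by (auto simp: ginv_def)
  moreover have l: "lAA r" using assms(1) by (simp add: ginv_def)
  ultimately show ?thesis
    unfolding ginv_def using assms(2-4) lAAD(3)[OF l] by metis
qed

context wmb_maps
begin

interpretation mir: wmb_maps s \<epsilon> "\<lambda>x y. m y x" "co t2" "co t1" "co t4" "co t3" "co e2" "co e1"
    "\<lambda>a. co (d2 a)" "\<lambda>a. co (d1 a)"
  by (rule mirror)

abbreviation mu where "mu \<equiv> tlA s m"

lemmas mu_simps = bl_tlA[OF m_bl]

lemma t1_ei: "u \<in> AA s \<Longrightarrow> ei (t1 u) = mu u"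
  and t2_ie: "u \<in> AA s \<Longrightarrow> ie (t2 u) = mu u"
  by (induct rule: AA_induct, simp_all add: mu_simps counit1 counit2)+

lemma mu_B12_B23: "x \<in> AAA s \<Longrightarrow> mu (B12 m x) = mu (B23 m x)"
  by (induct rule: AAA_induct) (simp_all add: B12_simps[OF m_bl] B23_simps[OF m_bl] mu_simps m_assoc)

lemma ie_Gg2: "u \<in> AA s \<Longrightarrow> ie (Gg2 u) = tlA s (\<lambda>x y. ei (t4 (y \<otimes> x))) u"
proof -
  assume u: "u \<in> AA s"
  have "ie (Gg2 u) = tlA s mir.piR (tw s u)"
    using u mir.ei_Gg[of "tw s u"] by (simp add: Gg2_def)
  also have "\<dots> = tlA s (\<lambda>x y. ei (t4 (y \<otimes> x))) u"
    unfolding tlA_tw[OF mir.bl_piR u] by (simp add: mir.piR_def)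
  finally show ?thesis .
qed

lemma commute_LL:
  assumes r: "ginv t2 e2 Gg2 r" and \<phi>: "lAA \<phi>"
    and c: "\<And>z. z \<in> AAA s \<Longrightarrow> LL t2 (KK \<phi> z) = KK \<phi> (LL t2 z)"
      "\<And>z. z \<in> AAA s \<Longrightarrow> LL e2 (KK \<phi> z) = KK \<phi> (LL e2 z)"
      "\<And>z. z \<in> AAA s \<Longrightarrow> LL Gg2 (KK \<phi> z) = KK \<phi> (LL Gg2 z)"
    and z: "z \<in> AAA s"
  shows "LL r (KK \<phi> z) = KK \<phi> (LL r z)"
proof -
  have R: "lAA r" "r (t2 u) = Gg2 u" "t2 (r u) = e2 u" "r (e2 u) = r u" if "u \<in> AA s" for u
    using r that by (auto simp: ginv_def)
  have r': "lAA r" using r by (simp add: ginv_def)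
  have "KK \<phi> (LL r z) = LL r (KK \<phi> z)"
    by (rule commute_inverse[where V = "AAA s" and X = "KK \<phi>" and R = "LL r" and T = "LL t2" and G = "LL Gg2" and E = "LL e2"])
      (simp_all add: r' \<phi> c z R LL_comp[where \<phi> = r and \<psi> = t2 and \<chi> = Gg2]
        LL_comp[where \<phi> = t2 and \<psi> = r and \<chi> = e2] LL_comp[where \<phi> = r and \<psi> = e2 and \<chi> = r])
  then show ?thesis by simp
qed

section \<open>The multiplier S(a) obtained from generalised inverses\<close>

context
  fixes R1 assumes R1: "ginv t1 e1 Gg R1"
begin

lemma R1_simps:
  shows R1_lAA [simp]: "lAA R1"
    and "u \<in> AA s \<Longrightarrow> R1 (t1 u) = Gg u" "u \<in> AA s \<Longrightarrow> t1 (R1 u) = e1 u"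
    "u \<in> AA s \<Longrightarrow> R1 (e1 u) = R1 u" "u \<in> AA s \<Longrightarrow> Gg (R1 u) = R1 u"
proof -
  have R: "lAA R1" "\<And>u. u \<in> AA s \<Longrightarrow> R1 (t1 u) = Gg u" "\<And>u. u \<in> AA s \<Longrightarrow> t1 (R1 u) = e1 u"
    "\<And>u. u \<in> AA s \<Longrightarrow> R1 (e1 u) = R1 u"
    using R1 by (auto simp: ginv_def)
  then show "lAA R1" "u \<in> AA s \<Longrightarrow> R1 (t1 u) = Gg u" "u \<in> AA s \<Longrightarrow> t1 (R1 u) = e1 u"
    "u \<in> AA s \<Longrightarrow> R1 (e1 u) = R1 u" by auto
  show "Gg (R1 u) = R1 u" if u: "u \<in> AA s"
    using R(2)[of "R1 u"] R(3,4)[OF u] lAAD(3)[OF R(1) u] by simp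
qed

lemmas R1_maps [simp] = lAAD(1,3)[OF R1_lAA]

lemma t2_R1: "z \<in> AAA s \<Longrightarrow> LL t2 (KK R1 z) = KK R1 (LL t2 z)"
  and e2_R1: "z \<in> AAA s \<Longrightarrow> LL e2 (KK R1 z) = KK R1 (LL e2 z)"
  by (rule commute_KK[OF R1]; simp add: coassoc t2_e1 t2_Gg e2_t1 e2_e1 e2_Gg)+

lemma Gg2_R1: "z \<in> AAA s \<Longrightarrow> LL Gg2 (KK R1 z) = KK R1 (LL Gg2 z)"
  by (rule commute_KK[OF R1]; simp add: Gg2_Gg Gg2_t1 mir.t2_Gg mir.e2_Gg)

lemma bl_S1: "bl s (\<lambda>a b. ei (R1 (a \<otimes> b)))"
  by (rule blI) (simp_all add: ten_simps lAAD(2)[OF R1_lAA])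

abbreviation S1 where "S1 a b \<equiv> ei (R1 (a \<otimes> b))"

text \<open>The argument of the outer \<open>t1\<close> is the middle-leg slice of (id \<otimes>
  \<open>R1\<close>)(\<open>t2\<close> \<otimes> id). After the interchange the counit reduces it to
  (a \<otimes> 1) \<open>R1 (b \<otimes> c)\<close>; then \<open>t1\<close> after \<open>R1\<close>
  is E, and \<Delta>(a) E = \<Delta>(a).\<close>

lemma S_vii: "t1 (tmapA s (\<lambda>x. x) (\<lambda>y. S1 y c) (t2 (a \<otimes> b))) = d1 a (b \<otimes> c)"
proof -
  note [simp] = lA_bl[OF bl_S1]
  have 1: "tmapA s (\<lambda>x. x) (\<lambda>y. S1 y c) v = B23 (\<lambda>x y. s (\<epsilon> x) y) (KK R1 (v \<otimes>\<^sub>3 c))" if "v \<in> AA s" for v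
    using that by (induct rule: AA_induct) (simp_all add: B23_eps B23_simps[OF bl_eps(1)] ten3_simps)
  have 2: "B23 (\<lambda>x y. s (\<epsilon> x) y) (LL t2 (J a u)) = l1 a u" if "u \<in> AA s" for u
    using that by (induct rule: AA_induct) (simp_all add: B23_eps counit2 B23_simps[OF bl_eps(1)])
  have "tmapA s (\<lambda>x. x) (\<lambda>y. S1 y c) (t2 (a \<otimes> b)) = B23 (\<lambda>x y. s (\<epsilon> x) y) (KK R1 (LL t2 (a \<otimes> b \<otimes>\<^sub>3 c)))"
    by (simp add: 1)
  also have "\<dots> = l1 a (R1 (b \<otimes> c))"
    by (simp add: t2_R1[symmetric] 2 del: Rg_ten)
  finally show ?thesis by (simp add: d1_t1[symmetric] R1_simps d1_e1)
qed

text \<open>This is the slice of \<open>R\<^sub>1 E\<^sub>1 = R\<^sub>1\<close> by \<epsilon> on the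
  first leg.\<close>

lemma S_ix: "tlA s S1 (e1 (a \<otimes> b)) = S1 a b"
proof -
  have "tlA s S1 u = ei (R1 u)" if "u \<in> AA s" for u
    using that by (induct rule: AA_induct) (simp_all add: bl_tlA[OF bl_S1])
  then show ?thesis by (simp add: R1_simps)
qed

end

lemma R2_simps:
  assumes "ginv t2 e2 Gg2 R2"
  shows "lAA R2" "u \<in> AA s \<Longrightarrow> t2 (R2 u) = e2 u" "u \<in> AA s \<Longrightarrow> Gg2 (R2 u) = R2 u"
proof -
  have R: "lAA R2" "\<And>u. u \<in> AA s \<Longrightarrow> R2 (t2 u) = Gg2 u" "\<And>u. u \<in> AA s \<Longrightarrow> t2 (R2 u) = e2 u"
    "\<And>u. u \<in> AA s \<Longrightarrow> R2 (e2 u) = R2 u"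
    using assms by (auto simp: ginv_def)
  then show "lAA R2" "u \<in> AA s \<Longrightarrow> t2 (R2 u) = e2 u" by auto
  show "Gg2 (R2 u) = R2 u" if u: "u \<in> AA s"
    using R(2)[of "R2 u"] R(3,4)[OF u] lAAD(3)[OF R(1) u] by simp
qed

lemma R2_R1:
  assumes "ginv t1 e1 Gg R1" "ginv t2 e2 Gg2 R2" "z \<in> AAA s"
  shows "LL R2 (KK R1 z) = KK R1 (LL R2 z)"
  by (rule commute_LL[OF assms(2)])
    (simp_all add: R1_lAA[OF assms(1)] t2_R1[OF assms(1)] e2_R1[OF assms(1)] Gg2_R1[OF assms(1)] assms(3))

text \<open>The counit law gives \<mu> \<open>R2\<close> = (id \<otimes> \<epsilon>)
  \<open>t2\<close> \<open>R2\<close> = (id \<otimes> \<epsilon>) \<open>e2\<close>, which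
  \<open>piR_mult\<close> converts into \<open>piR\<close>. Summed over
  \<open>R1 (a \<otimes> b)\<close> this is (\<epsilon> \<otimes> id) \<open>Gg\<close>
  \<open>R1\<close>, and \<open>Gg\<close> fixes the values of \<open>R1\<close>. The other
  evaluation is the dual computation.\<close>

lemma S_link:
  assumes R1: "ginv t1 e1 Gg R1" and R2: "ginv t2 e2 Gg2 R2"
  shows "m c (ei (R1 (a \<otimes> b))) = m (ie (R2 (c \<otimes> a))) b"
proof -
  note [simp] = R1_lAA[OF R1] R1_maps[OF R1] R2_simps(1)[OF R2] lAAD(1,3)[OF R2_simps(1)[OF R2]]
  note R_simps = R1_simps[OF R1] R2_simps[OF R2]
  have 1: "mu (B12 m (LL R2 (J c u))) = m c (tlA s piR u)" if "u \<in> AA s" for u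
    using that
  proof (induct rule: AA_induct)
    case (ten x y)
    have "mu (R2 (c \<otimes> x)) = ie (e2 (c \<otimes> x))"
      by (simp add: t2_ie[symmetric] R_simps)
    moreover have "m (ie (e2 (c \<otimes> x))) y = m c (piR x y)" by (simp add: piR_mult piR_def)
    ultimately show ?case by (simp add: B12_simps[OF m_bl] mu_simps bl_tlA[OF bl_piR])
  qed (simp add: B12_simps[OF m_bl] mu_simps bl_tlA[OF bl_piR] mD)
  have b4: "bl s (\<lambda>x y. ei (t4 (y \<otimes> x)))"
    by (rule blI) (simp_all add: ten_simps lAAD)
  have 2: "mu (B23 m (KK R1 (u \<otimes>\<^sub>3 b))) = m (tlA s (\<lambda>x y. ei (t4 (y \<otimes> x))) u) b" if "u \<in> AA s" for u
    using that
  proof (induct rule: AA_induct)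
    case (ten x y)
    have "mu (R1 (y \<otimes> b)) = ei (e1 (y \<otimes> b))"
      by (simp add: t1_ei[symmetric] R_simps)
    then show ?case by (simp add: B23_simps[OF m_bl] mu_simps piL_mult bl_tlA[OF b4])
  qed (simp add: B23_simps[OF m_bl] mu_simps bl_tlA[OF b4] mD ten3_simps)
  have "m c (ei (R1 (a \<otimes> b))) = mu (B12 m (LL R2 (J c (R1 (a \<otimes> b)))))"
    using ei_Gg[of "R1 (a \<otimes> b)"] by (simp add: 1 R_simps)
  also have "\<dots> = mu (B12 m (LL R2 (KK R1 (c \<otimes> a \<otimes>\<^sub>3 b))))" by simp
  also have "\<dots> = mu (B23 m (KK R1 (LL R2 (c \<otimes> a \<otimes>\<^sub>3 b))))"
    by (simp add: R2_R1[OF R1 R2] mu_B12_B23 del: idLg_ten Rg_ten)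
  also have "\<dots> = m (ie (R2 (c \<otimes> a))) b"
    using ie_Gg2[of "R2 (c \<otimes> a)"] by (simp add: 2 R_simps)
  finally show ?thesis .
qed

end

context wmb_maps
begin

interpretation mir: wmb_maps s \<epsilon> "\<lambda>x y. m y x" "co t2" "co t1" "co t4" "co t3" "co e2" "co e1"
    "\<lambda>a. co (d2 a)" "\<lambda>a. co (d1 a)"
  by (rule mirror)

lemma Gg2_mul: "Gg2 (m a b \<otimes> c) = tlA s (\<lambda>x y. x \<otimes> ei (t2 (y \<otimes> c))) (tw s (t3 (b \<otimes> a)))"
proof -
  have bl: "bl tsc (\<lambda>x y. x \<otimes> ei (t2 (y \<otimes> c)))"
    by (rule blI) (simp_all add: ten_simps lAAD)
  have "tw s (mir.Ht c v) = tlA s (\<lambda>x y. x \<otimes> ei (t2 (y \<otimes> c))) v" if "v \<in> AA s" for v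
    using that by (rule AA_induct) (simp_all add: bl_tlA[OF bl] mir.barR_def)
  then show ?thesis by (simp add: Gg2_def mir.G0_mul)
qed

lemma R_mirror:
  assumes R2: "ginv t2 e2 Gg2 R2"
  shows "ginv (co t2) (co e2) mir.Gg (co R2)"
  by (rule ginv_cong[OF ginv_co[OF _ _ _ R2]]) (simp_all add: Gg2_def)

lemma S_ok_R:
  assumes R1: "ginv t1 e1 Gg R1" and R2: "ginv t2 e2 Gg2 R2"
  shows "S_ok (\<lambda>a b. ei (R1 (a \<otimes> b))) (\<lambda>a c. ie (R2 (c \<otimes> a)))"
proof -
  note [simp] = R2_simps(1)[OF R2] lAAD(1,3)[OF R2_simps(1)[OF R2]]
  have b: "bl s (\<lambda>a c. ie (R2 (c \<otimes> a)))"
    by (rule blI) (simp_all add: ten_simps lAAD(2)[OF R2_simps(1)[OF R2]])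
  note [simp] = lA_bl[OF b]
  \<comment> \<open>Condition (viii) is (vii) of the mirrored structure, with \<open>R2\<close>
    conjugated by the twist.\<close>
  have "t2 (tmapA s (\<lambda>x. ie (R2 (c \<otimes> x))) (\<lambda>x. x) (t1 (b \<otimes> a))) = d2 a (c \<otimes> b)" for a b c
  proof -
    have "tw s (co t2 (tmapA s (\<lambda>x. x) (\<lambda>y. ei (co R2 (y \<otimes> c))) (co t1 (a \<otimes> b)))) = tw s (co (d2 a) (b \<otimes> c))"
      using mir.S_vii[OF R_mirror[OF R2], of c a b] by simp
    then show ?thesis by (simp add: tmapA_tw)
  qed
  then show ?thesis unfolding S_ok_def
    using bl_S1[OF R1] b S_link[OF R1 R2] S_vii[OF R1] by simp
qed

lemma S_ok_mirror:
  assumes "S_ok \<sigma> \<rho>" shows "mir.S_ok \<rho> \<sigma>"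
proof -
  have "bl s \<sigma>" "bl s \<rho>" using assms by (auto simp: S_ok_def)
  note [simp] = lA_bl[OF this(1)] lA_bl[OF this(2)]
  show ?thesis using assms by (simp add: S_ok_def mir.S_ok_def tmapA_tw)
qed

lemma S_ok_ginv2:
  assumes "S_ok \<sigma> \<rho>" shows "\<exists>r. ginv t2 e2 Gg2 r"
proof -
  obtain r where r: "ginv (co t2) (co e2) mir.Gg r"
    using mir.S_ok_ginv[OF S_ok_mirror[OF assms]] by blast
  have "ginv t2 e2 Gg2 (co r)"
    by (rule ginv_cong[OF ginv_co[OF _ _ _ r]]) (simp_all add: Gg2_def)
  then show ?thesis by blast
qed

end

section \<open>The maps of a regular weak multiplier bialgebra\<close>

context nondeg_alg
begin

lemma mult_add_in:
  assumes "x \<in> M" "y \<in> M" shows "x + y \<in> M"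
proof -
  have "(fst x + fst y, snd x + snd y) \<in> M"
    by (rule multI) (use assms in \<open>auto simp: fun_apply mult_out mul_simps mult_link\<close>)
  then show ?thesis by (simp add: plus_prod_def)
qed

lemma mult_msc_in:
  assumes "x \<in> M" shows "msc sx c x \<in> M"
  unfolding msc_def
  by (rule multI) (use assms in \<open>auto simp: mult_out mul_simps mult_link\<close>)

end

section \<open>The algebras A, A \<otimes> A, A \<otimes> A \<otimes> A and their
  multipliers\<close>

locale tensor_alg = tens3 s for s :: "'k::field \<Rightarrow> 'a::ab_group_add \<Rightarrow> 'a" +
  fixes m assumes A: "nondeg_alg s UNIV m"
begin

sublocale A: nondeg_alg s UNIV m by (rule A)
sublocale A2: nondeg_alg_pair s UNIV m s UNIV m by unfold_locales

sublocale B: nondeg_alg tsc "AA s" "mulAA s m"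
  using A2.nondeg_alg_tensor by (simp add: AA_tsp mulAA_def)

sublocale B2: nondeg_alg_pair tsc "AA s" "mulAA s m" s UNIV m by unfold_locales

sublocale C: nondeg_alg tsc "AAA s" "mulAAA s m"
  using B2.nondeg_alg_tensor by (simp add: AAA_tsp mulAAA_def)

abbreviation mul2 (infixl "\<star>" 70) where "u \<star> v \<equiv> mulAA s m u v"
abbreviation mul3 (infixl "\<star>\<^sub>3" 70) where "x \<star>\<^sub>3 y \<equiv> mulAAA s m x y"

lemma MA_M: "MA s m = A.M" and MAA_M: "MAA s m = B.M" and MAAA_M: "MAAA s m = C.M"
  by (simp_all add: MA_def MAA_def MAAA_def)

lemma m_bl: "bl s m" using A.mul_bilin .

lemmas m_simps = blD[OF m_bl]

lemma lA_m [simp]: "lA (m c)" "lA (\<lambda>y. m y c)"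
  using lA_bl[OF m_bl] by auto

lemma m_zero [simp]: "m 0 x = 0" "m x 0 = 0"
  using lAD(3)[OF lA_m(1)] lAD(3)[OF lA_m(2)] by auto

lemma m_assoc: "m (m a b) c = m a (m b c)"
  using A.mul_assoc by simp

lemma mul2_ten [simp]: "(a \<otimes> b) \<star> (c \<otimes> d) = m a c \<otimes> m b d"
  using A2.tmul_tens[of a b c d] by (simp add: mulAA_def ten_def)

lemma mul2_add [simp]:
  "u \<in> AA s \<Longrightarrow> u' \<in> AA s \<Longrightarrow> v \<in> AA s \<Longrightarrow> (u + u') \<star> v = u \<star> v + u' \<star> v"
  "u \<in> AA s \<Longrightarrow> v \<in> AA s \<Longrightarrow> v' \<in> AA s \<Longrightarrow> u \<star> (v + v') = u \<star> v + u \<star> v'"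
  by (simp_all add: B.mul_simps)

lemma mul3_ten [simp]:
  "w \<in> AA s \<Longrightarrow> w' \<in> AA s \<Longrightarrow> (w \<otimes>\<^sub>3 c) \<star>\<^sub>3 (w' \<otimes>\<^sub>3 c') = (w \<star> w') \<otimes>\<^sub>3 m c c'"
  using B2.tmul_tens[of w c w' c'] by (simp add: mulAAA_def)

lemma mul3_add [simp]:
  "u \<in> AAA s \<Longrightarrow> u' \<in> AAA s \<Longrightarrow> v \<in> AAA s \<Longrightarrow> (u + u') \<star>\<^sub>3 v = u \<star>\<^sub>3 v + u' \<star>\<^sub>3 v"
  "u \<in> AAA s \<Longrightarrow> v \<in> AAA s \<Longrightarrow> v' \<in> AAA s \<Longrightarrow> u \<star>\<^sub>3 (v + v') = u \<star>\<^sub>3 v + u \<star>\<^sub>3 v'"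
  by (simp_all add: C.mul_simps)

lemma mul3_J_ten: "v \<in> AA s \<Longrightarrow> J a (x \<otimes> y) \<star>\<^sub>3 J b v = J (m a b) ((x \<otimes> y) \<star> v)"
proof (induct v rule: AA_induct)
  case (ten x' y')
  show ?case by simp
qed (simp del: J_ten)

lemma mul3_J [simp]:
  assumes "u \<in> AA s" "v \<in> AA s"
  shows "J a u \<star>\<^sub>3 J b v = J (m a b) (u \<star> v)"
  using assms(1)
  by (induct rule: AA_induct) (simp_all add: assms(2) mul3_J_ten del: J_ten)

abbreviation l1 where "l1 c \<equiv> tmapA s (m c) (\<lambda>x. x)"
abbreviation r2 where "r2 c \<equiv> tmapA s (\<lambda>x. x) (\<lambda>y. m y c)"
abbreviation l2 where "l2 c \<equiv> tmapA s (\<lambda>x. x) (m c)"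
abbreviation r1 where "r1 c \<equiv> tmapA s (\<lambda>y. m y c) (\<lambda>x. x)"

lemma tmapA_out: "u \<notin> AA s \<Longrightarrow> tmapA s \<phi> \<psi> u = 0"
  by (simp add: tmapA_def rst_def)

lemma tmapA_mult:
  assumes "(p, p') \<in> A.M" "(q, q') \<in> A.M"
  shows "(tmapA s p q, tmapA s p' q') \<in> B.M"
proof -
  note [simp] = A.mult_lin[OF assms(1), simplified] A.mult_lin[OF assms(2), simplified]
    A.mult_link[OF assms(1), simplified] A.mult_link[OF assms(2), simplified]
  have link: "(x \<otimes> y) \<star> tmapA s p q v = tmapA s p' q' (x \<otimes> y) \<star> v" if "v \<in> AA s" for x y v
    using that by (induct rule: AA_induct) simp_all
  show ?thesis
  proof (rule B.multI)
    show "u \<star> tmapA s p q v = tmapA s p' q' u \<star> v" if "u \<in> AA s" "v \<in> AA s" for u v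
      using that(1) by (induct rule: AA_induct) (use link that(2) in simp_all)
  qed (simp_all add: tmapA_out)
qed

lemma id_mult: "((\<lambda>x. x), (\<lambda>x. x)) \<in> A.M"
  and m_mult: "(m b, \<lambda>x. m x b) \<in> A.M"
  by (rule A.multI; simp add: m_assoc)+

text \<open>These pairs are the multipliers c \<otimes> 1 and 1 \<otimes> c, to which the general
  multiplier rules then apply.\<close>

lemma lr_mult: "(l1 c, r1 c) \<in> B.M" "(l2 c, r2 c) \<in> B.M"
  by (rule tmapA_mult; rule id_mult m_mult)+

lemma lr_mul2:
  assumes "u \<in> AA s" "v \<in> AA s"
  shows "l1 c u \<star> v = l1 c (u \<star> v)" "l2 c u \<star> v = l2 c (u \<star> v)"
    "u \<star> r1 c v = r1 c (u \<star> v)" "u \<star> r2 c v = r2 c (u \<star> v)"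
    "r1 c u \<star> v = u \<star> l1 c v" "r2 c u \<star> v = u \<star> l2 c v"
  using B.mult_mul_left[OF lr_mult(1)] B.mult_mul_left[OF lr_mult(2)]
    B.mult_mul_right[OF lr_mult(1)] B.mult_mul_right[OF lr_mult(2)]
    B.mult_link[OF lr_mult(1)] B.mult_link[OF lr_mult(2)] assms by auto

lemma lr_simps:
  assumes "v \<in> AA s"
  shows ten_mul2: "(p \<otimes> q) \<star> v = l1 p (l2 q v)"
    and mul2_ten': "v \<star> (p \<otimes> q) = r1 p (r2 q v)"
    and l1_l2: "l1 p (l2 q v) = l2 q (l1 p v)"
    and r1_r2: "r1 p (r2 q v) = r2 q (r1 p v)"
proof -
  show "(p \<otimes> q) \<star> v = l1 p (l2 q v)"
    using assms by (induct rule: AA_induct) simp_all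
  show "v \<star> (p \<otimes> q) = r1 p (r2 q v)"
    using assms by (induct rule: AA_induct) simp_all
  show "l1 p (l2 q v) = l2 q (l1 p v)"
    using assms by (induct rule: AA_induct) simp_all
  show "r1 p (r2 q v) = r2 q (r1 p v)"
    using assms by (induct rule: AA_induct) simp_all
qed

lemma lAA_mult: "x \<in> B.M \<Longrightarrow> lAA (fst x)" "x \<in> B.M \<Longrightarrow> lAA (snd x)"
  using B.mult_lin B.mult_in by (auto simp: lAA_def)

lemma lA_mult: "n \<in> A.M \<Longrightarrow> lA (fst n)" "n \<in> A.M \<Longrightarrow> lA (snd n)"
  using A.mult_lin by auto

lemma Rg_out: "z \<notin> AAA s \<Longrightarrow> Rg s \<phi> \<psi> z = 0"
  and idLg_out: "z \<notin> AAA s \<Longrightarrow> idLg s \<psi> \<phi> z = 0"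
  by (simp_all add: Rg_def idLg_def rst_def)

lemma Rg_mult:
  assumes "x \<in> B.M" "n \<in> A.M"
  shows "(Rg s (fst x) (fst n), Rg s (snd x) (snd n)) \<in> C.M"
proof -
  note [simp] = lAA_mult[OF assms(1)] lA_mult[OF assms(2)] B.mult_in[OF assms(1)]
  have link: "(w \<otimes>\<^sub>3 c) \<star>\<^sub>3 Rg s (fst x) (fst n) z = Rg s (snd x) (snd n) (w \<otimes>\<^sub>3 c) \<star>\<^sub>3 z"
    if "z \<in> AAA s" "w \<in> AA s" for w c z
    by (rule AAA_induct_3[where P = "\<lambda>z. (w \<otimes>\<^sub>3 c) \<star>\<^sub>3 Rg s (fst x) (fst n) z
        = Rg s (snd x) (snd n) (w \<otimes>\<^sub>3 c) \<star>\<^sub>3 z", OF that(1)])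
     (simp_all add: that(2) B.mult_link[OF assms(1)] A.mult_link[OF assms(2), simplified])
  show ?thesis
  proof (rule C.multI)
    show "y \<star>\<^sub>3 Rg s (fst x) (fst n) z = Rg s (snd x) (snd n) y \<star>\<^sub>3 z" if "y \<in> AAA s" "z \<in> AAA s" for y z
      by (rule AAA_induct_3[where P = "\<lambda>y. y \<star>\<^sub>3 Rg s (fst x) (fst n) z = Rg s (snd x) (snd n) y \<star>\<^sub>3 z", OF that(1)])
        (simp_all add: link that(2) del: Rg_ten)
  qed (simp_all add: Rg_out)
qed

lemma idLg_mult:
  assumes "x \<in> B.M" "n \<in> A.M"
  shows "(idLg s (fst n) (fst x), idLg s (snd n) (snd x)) \<in> C.M"
proof -
  note [simp] = lAA_mult[OF assms(1)] lA_mult[OF assms(2)] B.mult_in[OF assms(1)]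
  have link: "J a u \<star>\<^sub>3 idLg s (fst n) (fst x) z = idLg s (snd n) (snd x) (J a u) \<star>\<^sub>3 z"
    if "z \<in> AAA s" "u \<in> AA s" for a u z
    by (rule AAA_induct_J[where P = "\<lambda>z. J a u \<star>\<^sub>3 idLg s (fst n) (fst x) z
        = idLg s (snd n) (snd x) (J a u) \<star>\<^sub>3 z", OF that(1)])
     (simp_all add: that(2) B.mult_link[OF assms(1)] A.mult_link[OF assms(2), simplified])
  show ?thesis
  proof (rule C.multI)
    show "y \<star>\<^sub>3 idLg s (fst n) (fst x) z = idLg s (snd n) (snd x) y \<star>\<^sub>3 z" if "y \<in> AAA s" "z \<in> AAA s" for y z
      by (rule AAA_induct_J[where P = "\<lambda>y. y \<star>\<^sub>3 idLg s (fst n) (fst x) z = idLg s (snd n) (snd x) y \<star>\<^sub>3 z", OF that(1)])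
        (simp_all add: link that(2) del: idLg_J)
  qed (simp_all add: idLg_out)
qed

lemma LL_mult: "x \<in> B.M \<Longrightarrow> (LL (fst x), LL (snd x)) \<in> C.M"
  and KK_mult: "x \<in> B.M \<Longrightarrow> (KK (fst x), KK (snd x)) \<in> C.M"
  using Rg_mult[OF _ id_mult] idLg_mult[OF _ id_mult] by auto

text \<open>Each of \<open>T\<^sub>1, \<dots>, T\<^sub>4\<close> is of this form.\<close>

lemma tlA_inAA:
  assumes X: "\<And>a b. X a b \<in> embAA s m ` AA s"
    and lin: "\<And>a a' b v. v \<in> AA s \<Longrightarrow> fst (X (a + a') b) v = fst (X a b) v + fst (X a' b) v"
      "\<And>a b b' v. v \<in> AA s \<Longrightarrow> fst (X a (b + b')) v = fst (X a b) v + fst (X a b') v"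
      "\<And>a b c v. v \<in> AA s \<Longrightarrow> fst (X (s c a) b) v = tsc c (fst (X a b) v)"
      "\<And>a b c v. v \<in> AA s \<Longrightarrow> fst (X a (s c b)) v = tsc c (fst (X a b) v)"
  defines "T \<equiv> tlA s (\<lambda>a b. inAA s m (X a b))"
  shows "lAA T" "v \<in> AA s \<Longrightarrow> T (a \<otimes> b) \<star> v = fst (X a b) v" "v \<in> AA s \<Longrightarrow> v \<star> T (a \<otimes> b) = snd (X a b) v"
proof -
  have in1: "inAA s m (X a b) \<in> AA s \<and> embAA s m (inAA s m (X a b)) = X a b" for a b
  proof -
    obtain w where w: "w \<in> AA s" "X a b = embAA s m w" using X[of a b] by auto
    show ?thesis unfolding inAA_def
      by (rule theI2[where a = w]) (use w B.memb_inj in \<open>auto simp: embAA_def\<close>)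
  qed
  have f: "inAA s m (X a b) \<star> v = fst (X a b) v" if "v \<in> AA s" for a b v
  proof -
    have "fst (embAA s m (inAA s m (X a b))) v = inAA s m (X a b) \<star> v"
      using that by (simp add: embAA_def memb_def rst_def)
    then show ?thesis using in1[of a b] by simp
  qed
  have g: "v \<star> inAA s m (X a b) = snd (X a b) v" if "v \<in> AA s" for a b v
  proof -
    have "snd (embAA s m (inAA s m (X a b))) v = v \<star> inAA s m (X a b)"
      using that by (simp add: embAA_def memb_def rst_def)
    then show ?thesis using in1[of a b] by simp
  qed
  have bl: "bl tsc (\<lambda>a b. inAA s m (X a b))"
  proof (rule blI)
    note [simp] = in1 f
    show "inAA s m (X (a + a') b) = inAA s m (X a b) + inAA s m (X a' b)" for a a' b
      by (rule B.cancel_right) (simp_all add: lin)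
    show "inAA s m (X a (b + b')) = inAA s m (X a b) + inAA s m (X a b')" for a b b'
      by (rule B.cancel_right) (simp_all add: lin)
    show "inAA s m (X (s c a) b) = tsc c (inAA s m (X a b))" for c a b
      by (rule B.cancel_right) (simp_all add: lin B.mul_simps)
    show "inAA s m (X a (s c b)) = tsc c (inAA s m (X a b))" for c a b
      by (rule B.cancel_right) (simp_all add: lin B.mul_simps)
  qed
  show "lAA T" unfolding T_def by (rule lAA_tlA[OF bl]) (simp add: in1)
  show "v \<in> AA s \<Longrightarrow> T (a \<otimes> b) \<star> v = fst (X a b) v" "v \<in> AA s \<Longrightarrow> v \<star> T (a \<otimes> b) = snd (X a b) v"
    by (simp_all add: T_def tlA_ten[OF bl] f g)
qed

end

lemma wmbaD:
  assumes "wmba s m E \<Delta> \<epsilon>"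
  shows "vector_space s"
    "(\<forall>x y z. m (x + y) z = m x z + m y z \<and> m x (y + z) = m x y + m x z)"
    "(\<forall>c x y. m (s c x) y = s c (m x y) \<and> m x (s c y) = s c (m x y))"
    "(\<forall>x y z. m (m x y) z = m x (m y z))"
    "(\<forall>a. \<exists>u\<in>AA s. muA s m u = a)"
    "(\<forall>b. (\<forall>a. m a b = 0) \<longrightarrow> b = 0)"
    "(\<forall>b. (\<forall>a. m b a = 0) \<longrightarrow> b = 0)"
    "E \<in> MAA s m"
    "mmul E E = E"
    "(\<forall>a. \<Delta> a \<in> MAA s m)"
    "lin_on s (msc tsc) UNIV \<Delta>"
    "(\<forall>a b. \<Delta> (m a b) = mmul (\<Delta> a) (\<Delta> b))"
    "lfun s \<epsilon>"
    "(\<forall>a b. mmul (\<Delta> a) (mtA s oneA (embA m b)) \<in> embAA s m ` AA s)"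
    "(\<forall>a b. mmul (mtA s (embA m a) oneA) (\<Delta> b) \<in> embAA s m ` AA s)"
    "(\<forall>u\<in>AAA s. Rg s (T2 s m \<Delta>) id (idLg s id (T1 s m \<Delta>) u) = idLg s id (T1 s m \<Delta>) (Rg s (T2 s m \<Delta>) id u))"
    "(\<forall>u\<in>AA s. epsid s \<epsilon> (T1 s m \<Delta> u) = muA s m u \<and> ideps s \<epsilon> (T2 s m \<Delta> u) = muA s m u)"
    "lspan tsc {fst (\<Delta> a) (ten s b b') | a b b'. True} = lspan tsc {fst E (ten s b b') | b b'. True}"
    "lspan tsc {snd (\<Delta> a) (ten s b b') | a b b'. True} = lspan tsc {snd E (ten s b b') | b b'. True}"
    "mmul (Eone s E) (oneE s E) = mext s m (idtD s m \<Delta>) (oneE s E) E"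
    "mext s m (idtD s m \<Delta>) (oneE s E) E = mext s m (Dtid s m \<Delta>) (Eone s E) E"
    "mmul (oneE s E) (Eone s E) = mext s m (idtD s m \<Delta>) (oneE s E) E"
    "(\<forall>a b c. epsid s \<epsilon> (tmapA s id (m a) (fst E (ten s b c))) = epsid s \<epsilon> (fst (\<Delta> a) (ten s b c)))"
    "(\<forall>a b c. epsid s \<epsilon> (tmapA s id (\<lambda>y. m y c) (snd E (ten s a b))) = epsid s \<epsilon> (snd (\<Delta> c) (ten s a b)))"
  by (insert assms, unfold wmba_def, (elim conjE, assumption)+)

lemma tensor_alg_of_wmba:
  assumes "wmba s m E \<Delta> \<epsilon>" shows "tensor_alg s m"
proof -
  note w = wmbaD[OF assms]
  have V: "vector_space s" by (rule w(1))
  interpret tens3 s using V by (simp add: tens3_def)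
  have add: "m (x + y) z = m x z + m y z" "m x (y + z) = m x y + m x z" for x y z
    using w(2) by auto
  have sc: "m (s c x) y = s c (m x y)" "m x (s c y) = s c (m x y)" for c x y
    using w(3) by auto
  have as: "m (m x y) z = m x (m y z)" for x y z
    using w(4) by blast
  have id: "\<exists>u\<in>AA s. muA s m u = x" for x
    using w(5) by blast
  have bl: "bl s m" by (rule blI) (simp_all add: add sc)
  show ?thesis
  proof (unfold_locales, goal_cases)
    case 3 show ?case by (rule bl)
  next
    case (7 a)
    obtain u where u: "u \<in> AA s" "tlA s m u = a" using id[of a] by (auto simp: muA_def)
    from u(1) obtain xs where xs: "u = psum (tens s s) xs" by (auto simp: AA_def tsp_def)
    have "tlA s m u = psum m xs" unfolding tlA_def xs by (rule P.tl_psum[OF bl]) simp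
    then show ?case using u by auto
  next
    case (5 b) then show ?case using w(6) by blast
  next
    case (6 b) then show ?case using w(7) by blast
  qed (simp_all add: as)
qed

section \<open>The maps \<open>T\<^sub>i\<close> and the actions of E and \<Delta>(a)\<close>

locale reg_wmb =
  fixes s :: "'k::field \<Rightarrow> 'a::ab_group_add \<Rightarrow> 'a" and m E \<Delta> \<epsilon>
  assumes reg: "regular_wmba s m E \<Delta> \<epsilon>"
begin

lemma base: "wmba s m E \<Delta> \<epsilon>"
  using reg by (simp add: regular_wmba_def)

sublocale tensor_alg s m by (rule tensor_alg_of_wmba[OF base])
sublocale tens3_functional s \<epsilon>
  by unfold_locales (rule wmbaD(13)[OF base])

abbreviation e1 where "e1 \<equiv> fst E"
abbreviation e2 where "e2 \<equiv> snd E"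
abbreviation d1 where "d1 a \<equiv> fst (\<Delta> a)"
abbreviation d2 where "d2 a \<equiv> snd (\<Delta> a)"
abbreviation t1 where "t1 \<equiv> T1 s m \<Delta>"
abbreviation t2 where "t2 \<equiv> T2 s m \<Delta>"
abbreviation t3 where "t3 \<equiv> T3 s m \<Delta>"
abbreviation t4 where "t4 \<equiv> T4 s m \<Delta>"

lemma E_in: "E \<in> B.M" and D_in: "\<Delta> a \<in> B.M"
  using wmbaD(8,10)[OF base] by (simp_all add: MAA_M)

lemma mult_lAA [simp]: "lAA e1" "lAA e2" "lAA (d1 a)" "lAA (d2 a)"
  by (simp_all add: lAA_mult E_in D_in)

lemma D_lin: "\<Delta> (a + b) = \<Delta> a + \<Delta> b" "\<Delta> (s c a) = msc tsc c (\<Delta> a)"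
  using wmbaD(11)[OF base] by (simp_all add: lin_on_def)

lemma d_lin:
  "d1 (a + b) u = d1 a u + d1 b u" "d1 (s c a) u = tsc c (d1 a u)"
  "d2 (a + b) u = d2 a u + d2 b u" "d2 (s c a) u = tsc c (d2 a u)"
  by (simp_all add: D_lin fun_apply msc_def)

lemma d_mul: "d1 (m a b) u = d1 a (d1 b u)" "d2 (m a b) u = d2 b (d2 a u)"
  using wmbaD(12)[OF base] by (simp_all add: mmul_def)

lemma rst_UNIV [simp]: "rst UNIV f = f"
  by (simp add: rst_def)

lemma mtA_emb: "mtA s oneA (embA m b) = (l2 b, r2 b)" "mtA s (embA m a) oneA = (l1 a, r1 a)"
  by (simp_all add: mtA_def oneA_def embA_def munit_def memb_def id_def)

lemma t_lAA [simp]: "lAA t1" "lAA t2" "lAA t3" "lAA t4"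
  and t1_mul: "v \<in> AA s \<Longrightarrow> t1 (a \<otimes> b) \<star> v = d1 a (l2 b v)" "v \<in> AA s \<Longrightarrow> v \<star> t1 (a \<otimes> b) = r2 b (d2 a v)"
  and t2_mul: "v \<in> AA s \<Longrightarrow> t2 (a \<otimes> b) \<star> v = l1 a (d1 b v)" "v \<in> AA s \<Longrightarrow> v \<star> t2 (a \<otimes> b) = d2 b (r1 a v)"
  and t3_mul: "v \<in> AA s \<Longrightarrow> t3 (a \<otimes> b) \<star> v = l2 b (d1 a v)" "v \<in> AA s \<Longrightarrow> v \<star> t3 (a \<otimes> b) = d2 a (r2 b v)"
  and t4_mul: "v \<in> AA s \<Longrightarrow> t4 (a \<otimes> b) \<star> v = d1 b (l1 a v)" "v \<in> AA s \<Longrightarrow> v \<star> t4 (a \<otimes> b) = r1 a (d2 b v)"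
proof -
  have la: "l1 (a + a') v = l1 a v + l1 a' v" "l2 (a + a') v = l2 a v + l2 a' v"
      "l1 (s c a) v = tsc c (l1 a v)" "l2 (s c a) v = tsc c (l2 a v)" if "v \<in> AA s" for a a' c v
  proof -
    show "l1 (a + a') v = l1 a v + l1 a' v" using that
      by (rule AA_induct) (simp_all add: m_simps ten_simps add_ac lA_add)
    show "l2 (a + a') v = l2 a v + l2 a' v" using that
      by (rule AA_induct) (simp_all add: m_simps ten_simps add_ac lA_add)
    show "l1 (s c a) v = tsc c (l1 a v)" using that
      by (rule AA_induct) (simp_all add: m_simps ten_simps tsc_add lA_scale)
    show "l2 (s c a) v = tsc c (l2 a v)" using that
      by (rule AA_induct) (simp_all add: m_simps ten_simps tsc_add lA_scale)
  qed
  have sc: "l1 a (tsc c v) = tsc c (l1 a v)" "l2 a (tsc c v) = tsc c (l2 a v)" if "v \<in> AA s" for a c v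
    using lAAD(2)[OF lAA_tmapA] that by auto
  note inAA_simps = la sc d_lin lAAD[OF mult_lAA(3)] mmul_def mtA_emb
  have X: "mmul (\<Delta> a) (mtA s oneA (embA m b)) \<in> embAA s m ` AA s"
    "mmul (mtA s (embA m a) oneA) (\<Delta> b) \<in> embAA s m ` AA s"
    "mmul (mtA s oneA (embA m b)) (\<Delta> a) \<in> embAA s m ` AA s"
    "mmul (\<Delta> b) (mtA s (embA m a) oneA) \<in> embAA s m ` AA s" for a b
    using wmbaD(14,15)[OF base] reg by (simp_all add: regular_wmba_def)
  note 1 = tlA_inAA[where X = "\<lambda>a b. mmul (\<Delta> a) (mtA s oneA (embA m b))", folded T1_def, OF X(1)]
  note 2 = tlA_inAA[where X = "\<lambda>a b. mmul (mtA s (embA m a) oneA) (\<Delta> b)", folded T2_def, OF X(2)]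
  note 3 = tlA_inAA[where X = "\<lambda>a b. mmul (mtA s oneA (embA m b)) (\<Delta> a)", folded T3_def, OF X(3)]
  note 4 = tlA_inAA[where X = "\<lambda>a b. mmul (\<Delta> b) (mtA s (embA m a) oneA)", folded T4_def, OF X(4)]
  show "lAA t1" "v \<in> AA s \<Longrightarrow> t1 (a \<otimes> b) \<star> v = d1 a (l2 b v)" "v \<in> AA s \<Longrightarrow> v \<star> t1 (a \<otimes> b) = r2 b (d2 a v)"
    by (rule 1(1); simp add: inAA_simps) (subst 1(2) 1(3); simp add: inAA_simps)+
  show "lAA t2" "v \<in> AA s \<Longrightarrow> t2 (a \<otimes> b) \<star> v = l1 a (d1 b v)" "v \<in> AA s \<Longrightarrow> v \<star> t2 (a \<otimes> b) = d2 b (r1 a v)"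
    by (rule 2(1); simp add: inAA_simps) (subst 2(2) 2(3); simp add: inAA_simps)+
  show "lAA t3" "v \<in> AA s \<Longrightarrow> t3 (a \<otimes> b) \<star> v = l2 b (d1 a v)" "v \<in> AA s \<Longrightarrow> v \<star> t3 (a \<otimes> b) = d2 a (r2 b v)"
    by (rule 3(1); simp add: inAA_simps) (subst 3(2) 3(3); simp add: inAA_simps)+
  show "lAA t4" "v \<in> AA s \<Longrightarrow> t4 (a \<otimes> b) \<star> v = d1 b (l1 a v)" "v \<in> AA s \<Longrightarrow> v \<star> t4 (a \<otimes> b) = r1 a (d2 b v)"
    by (rule 4(1); simp add: inAA_simps) (subst 4(2) 4(3); simp add: inAA_simps)+
qed

lemmas maps [simp] = t_lAA[THEN lAAD(1)] t_lAA[THEN lAAD(3)] mult_lAA[THEN lAAD(1)] mult_lAA[THEN lAAD(3)]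

lemma E_mul: "u \<in> AA s \<Longrightarrow> v \<in> AA s \<Longrightarrow> e1 (u \<star> v) = e1 u \<star> v"
    "u \<in> AA s \<Longrightarrow> v \<in> AA s \<Longrightarrow> e2 (u \<star> v) = u \<star> e2 v"
    "u \<in> AA s \<Longrightarrow> v \<in> AA s \<Longrightarrow> u \<star> e1 v = e2 u \<star> v"
  using B.mult_mul_left[OF E_in] B.mult_mul_right[OF E_in] B.mult_link[OF E_in] by auto

lemma D_mul: "u \<in> AA s \<Longrightarrow> v \<in> AA s \<Longrightarrow> d1 a (u \<star> v) = d1 a u \<star> v"
    "u \<in> AA s \<Longrightarrow> v \<in> AA s \<Longrightarrow> d2 a (u \<star> v) = u \<star> d2 a v"
    "u \<in> AA s \<Longrightarrow> v \<in> AA s \<Longrightarrow> u \<star> d1 a v = d2 a u \<star> v"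
  using B.mult_mul_left[OF D_in] B.mult_mul_right[OF D_in] B.mult_link[OF D_in] by auto

lemma E_idem: "e1 (e1 u) = e1 u" "e2 (e2 u) = e2 u"
proof -
  have "mmul E E = E" by (rule wmbaD(9)[OF base])
  then have "fst E \<circ> fst E = fst E" "snd E \<circ> snd E = snd E"
    by (metis fst_conv mmul_def, metis snd_conv mmul_def)
  then show "e1 (e1 u) = e1 u" "e2 (e2 u) = e2 u" by (metis comp_apply)+
qed

lemma lspan_fixed:
  assumes "w \<in> lspan tsc X" "lAA \<phi>" "X \<subseteq> AA s" "\<And>x. x \<in> X \<Longrightarrow> \<phi> x = x"
  shows "\<phi> w = w \<and> w \<in> AA s"
proof -
  have "\<phi> (psum tsc xs) = psum tsc xs \<and> psum tsc xs \<in> AA s" if "set (map snd xs) \<subseteq> X" for xs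
    using that
  proof (induct xs)
    case (Cons p xs)
    then have "snd p \<in> X" "snd p \<in> AA s" using assms(3) by auto
    then show ?case using Cons by (simp add: lAAD[OF assms(2)] assms(4))
  qed (simp add: lAAD[OF assms(2)])
  then show ?thesis using assms(1) by (auto simp: lspan_def)
qed

lemma lspan_psum:
  assumes "w \<in> lspan tsc {d a (ten s b b') | a b b'. True}" "\<And>a. lAA (d a)"
  shows "\<exists>xs. set xs \<subseteq> UNIV \<times> AA s \<and> w = psum d xs"
proof -
  have "\<exists>ys. set ys \<subseteq> UNIV \<times> AA s \<and> psum tsc xs = psum d ys"
    if "set (map snd xs) \<subseteq> {d a (ten s b b') | a b b'. True}" for xs
    using that
  proof (induct xs)
    case Nil
    show ?case by (rule exI[of _ "[]"]) simp
  next
    case (Cons p xs)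
    then obtain ys where ys: "set ys \<subseteq> UNIV \<times> AA s" "psum tsc xs = psum d ys" by auto
    from Cons.prems obtain a b b' where "snd p = d a (b \<otimes> b')" by auto
    then show ?case using ys
      by (intro exI[of _ "(a, tsc (fst p) (b \<otimes> b')) # ys"]) (simp add: lAAD(2)[OF assms(2)])
  qed
  then show ?thesis using assms(1) by (auto simp: lspan_def)
qed

lemma lspan_in: "x \<in> X \<Longrightarrow> x \<in> lspan tsc X"
proof -
  assume "x \<in> X"
  moreover have "tsc 1 x = x" by (simp add: tsc_def)
  ultimately show ?thesis unfolding lspan_def
    by (intro CollectI exI[of _ "[(1, x)]"]) simp
qed

lemma spans: "lspan tsc {d1 a (ten s b b') | a b b'. True} = lspan tsc {e1 (ten s b b') | b b'. True}"
    "lspan tsc {d2 a (ten s b b') | a b b'. True} = lspan tsc {e2 (ten s b b') | b b'. True}"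
  by (rule wmbaD(18,19)[OF base])+

text \<open>By (iv) the range of \<Delta>(a) lies in the span of the range of E, on which the
  idempotent E acts as the identity.\<close>

lemma e_d: "u \<in> AA s \<Longrightarrow> e1 (d1 a u) = d1 a u" "u \<in> AA s \<Longrightarrow> e2 (d2 a u) = d2 a u"
proof -
  have 1: "e1 (d1 a (b \<otimes> c)) = d1 a (b \<otimes> c)" "e2 (d2 a (b \<otimes> c)) = d2 a (b \<otimes> c)" for b c
  proof -
    have "d1 a (b \<otimes> c) \<in> lspan tsc {e1 (ten s b b') | b b'. True}"
      unfolding spans[symmetric] by (rule lspan_in) blast
    then show "e1 (d1 a (b \<otimes> c)) = d1 a (b \<otimes> c)"
      by (rule lspan_fixed[THEN conjunct1]) (auto simp: E_idem)
    have "d2 a (b \<otimes> c) \<in> lspan tsc {e2 (ten s b b') | b b'. True}"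
      unfolding spans[symmetric] by (rule lspan_in) blast
    then show "e2 (d2 a (b \<otimes> c)) = d2 a (b \<otimes> c)"
      by (rule lspan_fixed[THEN conjunct1]) (auto simp: E_idem)
  qed
  show "u \<in> AA s \<Longrightarrow> e1 (d1 a u) = d1 a u"
    by (erule AA_induct) (simp_all add: 1)
  show "u \<in> AA s \<Longrightarrow> e2 (d2 a u) = d2 a u"
    by (erule AA_induct) (simp_all add: 1)
qed

text \<open>Here E stands on the inner side, about which (iv) says nothing directly. Pairing with a
  test element v transfers the action to v, where the opposite half of \<open>e_d\<close> absorbs
  E.\<close>

lemma d_e: "u \<in> AA s \<Longrightarrow> d1 a (e1 u) = d1 a u" "u \<in> AA s \<Longrightarrow> d2 a (e2 u) = d2 a u"
proof -
  show "d1 a (e1 u) = d1 a u" if "u \<in> AA s"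
    by (rule B.cancel_left) (use that in \<open>simp_all add: D_mul E_mul e_d\<close>)
  show "d2 a (e2 u) = d2 a u" if "u \<in> AA s"
    by (rule B.cancel_right) (use that in \<open>simp_all add: D_mul(3)[symmetric] E_mul(3)[symmetric] e_d\<close>)
qed

lemma span_e1: "u \<in> AA s \<Longrightarrow> \<exists>xs. set xs \<subseteq> UNIV \<times> AA s \<and> e1 u = psum d1 xs"
  and span_e2: "u \<in> AA s \<Longrightarrow> \<exists>xs. set xs \<subseteq> UNIV \<times> AA s \<and> e2 u = psum d2 xs"
proof -
  show "\<exists>xs. set xs \<subseteq> UNIV \<times> AA s \<and> e1 u = psum d1 xs" if "u \<in> AA s"
    using that
  proof (induct rule: AA_induct)
    case (ten x y)
    show ?case by (rule lspan_psum, unfold spans, rule lspan_in, blast, simp)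
  next
    case (add u v)
    then obtain xs ys where "set xs \<subseteq> UNIV \<times> AA s" "e1 u = psum d1 xs" "set ys \<subseteq> UNIV \<times> AA s" "e1 v = psum d1 ys"
      by blast
    with add show ?case by (intro exI[of _ "xs @ ys"]) simp
  qed
  show "\<exists>xs. set xs \<subseteq> UNIV \<times> AA s \<and> e2 u = psum d2 xs" if "u \<in> AA s"
    using that
  proof (induct rule: AA_induct)
    case (ten x y)
    show ?case by (rule lspan_psum, unfold spans, rule lspan_in, blast, simp)
  next
    case (add u v)
    then obtain xs ys where "set xs \<subseteq> UNIV \<times> AA s" "e2 u = psum d2 xs" "set ys \<subseteq> UNIV \<times> AA s" "e2 v = psum d2 ys"
      by blast
    with add show ?case by (intro exI[of _ "xs @ ys"]) simp
  qed
qed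

text \<open>Each identity expands one product of \<Delta> with two one-leg multipliers in two
  ways.\<close>

lemma t_rel:
  shows t12: "l1 c (t1 (a \<otimes> b)) = r2 b (t2 (c \<otimes> a))"
    and t23: "l2 c (t2 (a \<otimes> b)) = l1 a (t3 (b \<otimes> c))"
    and t34: "r1 b (t3 (a \<otimes> c)) = l2 c (t4 (b \<otimes> a))"
    and t24: "r1 b (t2 (c \<otimes> a)) = l1 c (t4 (b \<otimes> a))"
    and t13: "r2 c (t3 (a \<otimes> b)) = l2 b (t1 (a \<otimes> c))"
  by (rule B.cancel_right;
      simp add: lr_mul2 t1_mul t2_mul t3_mul t4_mul l1_l2)+

lemma d1_ten: "d1 q (p \<otimes> a) = r2 a (t4 (p \<otimes> q))"
  by (rule B.cancel_right) (simp_all add: lr_mul2 t4_mul D_mul(1)[symmetric] ten_mul2)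

lemma d2_ten: "d2 q (a \<otimes> p) = l1 a (t3 (q \<otimes> p))"
  by (rule B.cancel_left) (simp_all add: lr_mul2(5)[symmetric] t3_mul D_mul(2)[symmetric] mul2_ten' r1_r2)

lemma d1_t1: "u \<in> AA s \<Longrightarrow> d1 c (t1 u) = t1 (l1 c u)"
proof (induct u rule: AA_induct)
  case (ten a b)
  show ?case
    by (rule B.cancel_right) (simp_all add: D_mul(1)[symmetric] t1_mul d_mul)
qed simp

lemma d2_t2: "u \<in> AA s \<Longrightarrow> d2 c (t2 u) = t2 (r2 c u)"
proof (induct u rule: AA_induct)
  case (ten a b)
  show ?case
    by (rule B.cancel_left) (simp_all add: D_mul(2)[symmetric] t2_mul d_mul)
qed simp

lemma e_t:
  "u \<in> AA s \<Longrightarrow> e1 (t1 u) = t1 u" "u \<in> AA s \<Longrightarrow> e1 (t4 u) = t4 u"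
  "u \<in> AA s \<Longrightarrow> e2 (t2 u) = t2 u" "u \<in> AA s \<Longrightarrow> e2 (t3 u) = t3 u"
proof -
  have 1: "e1 (t1 (a \<otimes> b)) = t1 (a \<otimes> b)" "e1 (t4 (a \<otimes> b)) = t4 (a \<otimes> b)" for a b
    by (rule B.cancel_right; simp add: E_mul(1)[symmetric] t1_mul t4_mul e_d)+
  have 2: "e2 (t2 (a \<otimes> b)) = t2 (a \<otimes> b)" "e2 (t3 (a \<otimes> b)) = t3 (a \<otimes> b)" for a b
    by (rule B.cancel_left; simp add: E_mul(2)[symmetric] t2_mul t3_mul e_d)+
  show "u \<in> AA s \<Longrightarrow> e1 (t1 u) = t1 u" by (erule AA_induct) (simp_all add: 1)
  show "u \<in> AA s \<Longrightarrow> e1 (t4 u) = t4 u" by (erule AA_induct) (simp_all add: 1)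
  show "u \<in> AA s \<Longrightarrow> e2 (t2 u) = t2 u" by (erule AA_induct) (simp_all add: 2)
  show "u \<in> AA s \<Longrightarrow> e2 (t3 u) = t3 u" by (erule AA_induct) (simp_all add: 2)
qed

lemma counit1: "ei (t1 (a \<otimes> b)) = m a b" and counit2: "ie (t2 (a \<otimes> b)) = m a b"
proof -
  note wmbaD(17)[OF base]
  then show "ei (t1 (a \<otimes> b)) = m a b" "ie (t2 (a \<otimes> b)) = m a b"
    by (simp_all add: muA_def tlA_ten[OF m_bl])
qed

lemma m_cancel: "(\<And>c. m a c = m b c) \<Longrightarrow> a = b" "(\<And>c. m c a = m c b) \<Longrightarrow> a = b"
  by (rule A.cancel_right; simp) (rule A.cancel_left; simp)

text \<open>Axiom (iii) concerns \<open>t1\<close> and \<open>t2\<close>. After multiplication by c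
  on the other side, \<open>t13\<close> replaces \<open>t3\<close> by \<open>t1\<close>; the next
  lemma treats \<open>t4\<close> through \<open>t24\<close> in the same way.\<close>

lemma counit3: "ei (t3 (b \<otimes> a)) = m a b"
proof (rule m_cancel(1))
  fix c
  have "m (ei (t3 (b \<otimes> a))) c = ei (r2 c (t3 (b \<otimes> a)))" by (simp add: ei_tmapA)
  also have "\<dots> = m (m a b) c" by (simp add: t13 ei_tmapA counit1 m_assoc)
  finally show "m (ei (t3 (b \<otimes> a))) c = m (m a b) c" .
qed

lemma counit4: "ie (t4 (b \<otimes> a)) = m a b"
proof (rule m_cancel(2))
  fix c
  have "m c (ie (t4 (b \<otimes> a))) = ie (l1 c (t4 (b \<otimes> a)))" by (simp add: ie_tmapA)
  also have "\<dots> = m c (m a b)" by (simp add: t24[symmetric] ie_tmapA counit2 m_assoc)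
  finally show "m c (ie (t4 (b \<otimes> a))) = m c (m a b)" .
qed

lemma weak: "ei (l2 a (e1 (b \<otimes> c))) = ei (d1 a (b \<otimes> c))" "ei (r2 c (e2 (a \<otimes> b))) = ei (d2 c (a \<otimes> b))"
  using wmbaD(23,24)[OF base] by (simp_all add: id_def)

lemma piL_mult: "m y (ei (e1 (x \<otimes> c))) = m (ei (t4 (x \<otimes> y))) c"
  using weak(1)[of y x c] by (simp add: ei_tmapA d1_ten)

lemma barL_mult: "m y (ei (t2 (x \<otimes> b))) = m (ei (e2 (x \<otimes> y))) b"
  using weak(2)[of b x y] by (simp add: ei_tmapA d2_ten t23[symmetric])

lemma weak_t4: "ei (t4 (x \<otimes> m a b)) = ei (r1 x (t3 (b \<otimes> a)))"
  by (rule m_cancel(1)) (simp add: piL_mult[symmetric] t34 ei_tmapA m_assoc)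

end

lemma fst_snd_mmul: "fst (mmul x y) z = fst x (fst y z)" "snd (mmul x y) z = snd y (snd x z)"
  by (simp_all add: mmul_def)

lemma fst_msc: "fst (msc sc c x) z = sc c (fst x z)"
  by (simp add: msc_def)

context reg_wmb
begin

section \<open>The extensions of \<Delta> \<otimes> id and id \<otimes> \<Delta> at E\<close>

lemma E12_in: "(LL e1, LL e2) \<in> C.M" and E23_in: "(KK e1, KK e2) \<in> C.M"
  by (rule LL_mult[OF E_in] KK_mult[OF E_in])+

lemma Eone_eq: "Eone s E = (LL e1, LL e2)" and oneE_eq: "oneE s E = (KK e1, KK e2)"
  by (simp_all add: Eone_def oneE_def id_def)

definition D12 where "D12 a b = (Rg s (d1 a) (m b), Rg s (d2 a) (\<lambda>c. m c b))"
definition D23 where "D23 a b = (idLg s (m a) (d1 b), idLg s (\<lambda>x. m x a) (d2 b))"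

lemma D12_in: "D12 a b \<in> C.M" and D23_in: "D23 a b \<in> C.M"
  using Rg_mult[OF D_in m_mult] idLg_mult[OF D_in m_mult] by (simp_all add: D12_def D23_def)

lemma fst_add_C:
  assumes "x \<in> C.M" "u \<in> AAA s" "v \<in> AAA s"
  shows "fst x (u + v) = fst x u + fst x v" "snd x (u + v) = snd x u + snd x v"
  using lin_on_add[OF C.mult_lin(1)[OF assms(1)]] lin_on_add[OF C.mult_lin(2)[OF assms(1)]] assms by auto

lemma C_eqI:
  assumes "x \<in> C.M" "y \<in> C.M" "\<And>w c. w \<in> AA s \<Longrightarrow> fst x (w \<otimes>\<^sub>3 c) = fst y (w \<otimes>\<^sub>3 c)"
  shows "x = y"
proof (rule C.mult_eqI[OF assms(1,2)])
  fix z assume z: "z \<in> AAA s"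
  show "fst x z = fst y z"
    by (rule AAA_induct_3[where P = "\<lambda>z. fst x z = fst y z", OF z]) (simp_all add: assms fst_add_C)
qed

lemma C_eqI_J:
  assumes "x \<in> C.M" "y \<in> C.M" "\<And>a u. u \<in> AA s \<Longrightarrow> fst x (J a u) = fst y (J a u)"
  shows "x = y"
proof (rule C.mult_eqI[OF assms(1,2)])
  fix z assume z: "z \<in> AAA s"
  show "fst x z = fst y z"
    by (rule AAA_induct_J[where P = "\<lambda>z. fst x z = fst y z", OF z]) (simp_all add: assms fst_add_C)
qed

lemma D12_fst: "w \<in> AA s \<Longrightarrow> fst (D12 a b) (w \<otimes>\<^sub>3 c) = d1 a w \<otimes>\<^sub>3 m b c"
  and D12_snd: "w \<in> AA s \<Longrightarrow> snd (D12 a b) (w \<otimes>\<^sub>3 c) = d2 a w \<otimes>\<^sub>3 m c b"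
  and D23_fst: "u \<in> AA s \<Longrightarrow> fst (D23 a b) (J c u) = J (m a c) (d1 b u)"
  and D23_snd: "u \<in> AA s \<Longrightarrow> snd (D23 a b) (J c u) = J (m c a) (d2 b u)"
  by (simp_all add: D12_def D23_def)

lemmas D_AAA = D12_fst D12_snd D23_fst D23_snd fst_add_C[OF D12_in] fst_add_C[OF D23_in]
  C.mult_in[OF D12_in] C.mult_in[OF D23_in]

lemma bl_D12: "bl (msc tsc) D12"
proof (rule blI)
  note s = D_AAA fst_msc fun_apply m_simps d_lin ten3_simps tsc_add add_ac
  show "D12 (x + x') y = D12 x y + D12 x' y" for x x' y
    by (rule C_eqI) (simp_all add: s D12_in C.mult_add_in)
  show "D12 x (y + y') = D12 x y + D12 x y'" for x y y'
    by (rule C_eqI) (simp_all add: s D12_in C.mult_add_in)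
  show "D12 (s c x) y = msc tsc c (D12 x y)" for c x y
    by (rule C_eqI) (simp_all add: s D12_in C.mult_msc_in)
  show "D12 x (s c y) = msc tsc c (D12 x y)" for c x y
    by (rule C_eqI) (simp_all add: s D12_in C.mult_msc_in)
qed

lemma bl_D23: "bl (msc tsc) D23"
proof (rule blI)
  note s = D_AAA fst_msc fun_apply m_simps d_lin J_add_left J_scale_left J_scale tsc_add add_ac
  show "D23 (x + x') y = D23 x y + D23 x' y" for x x' y
    by (rule C_eqI_J) (simp_all add: s D23_in C.mult_add_in)
  show "D23 x (y + y') = D23 x y + D23 x y'" for x y y'
    by (rule C_eqI_J) (simp_all add: s D23_in C.mult_add_in)
  show "D23 (s c x) y = msc tsc c (D23 x y)" for c x y
    by (rule C_eqI_J) (simp_all add: s D23_in C.mult_msc_in)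
  show "D23 x (s c y) = msc tsc c (D23 x y)" for c x y
    by (rule C_eqI_J) (simp_all add: s D23_in C.mult_msc_in)
qed

lemma A_induct:
  assumes "\<And>b c. P (m b c)" "\<And>x y. P x \<Longrightarrow> P y \<Longrightarrow> P (x + y)"
  shows "P a"
proof -
  obtain xs where xs: "a = psum m xs" using A.idem[of a] by auto
  have "P (psum m ys)" for ys
    by (induct ys) (use assms(1)[of 0 0] in \<open>auto simp: assms\<close>)
  then show ?thesis using xs by simp
qed

lemma mmul_add:
  assumes "x \<in> C.M" "y \<in> C.M" "y' \<in> C.M"
  shows "mmul x (y + y') = mmul x y + mmul x y'" "mmul (y + y') x = mmul y x + mmul y' x"
  by (rule C.mult_eqI; simp add: assms C.mult_add_in fst_snd_mmul fst_add_C fun_apply)+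

text \<open>Both extensions in (v) are instances of the following: \<open>D\<close> is \<open>\<Delta> \<otimes> id\<close> or
  \<open>id \<otimes> \<Delta>\<close> on simple tensors, and \<open>P\<close> is \<open>E \<otimes> 1\<close> or \<open>1 \<otimes> E\<close>.\<close>

lemma mext_tlA:
  fixes D P
  defines "DD \<equiv> tlA s D"
  assumes D: "\<And>a b. D a b \<in> C.M" "bl (msc tsc) D" "\<And>a b c d. D (m a c) (m b d) = mmul (D a b) (D c d)"
    and P: "P \<in> C.M" "mmul P P = P" "\<And>a b. mmul P (D a b) = D a b" "\<And>a b. mmul (D a b) P = D a b"
    and span: "\<And>z. z \<in> AAA s \<Longrightarrow> \<exists>xs. set xs \<subseteq> AA s \<times> AAA s \<and> fst P z = psum (\<lambda>u. fst (DD u)) xs"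
      "\<And>z. z \<in> AAA s \<Longrightarrow> \<exists>xs. set xs \<subseteq> AA s \<times> AAA s \<and> snd P z = psum (\<lambda>u. snd (DD u)) xs"
    and u: "u \<in> AA s"
  shows "mmul (mext s m DD P E) (DD u) = DD (e1 u)" "mmul (DD u) (mext s m DD P E) = DD (e2 u)"
    "mmul P (DD u) = DD u" "mmul (DD u) P = DD u"
proof -
  have DD: "DD (a \<otimes> b) = D a b" "u \<in> AA s \<Longrightarrow> v \<in> AA s \<Longrightarrow> DD (u + v) = DD u + DD v"
    "u \<in> AA s \<Longrightarrow> DD u \<in> C.M" for a b u v
    unfolding DD_def by (simp_all add: bl_tlA[OF D(2)] tlA_in[OF D(2)] D(1) C.mult_add_in)
  have mul0: "DD ((a \<otimes> b) \<star> v) = mmul (D a b) (DD v)" if "v \<in> AA s" for a b v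
    using that by (rule AA_induct) (simp_all add: DD D(1,3) mmul_add)
  have mul: "DD (u \<star> v) = mmul (DD u) (DD v)" if u: "u \<in> AA s" and v: "v \<in> AA s" for u v
    using u by (rule AA_induct) (simp_all add: DD v mul0 mmul_add)
  have PD: "mmul P (DD u) = DD u" if "u \<in> AA s" for u
    using that by (rule AA_induct) (simp_all add: DD P mmul_add)
  have DP: "mmul (DD u) P = DD u" if "u \<in> AA s" for u
    using that by (rule AA_induct) (simp_all add: DD P mmul_add)
  have "\<exists>!y. y \<in> C.M \<and> (\<forall>u\<in>AA s. mmul y (DD u) = DD (e1 u) \<and> mmul (DD u) y = DD (e2 u))
      \<and> mmul y P = y \<and> mmul P y = y"
    by (rule C.multiplier_extension[OF B.nondeg_alg_axioms E_in]) (simp_all add: DD P PD DP mul span)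
  from theI'[OF this] show "mmul (mext s m DD P E) (DD u) = DD (e1 u)" "mmul (DD u) (mext s m DD P E) = DD (e2 u)"
    using u unfolding mext_def MAAA_M by auto
  show "mmul P (DD u) = DD u" "mmul (DD u) P = DD u" by (rule PD[OF u] DP[OF u])+
qed

abbreviation Dl where "Dl \<equiv> Dtid s m \<Delta>"
abbreviation Dr where "Dr \<equiv> idtD s m \<Delta>"

lemma Dl_eq: "Dl = tlA s D12" and Dr_eq: "Dr = tlA s D23"
  by (simp_all add: Dtid_def D12_def[abs_def] idtD_def D23_def[abs_def])

lemma Dl_simps [simp]:
  "Dl (a \<otimes> b) = D12 a b" "u \<in> AA s \<Longrightarrow> v \<in> AA s \<Longrightarrow> Dl (u + v) = Dl u + Dl v"
  "u \<in> AA s \<Longrightarrow> Dl u \<in> C.M"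
  by (simp_all add: Dl_eq bl_tlA[OF bl_D12] tlA_in[OF bl_D12] D12_in C.mult_add_in)

lemma Dr_simps [simp]:
  "Dr (a \<otimes> b) = D23 a b" "u \<in> AA s \<Longrightarrow> v \<in> AA s \<Longrightarrow> Dr (u + v) = Dr u + Dr v"
  "u \<in> AA s \<Longrightarrow> Dr u \<in> C.M"
  by (simp_all add: Dr_eq bl_tlA[OF bl_D23] tlA_in[OF bl_D23] D23_in C.mult_add_in)

text \<open>Membership in a span, in the list form in which \<open>multiplier_extension\<close> asks
  for it; F is one component of the map to be extended.\<close>

definition decomp where
  "decomp F v \<longleftrightarrow> (\<exists>xs. set xs \<subseteq> AA s \<times> AAA s \<and> v = psum F xs)"

lemma decomp_add: "decomp F v \<Longrightarrow> decomp F w \<Longrightarrow> decomp F (v + w)"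
  unfolding decomp_def by (metis le_sup_iff psum_append set_append)

lemma decomp_single: "u \<in> AA s \<Longrightarrow> z \<in> AAA s \<Longrightarrow> decomp F (F u z)"
  unfolding decomp_def by (rule exI[of _ "[(u, z)]"]) simp

text \<open>Here \<open>\<tau> w c\<close> stands for \<open>w \<otimes> c\<close> or \<open>c \<otimes> w\<close>, and \<open>n\<close> for the multiplication
  or its opposite.\<close>

lemma decomp_lift:
  assumes d: "\<exists>xs. set xs \<subseteq> UNIV \<times> AA s \<and> e = psum d xs" and l: "\<And>a. lAA (d a)"
    and \<tau>: "\<And>w w' c. w \<in> AA s \<Longrightarrow> w' \<in> AA s \<Longrightarrow> \<tau> (w + w') c = \<tau> w c + \<tau> w' c"
      "\<And>w c c'. w \<in> AA s \<Longrightarrow> \<tau> w (c + c') = \<tau> w c + \<tau> w c'" "\<And>w c. w \<in> AA s \<Longrightarrow> \<tau> w c \<in> AAA s" "\<And>c. \<tau> 0 c = 0"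
    and \<pi>: "\<And>a b. \<pi> a b \<in> AA s"
    and D: "\<And>a b c w. w \<in> AA s \<Longrightarrow> F (\<pi> a b) (\<tau> w c) = \<tau> (d a w) (n b c)"
    and n: "n = m \<or> n = (\<lambda>x y. m y x)"
  shows "decomp F (\<tau> e c)"
proof -
  obtain ys where ys: "set ys \<subseteq> UNIV \<times> AA s" "e = psum d ys" using d by blast
  have 1: "set us \<subseteq> UNIV \<times> AA s \<longrightarrow> decomp F (\<tau> (psum d us) (n b c)) \<and> psum d us \<in> AA s" for b c us
  proof (rule list.induct[where P = "\<lambda>us. set us \<subseteq> UNIV \<times> AA s \<longrightarrow>
      decomp F (\<tau> (psum d us) (n b c)) \<and> psum d us \<in> AA s"])
    show "set [] \<subseteq> UNIV \<times> AA s \<longrightarrow> decomp F (\<tau> (psum d []) (n b c)) \<and> psum d [] \<in> AA s"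
      unfolding decomp_def by (auto simp: \<tau>(4) intro: exI[of _ "[]"])
    show "set (p # us) \<subseteq> UNIV \<times> AA s \<longrightarrow> decomp F (\<tau> (psum d (p # us)) (n b c)) \<and> psum d (p # us) \<in> AA s"
      if IH: "set us \<subseteq> UNIV \<times> AA s \<longrightarrow> decomp F (\<tau> (psum d us) (n b c)) \<and> psum d us \<in> AA s" for p us
    proof
      assume "set (p # us) \<subseteq> UNIV \<times> AA s"
      then have "snd p \<in> AA s" "set us \<subseteq> UNIV \<times> AA s" by auto
      with IH show "decomp F (\<tau> (psum d (p # us)) (n b c)) \<and> psum d (p # us) \<in> AA s"
        using decomp_single[OF \<pi> \<tau>(3), of "snd p" F "fst p" b c]
        by (simp add: \<tau>(1) lAAD[OF l] D decomp_add)
    qed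
  qed
  show ?thesis
  proof (rule A_induct[where P = "\<lambda>c. decomp F (\<tau> e c)"])
    fix b c show "decomp F (\<tau> e (m b c))"
      using 1[of ys b c] 1[of ys c b] ys n by auto
  qed (use 1 ys in \<open>simp add: \<tau>(2) decomp_add\<close>)
qed

lemma decomp_E12:
  assumes z: "z \<in> AAA s"
  shows "decomp (\<lambda>u. fst (Dl u)) (LL e1 z)" "decomp (\<lambda>u. snd (Dl u)) (LL e2 z)"
proof -
  note l = decomp_lift[where \<tau> = "\<lambda>w c. w \<otimes>\<^sub>3 c" and \<pi> = "\<lambda>a b. a \<otimes> b"]
  have 1: "decomp (\<lambda>u. fst (Dl u)) (e1 w \<otimes>\<^sub>3 c)" "decomp (\<lambda>u. snd (Dl u)) (e2 w \<otimes>\<^sub>3 c)" if "w \<in> AA s" for w c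
    by (rule l[where d = d1 and n = m, OF span_e1[OF that]]; simp add: ten3_simps D_AAA)
      (rule l[where d = d2 and n = "\<lambda>x y. m y x", OF span_e2[OF that]]; simp add: ten3_simps D_AAA)
  show "decomp (\<lambda>u. fst (Dl u)) (LL e1 z)"
    by (rule AAA_induct_3[where P = "\<lambda>z. decomp (\<lambda>u. fst (Dl u)) (LL e1 z)", OF z]) (simp_all add: 1 decomp_add)
  show "decomp (\<lambda>u. snd (Dl u)) (LL e2 z)"
    by (rule AAA_induct_3[where P = "\<lambda>z. decomp (\<lambda>u. snd (Dl u)) (LL e2 z)", OF z]) (simp_all add: 1 decomp_add)
qed

lemma decomp_E23:
  assumes z: "z \<in> AAA s"
  shows "decomp (\<lambda>u. fst (Dr u)) (KK e1 z)" "decomp (\<lambda>u. snd (Dr u)) (KK e2 z)"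
proof -
  note l = decomp_lift[where \<tau> = "\<lambda>w c. J c w" and \<pi> = "\<lambda>a b. b \<otimes> a"]
  have 1: "decomp (\<lambda>u. fst (Dr u)) (J c (e1 w))" "decomp (\<lambda>u. snd (Dr u)) (J c (e2 w))" if "w \<in> AA s" for w c
    by (rule l[where d = d1 and n = m, OF span_e1[OF that]]; simp add: J_add_left J_zero D_AAA)
      (rule l[where d = d2 and n = "\<lambda>x y. m y x", OF span_e2[OF that]]; simp add: J_add_left J_zero D_AAA)
  show "decomp (\<lambda>u. fst (Dr u)) (KK e1 z)"
    by (rule AAA_induct_J[where P = "\<lambda>z. decomp (\<lambda>u. fst (Dr u)) (KK e1 z)", OF z]) (simp_all add: 1 decomp_add)
  show "decomp (\<lambda>u. snd (Dr u)) (KK e2 z)"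
    by (rule AAA_induct_J[where P = "\<lambda>z. decomp (\<lambda>u. snd (Dr u)) (KK e2 z)", OF z]) (simp_all add: 1 decomp_add)
qed

lemma mext_Dl:
  assumes "u \<in> AA s"
  shows "mmul (mext s m Dl (LL e1, LL e2) E) (Dl u) = Dl (e1 u)" "mmul (Dl u) (mext s m Dl (LL e1, LL e2) E) = Dl (e2 u)"
    "mmul (LL e1, LL e2) (Dl u) = Dl u" "mmul (Dl u) (LL e1, LL e2) = Dl u"
proof -
  have "D12 (m a c) (m b d) = mmul (D12 a b) (D12 c d)" for a b c d
    by (rule C_eqI) (simp_all add: D12_in D_AAA fst_snd_mmul d_mul m_assoc)
  moreover have "mmul (LL e1, LL e2) (LL e1, LL e2) = (LL e1, LL e2)"
    by (rule C_eqI) (simp_all add: E12_in fst_snd_mmul E_idem)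
  moreover have "mmul (LL e1, LL e2) (D12 a b) = D12 a b" "mmul (D12 a b) (LL e1, LL e2) = D12 a b" for a b
    by (rule C_eqI; simp add: D12_in E12_in D_AAA fst_snd_mmul e_d d_e)+
  ultimately show "mmul (mext s m Dl (LL e1, LL e2) E) (Dl u) = Dl (e1 u)" "mmul (Dl u) (mext s m Dl (LL e1, LL e2) E) = Dl (e2 u)"
    "mmul (LL e1, LL e2) (Dl u) = Dl u" "mmul (Dl u) (LL e1, LL e2) = Dl u"
    using mext_tlA[of D12 "(LL e1, LL e2)" u, OF D12_in bl_D12 _ E12_in] decomp_E12 assms
    by (simp_all add: Dl_eq[symmetric] decomp_def)
qed

lemma mext_Dr:
  assumes "u \<in> AA s"
  shows "mmul (mext s m Dr (KK e1, KK e2) E) (Dr u) = Dr (e1 u)" "mmul (Dr u) (mext s m Dr (KK e1, KK e2) E) = Dr (e2 u)"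
    "mmul (KK e1, KK e2) (Dr u) = Dr u" "mmul (Dr u) (KK e1, KK e2) = Dr u"
proof -
  have "D23 (m a c) (m b d) = mmul (D23 a b) (D23 c d)" for a b c d
    by (rule C_eqI_J) (simp_all add: D23_in D_AAA fst_snd_mmul d_mul m_assoc)
  moreover have "mmul (KK e1, KK e2) (KK e1, KK e2) = (KK e1, KK e2)"
    by (rule C_eqI_J) (simp_all add: E23_in fst_snd_mmul E_idem)
  moreover have "mmul (KK e1, KK e2) (D23 a b) = D23 a b" "mmul (D23 a b) (KK e1, KK e2) = D23 a b" for a b
    by (rule C_eqI_J; simp add: D23_in E23_in D_AAA fst_snd_mmul e_d d_e)+
  ultimately show "mmul (mext s m Dr (KK e1, KK e2) E) (Dr u) = Dr (e1 u)" "mmul (Dr u) (mext s m Dr (KK e1, KK e2) E) = Dr (e2 u)"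
    "mmul (KK e1, KK e2) (Dr u) = Dr u" "mmul (Dr u) (KK e1, KK e2) = Dr u"
    using mext_tlA[of D23 "(KK e1, KK e2)" u, OF D23_in bl_D23 _ E23_in] decomp_E23 assms
    by (simp_all add: Dr_eq[symmetric] decomp_def)
qed

text \<open>By (v) the extension of \<Delta> \<otimes> id at E is
  \<open>E\<^sub>2\<^sub>3 E\<^sub>1\<^sub>2\<close> in leg notation. Multiplied with (\<Delta>
  \<otimes> id)(u) it gives (\<Delta> \<otimes> id)(E u), while \<open>E\<^sub>1\<^sub>2\<close> is
  absorbed, so \<open>E\<^sub>2\<^sub>3\<close> remains. The other two identities arise likewise
  with E on the right, the last one for id \<otimes> \<Delta>.\<close>

lemma E_D_mult:
  assumes u: "u \<in> AA s"
  shows "KK e1 (fst (Dl u) z) = fst (Dl (e1 u)) z" "KK e2 (snd (Dl u) z) = snd (Dl (e2 u)) z"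
    "LL e2 (snd (Dr u) z) = snd (Dr (e2 u)) z"
proof -
  let ?P = "(LL e1, LL e2)" and ?Q = "(KK e1, KK e2)"
  have v: "mmul ?P ?Q = mext s m Dr ?Q E" "mext s m Dr ?Q E = mext s m Dl ?P E" "mmul ?Q ?P = mext s m Dr ?Q E"
    using wmbaD(20-22)[OF base] by (simp_all add: Eone_eq oneE_eq)
  have 1: "mmul ?Q ?P = mext s m Dl ?P E" "mmul ?P ?Q = mext s m Dl ?P E" using v by simp_all
  have "fst (mmul (mmul ?Q ?P) (Dl u)) z = fst (Dl (e1 u)) z" using mext_Dl[OF u] 1 by simp
  then have "KK e1 (fst (mmul ?P (Dl u)) z) = fst (Dl (e1 u)) z" by (simp add: fst_snd_mmul)
  then show "KK e1 (fst (Dl u) z) = fst (Dl (e1 u)) z" using mext_Dl(3,4)[OF u] by simp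
  have "snd (mmul (Dl u) (mmul ?P ?Q)) z = snd (Dl (e2 u)) z" using mext_Dl[OF u] 1 by simp
  then have "KK e2 (snd (mmul (Dl u) ?P) z) = snd (Dl (e2 u)) z" by (simp add: fst_snd_mmul)
  then show "KK e2 (snd (Dl u) z) = snd (Dl (e2 u)) z" using mext_Dl(3,4)[OF u] by simp
  have "snd (mmul (Dr u) (mmul ?Q ?P)) z = snd (Dr (e2 u)) z" using mext_Dr[OF u] v by simp
  then have "LL e2 (snd (mmul (Dr u) ?Q) z) = snd (Dr (e2 u)) z" by (simp add: fst_snd_mmul)
  then show "LL e2 (snd (Dr u) z) = snd (Dr (e2 u)) z" using mext_Dr(4)[OF u] by simp
qed

section \<open>Interchange of E with the maps \<open>T\<^sub>i\<close> on overlapping legs\<close>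

lemma C_fst_add [simp]:
  assumes "u \<in> AA s" "x \<in> AAA s" "y \<in> AAA s"
  shows "fst (Dl u) (x + y) = fst (Dl u) x + fst (Dl u) y" "snd (Dl u) (x + y) = snd (Dl u) x + snd (Dl u) y"
    "fst (Dr u) (x + y) = fst (Dr u) x + fst (Dr u) y" "snd (Dr u) (x + y) = snd (Dr u) x + snd (Dr u) y"
    "fst (Dl u) x \<in> AAA s" "snd (Dl u) x \<in> AAA s" "fst (Dr u) x \<in> AAA s" "snd (Dr u) x \<in> AAA s"
  using fst_add_C[OF Dl_simps(3)[OF assms(1)]] fst_add_C[OF Dr_simps(3)[OF assms(1)]]
    C.mult_in[OF Dl_simps(3)[OF assms(1)]] C.mult_in[OF Dr_simps(3)[OF assms(1)]] assms by auto

text \<open>The element \<open>LL t2 (J a u)\<close> stands for (a \<otimes> 1 \<otimes> 1)(\<Delta>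
  \<otimes> id)(u). This and the next three lemmas describe elements of this kind by their products
  with z, on the side where z will be cancelled.\<close>

lemma t2_right:
  assumes u: "u \<in> AA s" and z: "z \<in> AAA s"
  shows "LL t2 (J a u) \<star>\<^sub>3 z = LL (l1 a) (fst (Dl u) z)"
proof (rule AA_induct[where P = "\<lambda>u. LL t2 (J a u) \<star>\<^sub>3 z = LL (l1 a) (fst (Dl u) z)", OF u])
  fix b c
  show "LL t2 (J a (b \<otimes> c)) \<star>\<^sub>3 z = LL (l1 a) (fst (Dl (b \<otimes> c)) z)"
    by (rule AAA_induct_3[where P = "\<lambda>z. LL t2 (J a (b \<otimes> c)) \<star>\<^sub>3 z = LL (l1 a) (fst (Dl (b \<otimes> c)) z)", OF z])
      (simp_all add: D_AAA t2_mul)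
qed (simp_all add: z fun_apply)

lemma t4_right:
  assumes u: "u \<in> AA s" and z: "z \<in> AAA s"
  shows "LL t4 (J a u) \<star>\<^sub>3 z = fst (Dl u) (LL (l1 a) z)"
proof (rule AA_induct[where P = "\<lambda>u. LL t4 (J a u) \<star>\<^sub>3 z = fst (Dl u) (LL (l1 a) z)", OF u])
  fix b c
  show "LL t4 (J a (b \<otimes> c)) \<star>\<^sub>3 z = fst (Dl (b \<otimes> c)) (LL (l1 a) z)"
    by (rule AAA_induct_3[where P = "\<lambda>z. LL t4 (J a (b \<otimes> c)) \<star>\<^sub>3 z = fst (Dl (b \<otimes> c)) (LL (l1 a) z)", OF z])
      (simp_all add: D_AAA t4_mul)
qed (simp_all add: z fun_apply)

lemma t2_left:
  assumes u: "u \<in> AA s" and z: "z \<in> AAA s"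
  shows "z \<star>\<^sub>3 LL t2 (J a u) = snd (Dl u) (LL (r1 a) z)"
proof (rule AA_induct[where P = "\<lambda>u. z \<star>\<^sub>3 LL t2 (J a u) = snd (Dl u) (LL (r1 a) z)", OF u])
  fix b c
  show "z \<star>\<^sub>3 LL t2 (J a (b \<otimes> c)) = snd (Dl (b \<otimes> c)) (LL (r1 a) z)"
    by (rule AAA_induct_3[where P = "\<lambda>z. z \<star>\<^sub>3 LL t2 (J a (b \<otimes> c)) = snd (Dl (b \<otimes> c)) (LL (r1 a) z)", OF z])
      (simp_all add: D_AAA t2_mul)
qed (simp_all add: z fun_apply)

lemma t1_left:
  assumes u: "u \<in> AA s" and z: "z \<in> AAA s"
  shows "z \<star>\<^sub>3 KK t1 (u \<otimes>\<^sub>3 c) = KK (r2 c) (snd (Dr u) z)"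
proof (rule AA_induct[where P = "\<lambda>u. z \<star>\<^sub>3 KK t1 (u \<otimes>\<^sub>3 c) = KK (r2 c) (snd (Dr u) z)", OF u])
  fix a b
  show "z \<star>\<^sub>3 KK t1 (a \<otimes> b \<otimes>\<^sub>3 c) = KK (r2 c) (snd (Dr (a \<otimes> b)) z)"
    by (rule AAA_induct_J[where P = "\<lambda>z. z \<star>\<^sub>3 KK t1 (a \<otimes> b \<otimes>\<^sub>3 c) = KK (r2 c) (snd (Dr (a \<otimes> b)) z)", OF z])
      (simp_all add: D_AAA t1_mul)
qed (simp_all add: z fun_apply ten3_simps)

lemma KK_LLl1:
  assumes "lAA \<phi>" "z \<in> AAA s" shows "KK \<phi> (LL (l1 a) z) = LL (l1 a) (KK \<phi> z)"
proof -
  have 1: "LL (l1 a) (J b u) = J (m a b) u" if "u \<in> AA s" for b u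
    using that by (rule AA_induct) simp_all
  show ?thesis
    by (rule AAA_induct_J[where P = "\<lambda>z. KK \<phi> (LL (l1 a) z) = LL (l1 a) (KK \<phi> z)", OF assms(2)])
      (simp_all add: 1 assms(1) lAAD[OF assms(1)])
qed

lemma LL_KKr2:
  assumes "lAA \<phi>" "z \<in> AAA s" shows "LL \<phi> (KK (r2 a) z) = KK (r2 a) (LL \<phi> z)"
proof -
  have 1: "KK (r2 a) (w \<otimes>\<^sub>3 c) = w \<otimes>\<^sub>3 m c a" if "w \<in> AA s" for w c
    using that by (rule AA_induct) (simp_all add: ten3_simps)
  show ?thesis
    by (rule AAA_induct_3[where P = "\<lambda>z. LL \<phi> (KK (r2 a) z) = KK (r2 a) (LL \<phi> z)", OF assms(2)])
      (simp_all add: 1 assms(1) lAAD[OF assms(1)])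
qed

lemma E23_mul: "y \<in> AAA s \<Longrightarrow> z \<in> AAA s \<Longrightarrow> KK e1 y \<star>\<^sub>3 z = KK e1 (y \<star>\<^sub>3 z)"
    "y \<in> AAA s \<Longrightarrow> z \<in> AAA s \<Longrightarrow> y \<star>\<^sub>3 KK e2 z = KK e2 (y \<star>\<^sub>3 z)"
    "y \<in> AAA s \<Longrightarrow> z \<in> AAA s \<Longrightarrow> y \<star>\<^sub>3 LL e2 z = LL e2 (y \<star>\<^sub>3 z)"
  using C.mult_mul_left[OF E23_in] C.mult_mul_right[OF E23_in] C.mult_mul_right[OF E12_in] by simp_all

text \<open>After multiplication by a test element this is (\<Delta> \<otimes> id)(E u) =
  \<open>E\<^sub>2\<^sub>3\<close> (\<Delta> \<otimes> id)(u), together with the fact that a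
  \<otimes> 1 \<otimes> 1 commutes with \<open>E\<^sub>2\<^sub>3\<close>.\<close>

lemma t2_e1_J:
  assumes u: "u \<in> AA s" shows "LL t2 (J a (e1 u)) = KK e1 (LL t2 (J a u))"
  by (rule C.cancel_right)
    (simp_all add: u E23_mul t2_right E_D_mult(1)[symmetric] KK_LLl1)

lemma t2_e2_J:
  assumes u: "u \<in> AA s" shows "LL t2 (J a (e2 u)) = KK e2 (LL t2 (J a u))"
  by (rule C.cancel_left)
    (simp_all add: u E23_mul t2_left E_D_mult(2)[symmetric])

lemma t4_e1_J:
  assumes u: "u \<in> AA s" shows "LL t4 (J a (e1 u)) = KK e1 (LL t4 (J a u))"
  by (rule C.cancel_right)
    (simp_all add: u E23_mul t4_right E_D_mult(1)[symmetric])

lemma t2_e1: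
  assumes z: "z \<in> AAA s" shows "LL t2 (KK e1 z) = KK e1 (LL t2 z)"
  by (rule AAA_induct_J[where P = "\<lambda>z. LL t2 (KK e1 z) = KK e1 (LL t2 z)", OF z]) (simp_all add: t2_e1_J)

lemma e2_t1:
  assumes z: "z \<in> AAA s" shows "LL e2 (KK t1 z) = KK t1 (LL e2 z)"
proof (rule AAA_induct_3[where P = "\<lambda>z. LL e2 (KK t1 z) = KK t1 (LL e2 z)", OF z])
  fix u c assume u: "u \<in> AA s"
  have "LL e2 (KK t1 (u \<otimes>\<^sub>3 c)) = KK t1 (e2 u \<otimes>\<^sub>3 c)"
    by (rule C.cancel_left)
      (simp_all add: u E23_mul t1_left E_D_mult(3)[symmetric] LL_KKr2)
  then show "LL e2 (KK t1 (u \<otimes>\<^sub>3 c)) = KK t1 (LL e2 (u \<otimes>\<^sub>3 c))" using u by simp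
qed simp_all

lemma e2_e1: "z \<in> AAA s \<Longrightarrow> LL e2 (KK e1 z) = KK e1 (LL e2 z)"
  using C.mult_commute[OF E23_in E12_in, of z] by simp

lemma coassoc: "z \<in> AAA s \<Longrightarrow> LL t2 (KK t1 z) = KK t1 (LL t2 z)"
  using wmbaD(16)[OF base] by (simp add: id_def)

section \<open>The weak counit identities\<close>

lemma lA_slice: "lAA \<phi> \<Longrightarrow> lA (\<lambda>q. ei (\<phi> (q \<otimes> d)))"
  by (simp add: lin_on_def ten_simps lAAD)

lemma B23_ei_KK:
  assumes "lAA \<phi>" "v \<in> AA s"
  shows "B23 (\<lambda>x y. s (\<epsilon> x) y) (KK \<phi> (v \<otimes>\<^sub>3 d)) = tmapA s (\<lambda>x. x) (\<lambda>q. ei (\<phi> (q \<otimes> d))) v"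
  using assms(2) by (rule AA_induct)
    (simp_all add: assms(1) lA_slice B23_eps B23_simps[OF bl_eps(1)] lAAD[OF assms(1)] ten3_simps)

lemma e1_r1: "u \<in> AA s \<Longrightarrow> e1 (r1 c u) = r1 c (e1 u)"
  by (rule B.cancel_right) (simp_all add: lr_mul2(5) E_mul(1)[symmetric])

lemma e2_l1: "u \<in> AA s \<Longrightarrow> e2 (l1 c u) = l1 c (e2 u)"
  by (rule B.cancel_left) (simp_all add: lr_mul2(5)[symmetric] E_mul(2)[symmetric])

text \<open>Apply \<epsilon> to the middle leg of \<open>t4_e1_J\<close>. On one side the counit
  turns \<open>t4\<close> into right multiplication by c, on the other side E is sliced against
  d.\<close>

lemma e1_prod: "e1 (m b c \<otimes> d) = tmapA s (\<lambda>x. x) (\<lambda>q. ei (e1 (q \<otimes> d))) (t4 (c \<otimes> b))"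
proof -
  have 1: "B23 (\<lambda>x y. s (\<epsilon> x) y) (LL t4 (J c u)) = r1 c u" if "u \<in> AA s" for u
    using that by (rule AA_induct) (simp_all add: B23_eps counit4 B23_simps[OF bl_eps(1)])
  have "e1 (m b c \<otimes> d) = r1 c (e1 (b \<otimes> d))"
    using e1_r1[of "b \<otimes> d" c] by simp
  also have "\<dots> = B23 (\<lambda>x y. s (\<epsilon> x) y) (KK e1 (LL t4 (J c (b \<otimes> d))))"
    by (subst t4_e1_J[symmetric]) (simp_all add: 1)
  also have "\<dots> = tmapA s (\<lambda>x. x) (\<lambda>q. ei (e1 (q \<otimes> d))) (t4 (c \<otimes> b))"
    by (simp add: B23_ei_KK)
  finally show ?thesis .
qed

lemma e2_prod: "e2 (m d a \<otimes> c) = tmapA s (\<lambda>x. x) (\<lambda>q. ei (e2 (q \<otimes> c))) (t2 (d \<otimes> a))"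
proof -
  have 1: "B23 (\<lambda>x y. s (\<epsilon> x) y) (LL t2 (J d u)) = l1 d u" if "u \<in> AA s" for u
    using that by (rule AA_induct) (simp_all add: B23_eps counit2 B23_simps[OF bl_eps(1)])
  have "e2 (m d a \<otimes> c) = l1 d (e2 (a \<otimes> c))"
    using e2_l1[of "a \<otimes> c" d] by simp
  also have "\<dots> = B23 (\<lambda>x y. s (\<epsilon> x) y) (KK e2 (LL t2 (J d (a \<otimes> c))))"
    by (subst t2_e2_J[symmetric]) (simp_all add: 1)
  also have "\<dots> = tmapA s (\<lambda>x. x) (\<lambda>q. ei (e2 (q \<otimes> c))) (t2 (d \<otimes> a))"
    by (simp add: B23_ei_KK)
  finally show ?thesis .
qed

lemma cancel_l2: "u \<in> AA s \<Longrightarrow> v \<in> AA s \<Longrightarrow> (\<And>c. l2 c u = l2 c v) \<Longrightarrow> u = v"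
  by (rule tmapA_separates[where \<phi> = "\<lambda>_ x. x" and \<psi> = m]) (use A.nondeg_left in auto)

lemma cancel_r2: "u \<in> AA s \<Longrightarrow> v \<in> AA s \<Longrightarrow> (\<And>c. r2 c u = r2 c v) \<Longrightarrow> u = v"
  by (rule tmapA_separates[where \<phi> = "\<lambda>_ x. x" and \<psi> = "\<lambda>c y. m y c"]) (use A.nondeg_right in auto)

text \<open>The weak counit axioms (vi) are stated for \<open>\<epsilon> \<otimes> id\<close>; the following two lemmas
  transport them to \<open>id \<otimes> \<epsilon>\<close> by means of \<open>E (b c \<otimes> 1) = \<Sum> b\<^sub>1 c \<otimes> \<sqinter>\<^sup>L(b\<^sub>2)\<close> and
  its mirror image for \<open>(d a \<otimes> 1) E\<close>.\<close>

lemma barR_mult: "m (ie (t1 (b \<otimes> x))) y = m b (ie (e1 (y \<otimes> x)))"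
proof (rule m_cancel(2))
  fix d
  have l: "lA (\<lambda>q. ei (t2 (q \<otimes> x)))" by (rule lA_slice) simp
  have l': "lA (\<lambda>q. ei (e2 (q \<otimes> c)))" for c by (rule lA_slice) simp
  \<comment> \<open>The lemma is the slice by id \<otimes> \<epsilon> of this formula for (db
    \<otimes> 1) E (y \<otimes> x). Multiplying the second leg by c makes \<open>e2_prod\<close> and
    \<open>barL_mult\<close> applicable.\<close>
  have 1: "l1 (m d b) (e1 (y \<otimes> x)) = tmapA s (\<lambda>p. m p y) (\<lambda>q. ei (t2 (q \<otimes> x))) (t2 (d \<otimes> b))" (is "?a = ?b")
  proof (rule cancel_l2)
    fix c
    have 2: "tmapA s (\<lambda>x. x) (\<lambda>q. ei (e2 (q \<otimes> c))) v \<star> (y \<otimes> x)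
        = l2 c (tmapA s (\<lambda>p. m p y) (\<lambda>q. ei (t2 (q \<otimes> x))) v)" if "v \<in> AA s" for v
      using that by (rule AA_induct) (simp_all add: l l' barL_mult)
    have "l2 c (l1 (m d b) (e1 (y \<otimes> x))) = (m d b \<otimes> c) \<star> e1 (y \<otimes> x)"
      by (simp add: ten_mul2 l1_l2)
    also have "\<dots> = e2 (m d b \<otimes> c) \<star> (y \<otimes> x)" by (simp add: E_mul del: mul2_ten)
    finally show "l2 c ?a = l2 c ?b" by (simp add: e2_prod 2 del: mul2_ten)
  qed (simp_all add: l)
  have 3: "ie (tmapA s (\<lambda>p. m p y) (\<lambda>q. ei (t2 (q \<otimes> x))) v) = m (ie (r2 x v)) y" if "v \<in> AA s" for v
  proof -
    \<comment> \<open>\<epsilon> \<otimes> \<epsilon> may be evaluated in either order, and the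
      counit law for \<open>t2\<close> lives on the second leg.\<close>
    have e: "\<epsilon> (ei (t2 (q \<otimes> x))) = \<epsilon> (m q x)" for q by (simp add: eps_ei counit2)
    show ?thesis using that by (rule AA_induct) (simp_all add: l m_simps e)
  qed
  have "m d (m b (ie (e1 (y \<otimes> x)))) = ie (l1 (m d b) (e1 (y \<otimes> x)))"
    by (simp add: ie_tmapA m_assoc)
  also have "\<dots> = m (ie (r2 x (t2 (d \<otimes> b)))) y" by (simp only: 1 3 maps ten_in)
  also have "\<dots> = m d (m (ie (t1 (b \<otimes> x))) y)"
    by (simp add: t12[symmetric] ie_tmapA m_assoc)
  finally show "m d (m (ie (t1 (b \<otimes> x))) y) = m d (m b (ie (e1 (y \<otimes> x))))" by simp
qed

lemma e2_weak: "m (ie (e2 (a \<otimes> x))) (m b c) = m a (ie (l2 x (t4 (c \<otimes> b))))"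
proof -
  have l: "lA (\<lambda>q. ei (t4 (q \<otimes> x)))" by (rule lA_slice) simp
  have l': "lA (\<lambda>q. ei (e1 (q \<otimes> d)))" for d by (rule lA_slice) simp
  \<comment> \<open>The counterpart for (a \<otimes> x) E (bc \<otimes> 1), now from
    \<open>e1_prod\<close> and \<open>piL_mult\<close>.\<close>
  have 1: "r1 (m b c) (e2 (a \<otimes> x)) = tmapA s (m a) (\<lambda>q. ei (t4 (q \<otimes> x))) (t4 (c \<otimes> b))" (is "?a = ?b")
  proof (rule cancel_r2)
    fix d
    have 2: "(a \<otimes> x) \<star> tmapA s (\<lambda>x. x) (\<lambda>q. ei (e1 (q \<otimes> d))) v
        = r2 d (tmapA s (m a) (\<lambda>q. ei (t4 (q \<otimes> x))) v)" if "v \<in> AA s" for v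
      using that by (rule AA_induct) (simp_all add: l l' piL_mult)
    have "r2 d (r1 (m b c) (e2 (a \<otimes> x))) = e2 (a \<otimes> x) \<star> (m b c \<otimes> d)"
      by (simp add: mul2_ten' r1_r2)
    also have "\<dots> = (a \<otimes> x) \<star> e1 (m b c \<otimes> d)" by (simp add: E_mul del: mul2_ten)
    finally show "r2 d ?a = r2 d ?b" by (simp add: e1_prod 2 del: mul2_ten)
  qed (simp_all add: l)
  have 3: "ie (tmapA s (m a) (\<lambda>q. ei (t4 (q \<otimes> x))) v) = m a (ie (l2 x v))" if "v \<in> AA s" for v
  proof -
    have e: "\<epsilon> (ei (t4 (q \<otimes> x))) = \<epsilon> (m x q)" for q by (simp add: eps_ei counit4)
    show ?thesis using that by (rule AA_induct) (simp_all add: l m_simps e)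
  qed
  have "m (ie (e2 (a \<otimes> x))) (m b c) = ie (r1 (m b c) (e2 (a \<otimes> x)))"
    by (simp add: ie_tmapA)
  then show ?thesis by (simp only: 1 3 maps ten_in)
qed

text \<open>Since \<open>e2_weak\<close> speaks of products, y is first multiplied by d; then
  \<open>t34\<close> replaces \<open>t3\<close> by \<open>t4\<close>.\<close>

lemma piR_mult: "m (ie (e2 (c \<otimes> x))) y = m c (ie (t3 (y \<otimes> x)))"
proof (rule m_cancel(1))
  fix d
  have "m (m c (ie (t3 (y \<otimes> x)))) d = m c (ie (r1 d (t3 (y \<otimes> x))))"
    by (simp add: ie_tmapA m_assoc)
  then show "m (m (ie (e2 (c \<otimes> x))) y) d = m (m c (ie (t3 (y \<otimes> x)))) d"
    by (simp add: t34 e2_weak m_assoc)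
qed

lemma weak_t3: "ie (t3 (m b c \<otimes> x)) = ie (l2 x (t4 (c \<otimes> b)))"
  by (rule m_cancel(2)) (simp add: piR_mult[symmetric] e2_weak)

sublocale W: wmb_maps s \<epsilon> m t1 t2 t3 t4 e1 e2 d1 d2
proof (unfold_locales, goal_cases)
  case (5 a)
  then show ?case using A.idem[of a] by auto
next
  case (3 b)
  then show ?case using A.nondeg_left[of b] by blast
next
  case (4 b)
  then show ?case using A.nondeg_right[of b] by blast
qed ((rule m_bl m_assoc t_lAA mult_lAA t12 weak_t3 weak_t4 coassoc counit1 counit2 counit3 counit4
  barR_mult barL_mult piR_mult piL_mult e_t E_idem t2_e1 e2_t1 e2_e1 d1_t1 d2_t2 d_e span_e1 span_e2
  d1_ten d2_ten; assumption?)+)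

end

section \<open>The correspondence\<close>

context reg_wmb
begin

lemma lin_AA_map_iff: "lin_AA_map s R \<longleftrightarrow> lAA R \<and> (\<forall>u. u \<notin> AA s \<longrightarrow> R u = 0)"
  by (auto simp: lin_AA_map_def lAA_def)

lemma lin_on_eq_prod:
  assumes g: "lin_on tsc tsc (AA s) g" and h: "lin_on tsc tsc (AA s) h" and u: "u \<in> AA s"
  shows "(\<And>a b c. g (a \<otimes> m b c) = h (a \<otimes> m b c)) \<Longrightarrow> g u = h u"
    and "(\<And>a b c. g (m a b \<otimes> c) = h (m a b \<otimes> c)) \<Longrightarrow> g u = h u"
proof -
  note add = lin_on_add[OF g] lin_on_add[OF h]
  show "g u = h u" if p: "\<And>a b c. g (a \<otimes> m b c) = h (a \<otimes> m b c)"
  proof (rule AA_induct[where P = "\<lambda>u. g u = h u", OF u])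
    fix x y show "g (x \<otimes> y) = h (x \<otimes> y)"
      by (rule A_induct[where P = "\<lambda>y. g (x \<otimes> y) = h (x \<otimes> y)"]) (simp_all add: p add ten_simps)
  qed (simp add: add)
  show "g u = h u" if p: "\<And>a b c. g (m a b \<otimes> c) = h (m a b \<otimes> c)"
  proof (rule AA_induct[where P = "\<lambda>u. g u = h u", OF u])
    fix x y show "g (x \<otimes> y) = h (x \<otimes> y)"
      by (rule A_induct[where P = "\<lambda>x. g (x \<otimes> y) = h (x \<otimes> y)"]) (simp_all add: p add ten_simps)
  qed (simp add: add)
qed

lemma G1_eq: "G1 s m E \<Delta> \<epsilon> = W.Gg"
proof -
  have f: "tlA s (\<lambda>x y. snd (PiR s m E \<Delta> \<epsilon> x) a \<otimes> y) (tw s v) = W.Ht a v" if "v \<in> AA s" for a v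
  proof -
    have b: "bl tsc (\<lambda>x y. W.barR a x \<otimes> y)"
      by (rule blI) (simp_all add: ten_simps)
    show ?thesis using tlA_tw[OF b that] by (simp add: W.Ht_def PiR_def W.barR_def)
  qed
  have lin: "lin_on tsc tsc (AA s) W.Gg" using W.Gg_lAA by (simp add: lAA_def)
  show ?thesis unfolding G1_def
  proof (rule the_equality, goal_cases)
    case 1
    show ?case using lin by (simp add: f W.G0_mul)
  next
    case (2 g)
    show ?case
    proof
      fix u show "g u = W.Gg u"
        using lin_on_eq_prod(1)[of g W.Gg u] 2 lin by (cases "u \<in> AA s") (simp_all add: f W.G0_mul)
    qed
  qed
qed

lemma G2_eq: "u \<in> AA s \<Longrightarrow> G2 s m E \<Delta> \<epsilon> u = W.Gg2 u"
proof -
  assume u: "u \<in> AA s"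
  \<comment> \<open>\<open>G2\<close> vanishes outside A \<otimes> A, whereas the values there of
    \<open>W.Gg2\<close>, a conjugate by \<open>tw\<close>, are not controlled; hence the
    cut-off.\<close>
  define G where "G u = (if u \<in> AA s then W.Gg2 u else 0)" for u
  have lin: "lin_on tsc tsc (AA s) G"
    using lAAD(1,2)[OF W.Gg2_simps(1)] by (simp add: lin_on_def G_def)
  have f: "tlA s (\<lambda>x y. x \<otimes> fst (PiL s m E \<Delta> \<epsilon> y) c) (tw s (t3 (b \<otimes> a))) = G (m a b \<otimes> c)" for a b c
    by (simp add: G_def W.Gg2_mul PiL_def)
  have "G2 s m E \<Delta> \<epsilon> = G" unfolding G2_def f
  proof (rule the_equality, goal_cases)
    case 1
    show ?case using lin by (simp add: G_def)
  next
    case (2 g)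
    show ?case
    proof
      fix u show "g u = G u"
        using lin_on_eq_prod(2)[of g G u] 2 lin by (cases "u \<in> AA s") (simp_all add: G_def)
    qed
  qed
  then show ?thesis using u by (simp add: G_def)
qed

lemma R_data_iff:
  "(R1, R2) \<in> R_data s m E \<Delta> \<epsilon> \<longleftrightarrow> ginv t1 e1 W.Gg R1 \<and> ginv t2 e2 W.Gg2 R2
    \<and> (\<forall>u. u \<notin> AA s \<longrightarrow> R1 u = 0 \<and> R2 u = 0)"
  by (auto simp: R_data_def lin_AA_map_iff ginv_def G1_eq G2_eq)

section \<open>The space A \<otimes> M(A) and the element E(a \<otimes> 1)\<close>

lemma vector_space_M: "vector_space (msc s)"
  by (rule vector_space_msc) (rule vector_space_axioms)

lemma zero_in_MA: "0 \<in> A.M"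
proof -
  have "(0, 0) \<in> A.M" by (rule A.multI) (simp_all add: fun_apply)
  then show ?thesis by (simp add: zero_prod_def)
qed

sublocale AM: tprod s "msc s" UNIV "MA s m"
proof -
  interpret N: vector_space "msc s" by (rule vector_space_M)
  show "tprod s (msc s) UNIV (MA s m)"
    by unfold_locales
      (auto simp: N.subspace_def MA_M zero_in_MA A.mult_add_in A.mult_msc_in)
qed

lemma AMA_TT: "AM.TT = AMA s m"
  by (simp add: AMA_def)

lemmas MA_simps = fst_msc fun_apply A.mult_add_in A.mult_msc_in lA_mult lAD[OF lA_mult(1)] m_simps

text \<open>This is v \<mapsto> v(1 \<otimes> d), which brings elements of A \<otimes> M(A) down to
  A \<otimes> A, where equations can be tested.\<close>

definition slice where "slice d = tlift s (msc s) UNIV (MA s m) (\<lambda>x n. x \<otimes> fst n d)"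

lemma bl_slice: "AM.bil tsc (\<lambda>x n. x \<otimes> fst n d)"
  by (simp add: bilin_on_def lin_on_def ten_simps MA_simps MA_M)

lemma slice_simps:
  "n \<in> MA s m \<Longrightarrow> slice d (AM.tn x n) = x \<otimes> fst n d"
  "v \<in> AMA s m \<Longrightarrow> v' \<in> AMA s m \<Longrightarrow> slice d (v + v') = slice d v + slice d v'"
  using AM.tl_tens[OF bl_slice] AM.tl_add[OF bl_slice] by (simp_all add: slice_def AMA_TT)

lemma AMA_induct:
  assumes "v \<in> AMA s m" "\<And>x n. n \<in> MA s m \<Longrightarrow> P (AM.tn x n)"
    "\<And>u v. u \<in> AMA s m \<Longrightarrow> v \<in> AMA s m \<Longrightarrow> P u \<Longrightarrow> P v \<Longrightarrow> P (u + v)"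
  shows "P v"
  by (rule AM.TT_induct[where P = P]) (use assms in \<open>simp_all add: AMA_TT\<close>)

lemma slice_in: "v \<in> AMA s m \<Longrightarrow> slice d v \<in> AA s"
  by (rule AMA_induct[where P = "\<lambda>v. slice d v \<in> AA s"]) (simp_all add: slice_simps)

text \<open>For a functional f on the first leg, N = \<Sum> f(x) n is a multiplier whose value at
  each d is killed by all functionals. So N = 0 and \<Sum> f(x) g(n) = 0 for every g. This makes the
  description in \<open>asAM\<close> unique.\<close>

lemma slice_inj:
  assumes v: "v \<in> AMA s m" "v' \<in> AMA s m" and eq: "\<And>d. slice d v = slice d v'"
  shows "v = v'"
proof -
  interpret T': vector_space "tsc :: 'k \<Rightarrow> ('k,'a,'a mult) tensor \<Rightarrow> _" by (rule vector_space_tsc)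
  have "v - v' \<in> AMA s m" using T'.subspace_diff[OF AM.subspace_TT] v by (simp add: AMA_TT)
  then obtain xs where xs: "v - v' = psum (tens s (msc s)) xs" "set xs \<subseteq> UNIV \<times> MA s m"
    by (auto simp: AMA_def tsp_def)
  have s0: "psum (\<lambda>x n. x \<otimes> fst n d) xs = 0" for d
  proof -
    have "slice d (v - v') = 0"
      using slice_simps(2)[OF \<open>v - v' \<in> AMA s m\<close> v(2), of d] eq[of d] by simp
    then show ?thesis using AM.tl_psum[OF bl_slice xs(2), of d] xs(1) by (simp add: slice_def)
  qed
  have z: "psum (\<lambda>x n. f x * g n) xs = 0" if f: "lfun s f" and g: "lfun (msc s) g" for f g
  proof -
    define N where "N = psum (\<lambda>x n. msc s (f x) n) xs"
    have NM: "N \<in> A.M" unfolding N_def MA_M[symmetric]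
      by (rule AM.W.psum_in_subspace[OF AM.subY]) (use xs(2) in \<open>auto simp: MA_M intro!: A.mult_msc_in\<close>)
    have "fst N d = 0" for d
    proof (rule lfun_separates)
      fix h assume h: "lfun s h"
      have 1: "h (fst (psum (\<lambda>x n. msc s (f x) n) ys) d) = psum (\<lambda>x n. f x * h (fst n d)) ys" for ys
        by (induct ys) (simp_all add: lfun_linear[OF h] fun_apply fst_msc)
      have 2: "psum (\<lambda>x n. f x * h (fst n d)) ys = psum (\<lambda>x n. x \<otimes> fst n d) ys f h" for ys :: "('a \<times> 'a mult) list"
        by (induct ys) (simp_all add: fun_apply ten_def tens_def f h)
      then show "h (fst N d) = 0" using s0[of d] 1[of xs] 2[of xs] by (simp add: N_def fun_apply)
    qed
    then have "N = 0" by (intro A.mult_eqI[OF NM zero_in_MA]) (simp add: fun_apply)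
    then show ?thesis
      using lfun_psum_scale[OF g, of "\<lambda>x n. f x" "\<lambda>x n. n" xs] lfun_zero[OF g]
      by (simp add: N_def mult.commute)
  qed
  have "v - v' = 0"
  proof (intro ext)
    fix f g
    have nol: "psum (tens s (msc s)) ys f g = 0" if "\<not> (lfun s f \<and> lfun (msc s) g)" for ys
      using that by (induct ys) (auto simp: tens_def fun_apply)
    show "(v - v') f g = 0 f g"
      unfolding xs(1) using z[of f g] nol[of xs] AM.psum_tens_apply[of f g xs]
      by (cases "lfun s f \<and> lfun (msc s) g") (auto simp: fun_apply)
  qed
  then show ?thesis by simp
qed

lemma mtA_emb_mult: "n \<in> A.M \<Longrightarrow> mtA s (embA m x) n \<in> B.M"
proof -
  assume n: "n \<in> A.M"
  then have "(fst n, snd n) \<in> A.M" by simp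
  from tmapA_mult[OF m_mult this] show ?thesis
    by (simp add: mtA_def embA_def memb_def)
qed

lemma fst_mtA_emb: "n \<in> A.M \<Longrightarrow> fst (mtA s (embA m x) n) (c \<otimes> d) = m x c \<otimes> fst n d"
  by (simp add: mtA_def embA_def memb_def lA_mult)

lemma fst_add_B:
  "x \<in> B.M \<Longrightarrow> u \<in> AA s \<Longrightarrow> v \<in> AA s \<Longrightarrow> fst x (u + v) = fst x u + fst x v"
  using lin_on_add[OF B.mult_lin(1)] by blast

lemma B_eqI:
  assumes "x \<in> B.M" "y \<in> B.M" "\<And>c d. fst x (c \<otimes> d) = fst y (c \<otimes> d)"
  shows "x = y"
proof (rule B.mult_eqI[OF assms(1,2)])
  fix u assume u: "u \<in> AA s"
  show "fst x u = fst y u"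
    by (rule AA_induct[where P = "\<lambda>u. fst x u = fst y u", OF u]) (simp_all add: assms fst_add_B)
qed

lemma bl_embAM: "AM.bil (msc tsc) (\<lambda>x n. mtA s (embA m x) n)"
proof -
  note s = mtA_emb_mult fst_mtA_emb B.mult_add_in B.mult_msc_in MA_simps ten_simps
  have "mtA s (embA m (x + x')) n = mtA s (embA m x) n + mtA s (embA m x') n" if "n \<in> A.M" for x x' n
    by (rule B_eqI) (simp_all add: that s)
  moreover have "mtA s (embA m (s c x)) n = msc tsc c (mtA s (embA m x) n)" if "n \<in> A.M" for x c n
    by (rule B_eqI) (simp_all add: that s)
  moreover have "mtA s (embA m x) (n + n') = mtA s (embA m x) n + mtA s (embA m x) n'"
    if "n \<in> A.M" "n' \<in> A.M" for x n n'
    by (rule B_eqI) (simp_all add: that s)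
  moreover have "mtA s (embA m x) (msc s c n) = msc tsc c (mtA s (embA m x) n)" if "n \<in> A.M" for x c n
    by (rule B_eqI) (simp_all add: that s)
  ultimately show ?thesis by (simp add: bilin_on_def lin_on_def MA_M)
qed

lemma embAM:
  assumes v: "v \<in> AMA s m"
  shows "embAM s m v \<in> B.M" "fst (embAM s m v) (c \<otimes> d) = r1 c (slice d v)"
proof -
  have 1: "embAM s m (AM.tn x n) = mtA s (embA m x) n" if "n \<in> MA s m" for x n
    using AM.tl_tens[OF bl_embAM _ that] by (simp add: embAM_def)
  have 2: "embAM s m (u + v) = embAM s m u + embAM s m v" if "u \<in> AMA s m" "v \<in> AMA s m" for u v
    using AM.tl_add[OF bl_embAM] that by (simp add: embAM_def AMA_TT)
  show "embAM s m v \<in> B.M"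
    by (rule AMA_induct[where P = "\<lambda>v. embAM s m v \<in> B.M", OF v])
      (simp_all add: 1 2 mtA_emb_mult B.mult_add_in MA_M)
  show "fst (embAM s m v) (c \<otimes> d) = r1 c (slice d v)"
    by (rule AMA_induct[where P = "\<lambda>v. fst (embAM s m v) (c \<otimes> d) = r1 c (slice d v)", OF v])
      (simp_all add: 1 2 fst_mtA_emb slice_simps fun_apply slice_in MA_M)
qed

lemma cancel_r1: "u \<in> AA s \<Longrightarrow> v \<in> AA s \<Longrightarrow> (\<And>c. r1 c u = r1 c v) \<Longrightarrow> u = v"
  by (rule tmapA_separates[where \<phi> = "\<lambda>c y. m y c" and \<psi> = "\<lambda>_ x. x"]) (use A.nondeg_right in auto)

lemma E_a1_in: "mmul E (mtA s (embA m a) oneA) \<in> B.M"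
  by (rule B.mmul_in[OF E_in]) (simp add: mtA_emb lr_mult)

text \<open>The value of v at c \<otimes> d is its slice at d times c \<otimes> 1, and the value of
  E(a \<otimes> 1) there is E(a \<otimes> d) times c \<otimes> 1; the factor c is cancelled.\<close>

lemma embAM_eq_iff:
  assumes v: "v \<in> AMA s m"
  shows "embAM s m v = mmul E (mtA s (embA m a) oneA) \<longleftrightarrow> (\<forall>d. slice d v = e1 (a \<otimes> d))"
proof -
  have f: "fst (mmul E (mtA s (embA m a) oneA)) (c \<otimes> d) = r1 c (e1 (a \<otimes> d))" for c d
    using e1_r1[of "a \<otimes> d" c] by (simp add: mtA_emb fst_snd_mmul)
  show ?thesis
  proof
    assume "embAM s m v = mmul E (mtA s (embA m a) oneA)"
    then have 1: "r1 c (slice d v) = r1 c (e1 (a \<otimes> d))" for c d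
      using embAM(2)[OF v, of c d] f by simp
    show "\<forall>d. slice d v = e1 (a \<otimes> d)"
    proof
      fix d show "slice d v = e1 (a \<otimes> d)"
        by (rule cancel_r1) (simp_all add: slice_in v 1)
    qed
  next
    assume 1: "\<forall>d. slice d v = e1 (a \<otimes> d)"
    show "embAM s m v = mmul E (mtA s (embA m a) oneA)"
      by (rule B_eqI[OF embAM(1)[OF v] E_a1_in]) (simp add: embAM[OF v] f 1)
  qed
qed

text \<open>The multiplier \<open>\<sqinter>\<^sup>L(q)\<close> in \<open>E (b c \<otimes> 1) = \<Sum> b\<^sub>1 c \<otimes> \<sqinter>\<^sup>L(b\<^sub>2)\<close>, which shows
  \<open>E (a \<otimes> 1) \<in> A \<otimes> M(A)\<close>.\<close>

definition sqL where "sqL q = (\<lambda>d. ei (e1 (q \<otimes> d)), \<lambda>d. ei (t4 (q \<otimes> d)))"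

lemma sqL_in: "sqL q \<in> MA s m"
  unfolding sqL_def MA_M by (rule A.multI) (simp_all add: piL_mult)

text \<open>For a = bc take v = \<Sum> p \<otimes> \<open>sqL q\<close> over
  \<open>t4 (c \<otimes> b)\<close> = \<Sum> p \<otimes> q; its slices are computed by
  \<open>e1_prod\<close>. Products span A.\<close>

lemma asAM_ex: "\<exists>v\<in>AMA s m. \<forall>d. slice d v = e1 (a \<otimes> d)"
proof (rule A_induct[where P = "\<lambda>a. \<exists>v\<in>AMA s m. \<forall>d. slice d v = e1 (a \<otimes> d)"])
  fix b c
  have "t4 (c \<otimes> b) \<in> AA s" by simp
  then obtain ys where ys: "t4 (c \<otimes> b) = psum (tens s s) ys" by (auto simp: AA_def tsp_def)
  define v where "v = psum (\<lambda>p q. AM.tn p (sqL q)) ys"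
  have l: "lA (\<lambda>q. ei (e1 (q \<otimes> d)))" for d by (rule lA_slice) simp
  define Q where "Q d us \<longleftrightarrow> psum (\<lambda>p q. AM.tn p (sqL q)) us \<in> AMA s m \<and> psum (tens s s) us \<in> AA s
     \<and> slice d (psum (\<lambda>p q. AM.tn p (sqL q)) us)
       = tmapA s (\<lambda>x. x) (\<lambda>q. ei (e1 (q \<otimes> d))) (psum (tens s s) us)" for d us
  have 1: "Q d us" for d us
  proof (induct us)
    case Nil
    have z: "slice d 0 = 0" using slice_simps(1)[of 0 d 0] zero_in_MA by (simp add: MA_M)
    show ?case
      using AM.TT_zero by (simp add: Q_def z lAAD(4)[OF lAA_tmapA] l AMA_TT)
  next
    case (Cons p us)
    have t: "AM.tn (fst p) (sqL (snd p)) \<in> AMA s m" "tens s s (fst p) (snd p) = fst p \<otimes> snd p"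
      using AM.tens_in[of "fst p" "sqL (snd p)"] sqL_in by (simp_all add: AMA_TT ten_def)
    then show ?case
      using Cons AM.TT_add unfolding Q_def by (simp add: slice_simps sqL_in l AMA_TT) (simp add: sqL_def)
  qed
  show "\<exists>v\<in>AMA s m. \<forall>d. slice d v = e1 (m b c \<otimes> d)"
    by (rule bexI[of _ v]) (use 1[of _ ys] in \<open>simp_all add: Q_def v_def e1_prod ys\<close>)
next
  fix x y
  assume "\<exists>v\<in>AMA s m. \<forall>d. slice d v = e1 (x \<otimes> d)" "\<exists>v\<in>AMA s m. \<forall>d. slice d v = e1 (y \<otimes> d)"
  then obtain v v' where v: "v \<in> AMA s m" "v' \<in> AMA s m" "\<And>d. slice d v = e1 (x \<otimes> d)" "\<And>d. slice d v' = e1 (y \<otimes> d)"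
    by blast
  show "\<exists>v\<in>AMA s m. \<forall>d. slice d v = e1 ((x + y) \<otimes> d)"
    by (rule bexI[of _ "v + v'"]) (use v AM.TT_add in \<open>simp_all add: slice_simps ten_simps AMA_TT\<close>)
qed

lemma asAM:
  shows "asAM s m (mmul E (mtA s (embA m a) oneA)) \<in> AMA s m"
    and "slice d (asAM s m (mmul E (mtA s (embA m a) oneA))) = e1 (a \<otimes> d)"
proof -
  obtain v where v: "v \<in> AMA s m" "\<forall>d. slice d v = e1 (a \<otimes> d)" using asAM_ex by blast
  have "asAM s m (mmul E (mtA s (embA m a) oneA)) = v" unfolding asAM_def
    by (rule the_equality) (use v slice_inj in \<open>auto simp: embAM_eq_iff\<close>)
  then show "asAM s m (mmul E (mtA s (embA m a) oneA)) \<in> AMA s m"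
    "slice d (asAM s m (mmul E (mtA s (embA m a) oneA))) = e1 (a \<otimes> d)" using v by auto
qed

section \<open>The conditions on S in terms of its two components\<close>

context
  fixes S assumes S_lin: "lin_on s (msc s) UNIV S" and S_in: "\<And>a. S a \<in> A.M"
begin

lemma S_simps: "S (x + y) = S x + S y" "S (s c x) = msc s c (S x)"
  using S_lin by (simp_all add: lin_on_def)

lemma bl_fst_S: "bl s (\<lambda>a. fst (S a))" and bl_snd_S: "bl s (\<lambda>a. snd (S a))"
  by (rule blI; simp add: S_simps fun_apply msc_def lAD[OF lA_mult(1)[OF S_in]] lAD[OF lA_mult(2)[OF S_in]])+

lemma mult_S: "mmul (S x) n \<in> A.M" if "n \<in> A.M"
  using S_in that by simp

lemma bl_mult_S: "AM.bil (msc s) (\<lambda>x n. mmul (S x) n)"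
proof -
  note a = lAD[OF lA_mult(1)[OF S_in]]
  note i = mult_S A.mult_add_in A.mult_msc_in fst_snd_mmul fun_apply fst_msc S_simps a
  have "mmul (S (x + x')) n = mmul (S x) n + mmul (S x') n" if "n \<in> A.M" for x x' n
    by (rule A.mult_eqI) (simp_all add: that i S_in del: S_simps, simp_all add: that i)
  moreover have "mmul (S (s c x)) n = msc s c (mmul (S x) n)" if "n \<in> A.M" for x c n
    by (rule A.mult_eqI) (simp_all add: that i S_in)
  moreover have "mmul (S x) (n + n') = mmul (S x) n + mmul (S x) n'" if "n \<in> A.M" "n' \<in> A.M" for x n n'
    by (rule A.mult_eqI) (simp_all add: that i)
  moreover have "mmul (S x) (msc s c n) = msc s c (mmul (S x) n)" if "n \<in> A.M" for x c n
    by (rule A.mult_eqI) (simp_all add: that i)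
  ultimately show ?thesis by (simp add: bilin_on_def lin_on_def MA_M)
qed

lemma tlift_mult_S:
  assumes v: "v \<in> AMA s m"
  shows "tlift s (msc s) UNIV (MA s m) (\<lambda>x n. mmul (S x) n) v \<in> A.M"
    and "fst (tlift s (msc s) UNIV (MA s m) (\<lambda>x n. mmul (S x) n) v) d = tlA s (\<lambda>a. fst (S a)) (slice d v)"
proof -
  define N where "N = tlift s (msc s) UNIV (MA s m) (\<lambda>x n. mmul (S x) n)"
  have 1: "N (AM.tn x n) = mmul (S x) n" if "n \<in> MA s m" for x n
    unfolding N_def using AM.tl_tens[OF bl_mult_S _ that] by simp
  have 2: "N (u + v) = N u + N v" if "u \<in> AMA s m" "v \<in> AMA s m" for u v
    unfolding N_def using AM.tl_add[OF bl_mult_S] that by (simp add: AMA_TT)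
  have "N v \<in> A.M"
    by (rule AMA_induct[where P = "\<lambda>v. N v \<in> A.M", OF v])
      (simp_all add: 1 2 mult_S A.mult_add_in MA_M)
  moreover have "fst (N v) d = tlA s (\<lambda>a. fst (S a)) (slice d v)"
    by (rule AMA_induct[where P = "\<lambda>v. fst (N v) d = tlA s (\<lambda>a. fst (S a)) (slice d v)", OF v])
      (simp_all add: 1 2 slice_simps slice_in fst_snd_mmul fun_apply bl_tlA[OF bl_fst_S] MA_M)
  ultimately show "tlift s (msc s) UNIV (MA s m) (\<lambda>x n. mmul (S x) n) v \<in> A.M"
    "fst (tlift s (msc s) UNIV (MA s m) (\<lambda>x n. mmul (S x) n) v) d = tlA s (\<lambda>a. fst (S a)) (slice d v)"
    by (simp_all add: N_def)
qed

text \<open>Both sides of (ix) are multipliers, so left actions decide. At d the left side involves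
  only the slice of E(a \<otimes> 1) at d, which is E(a \<otimes> d).\<close>

lemma ix_iff:
  "tlift s (msc s) UNIV (MA s m) (\<lambda>x n. mmul (S x) n) (asAM s m (mmul E (mtA s (embA m a) oneA))) = S a
    \<longleftrightarrow> (\<forall>d. tlA s (\<lambda>a. fst (S a)) (e1 (a \<otimes> d)) = fst (S a) d)" (is "?N = _ \<longleftrightarrow> ?R")
proof -
  have 1: "fst ?N d = tlA s (\<lambda>a. fst (S a)) (e1 (a \<otimes> d))" for d
    using tlift_mult_S(2)[OF asAM(1)[of a], of d] asAM(2)[of d a] by simp
  have 2: "?N \<in> A.M" by (rule tlift_mult_S(1)[OF asAM(1)])
  show ?thesis
  proof
    assume "?N = S a"
    then show ?R using 1 by metis
  next
    assume ?R
    then show "?N = S a"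
      by (intro A.mult_eqI[OF 2 S_in]) (simp add: 1)
  qed
qed

lemma S_data_iff:
  "S \<in> S_data s m E \<Delta> \<epsilon> \<longleftrightarrow> W.S_ok (\<lambda>a. fst (S a)) (\<lambda>a. snd (S a))
    \<and> (\<forall>a d. tlA s (\<lambda>a. fst (S a)) (e1 (a \<otimes> d)) = fst (S a) d)"
proof -
  have 1: "tlA s (\<lambda>x y. x \<otimes> fst (S y) c) w = tmapA s (\<lambda>x. x) (\<lambda>y. fst (S y) c) w" if "w \<in> AA s" for c w
    using that by (simp add: tmapA_def rst_def)
  have 2: "tlA s (\<lambda>x y. snd (S x) c \<otimes> y) w = tmapA s (\<lambda>x. snd (S x) c) (\<lambda>x. x) w" if "w \<in> AA s" for c w
    using that by (simp add: tmapA_def rst_def)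
  have 3: "m c (fst (S a) b) = m (snd (S a) c) b" for a b c
    using A.mult_link[OF S_in] by simp
  show ?thesis
    unfolding S_data_def W.S_ok_def mem_Collect_eq ix_iff
    using S_lin S_in bl_fst_S bl_snd_S 3 by (simp add: 1 2 MA_M) blast
qed

end

lemma S_dataD: "S \<in> S_data s m E \<Delta> \<epsilon> \<Longrightarrow> lin_on s (msc s) UNIV S" "S \<in> S_data s m E \<Delta> \<epsilon> \<Longrightarrow> S a \<in> A.M"
  by (simp_all add: S_data_def MA_M)

section \<open>Uniqueness, and existence on either side from the other\<close>

lemma S_data_unique:
  assumes "S \<in> S_data s m E \<Delta> \<epsilon>" "S' \<in> S_data s m E \<Delta> \<epsilon>"
  shows "S = S'"
proof
  fix a
  note 1 = S_data_iff[OF S_dataD[OF assms(1)], THEN iffD1, OF assms(1)]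
  note 2 = S_data_iff[OF S_dataD[OF assms(2)], THEN iffD1, OF assms(2)]
  have "fst (S a) b = fst (S' a) b" for b
    by (rule W.S_ok_unique[OF 1[THEN conjunct1] 2[THEN conjunct1]]) (use 1 2 in auto)
  then show "S a = S' a"
    by (intro A.mult_eqI S_dataD(2)[OF assms(1)] S_dataD(2)[OF assms(2)])
qed

lemma R_data_unique:
  assumes "(R1, R2) \<in> R_data s m E \<Delta> \<epsilon>" "(R1', R2') \<in> R_data s m E \<Delta> \<epsilon>"
  shows "R1 = R1'" "R2 = R2'"
proof -
  note R = assms[unfolded R_data_iff]
  show "R1 = R1'"
  proof
    fix u show "R1 u = R1' u"
      using R ginv_unique[of t1 e1 W.Gg R1 R1' u] by (cases "u \<in> AA s") auto
  qed
  show "R2 = R2'"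
  proof
    fix u show "R2 u = R2' u"
      using R ginv_unique[of t2 e2 W.Gg2 R2 R2' u] by (cases "u \<in> AA s") auto
  qed
qed

text \<open>Elements of \<open>R_data\<close> vanish outside A \<otimes> A, while
  \<open>ginv\<close> constrains the values inside; the cut-off selects the normalised
  representative.\<close>

lemma ginv_rst:
  assumes "ginv t e g r" "lAA t" shows "ginv t e g (rst (AA s) r)"
proof -
  have r: "r (t u) = g u" "t (r u) = e u" "r (e u) = r u" if "u \<in> AA s" for u
    using assms(1) that by (auto simp: ginv_def)
  have l: "lAA r" using assms(1) by (simp add: ginv_def)
  have eu: "e u \<in> AA s" if "u \<in> AA s" for u
    using r(2)[OF that] lAAD(3)[OF assms(2) lAAD(3)[OF l that]] by simp
  have "lAA (rst (AA s) r)" by (rule lAAI) (simp_all add: rst_def lAAD[OF l])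
  moreover have "rst (AA s) r u = r u" if "u \<in> AA s" for u
    using that by (simp add: rst_def)
  ultimately show ?thesis
    unfolding ginv_def by (intro conjI ballI) (simp_all add: r eu lAAD(3)[OF assms(2)] lAAD(3)[OF l])
qed

lemma R_data_of_S:
  assumes "S \<in> S_data s m E \<Delta> \<epsilon>"
  shows "\<exists>R1 R2. (R1, R2) \<in> R_data s m E \<Delta> \<epsilon>"
proof -
  have ok: "W.S_ok (\<lambda>a. fst (S a)) (\<lambda>a. snd (S a))"
    using S_data_iff[OF S_dataD[OF assms]] assms by blast
  obtain r1 r2 where "ginv t1 e1 W.Gg r1" "ginv t2 e2 W.Gg2 r2"
    using W.S_ok_ginv[OF ok] W.S_ok_ginv2[OF ok] by blast
  then have "ginv t1 e1 W.Gg (rst (AA s) r1)" "ginv t2 e2 W.Gg2 (rst (AA s) r2)"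
    by (auto intro: ginv_rst)
  moreover have "rst (AA s) r1 u = 0 \<and> rst (AA s) r2 u = 0" if "u \<notin> AA s" for u
    using that by (simp add: rst_def)
  ultimately have "(rst (AA s) r1, rst (AA s) r2) \<in> R_data s m E \<Delta> \<epsilon>"
    unfolding R_data_iff by blast
  then show ?thesis by blast
qed

lemma S_data_of_R:
  assumes "(R1, R2) \<in> R_data s m E \<Delta> \<epsilon>"
  shows "\<exists>S. S \<in> S_data s m E \<Delta> \<epsilon>"
proof -
  have R: "ginv t1 e1 W.Gg R1" "ginv t2 e2 W.Gg2 R2" using assms by (simp_all add: R_data_iff)
  define S where "S a = (\<lambda>b. ei (R1 (a \<otimes> b)), \<lambda>c. ie (R2 (c \<otimes> a)))" for a
  have fs: "(\<lambda>a. fst (S a)) = (\<lambda>a b. ei (R1 (a \<otimes> b)))" "(\<lambda>a. snd (S a)) = (\<lambda>a c. ie (R2 (c \<otimes> a)))"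
    by (simp_all add: S_def)
  have ok: "W.S_ok (\<lambda>a. fst (S a)) (\<lambda>a. snd (S a))"
    unfolding fs by (rule W.S_ok_R[OF R])
  have "S a \<in> A.M" for a
    unfolding S_def by (rule A.multI) (simp_all add: W.S_link[OF R])
  moreover have "lin_on s (msc s) UNIV S"
  proof -
    have b: "bl s (\<lambda>a. fst (S a))" "bl s (\<lambda>a. snd (S a))" using ok by (simp_all add: W.S_ok_def)
    have "S (x + y) = S x + S y" "S (s c x) = msc s c (S x)" for x y c
      by (rule prod_eqI; rule ext; simp add: fun_apply msc_def blD[OF b(1)] blD[OF b(2)])+
    then show ?thesis by (simp add: lin_on_def)
  qed
  moreover have "tlA s (\<lambda>a. fst (S a)) (e1 (a \<otimes> d)) = fst (S a) d" for a d
    unfolding fs using W.S_ix[OF R(1)] by (simp add: S_def)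
  ultimately have "S \<in> S_data s m E \<Delta> \<epsilon>" using S_data_iff[of S] ok by blast
  then show ?thesis by blast
qed

end

theorem theorem6p8:
  fixes s :: "'k::field \<Rightarrow> 'a::ab_group_add \<Rightarrow> 'a"
    and m :: "'a \<Rightarrow> 'a \<Rightarrow> 'a"
    and E :: "('k,'a) AA mult"
    and \<Delta> :: "'a \<Rightarrow> ('k,'a) AA mult"
    and \<epsilon> :: "'a \<Rightarrow> 'k"
  assumes "regular_wmba s m E \<Delta> \<epsilon>"
  shows "\<exists>\<Phi>. bij_betw \<Phi> (R_data s m E \<Delta> \<epsilon>) (S_data s m E \<Delta> \<epsilon>)"
proof -
  interpret reg_wmb s m E \<Delta> \<epsilon> by (rule reg_wmb.intro) (rule assms)
  let ?R = "R_data s m E \<Delta> \<epsilon>" and ?S = "S_data s m E \<Delta> \<epsilon>"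
  show ?thesis
  proof (cases "?S = {}")
    case True
    then have "?R = {}" using S_data_of_R by (metis emptyE equals0I prod.exhaust)
    then show ?thesis using True by (simp add: bij_betw_def)
  next
    case False
    then obtain S where S: "S \<in> ?S" by blast
    then obtain R1 R2 where R: "(R1, R2) \<in> ?R" using R_data_of_S by blast
    have "?S = {S}" using S S_data_unique by blast
    moreover have "?R = {(R1, R2)}"
    proof (intro equalityI subsetI)
      fix p assume "p \<in> ?R"
      then show "p \<in> {(R1, R2)}" using R_data_unique[OF R, of "fst p" "snd p"] by simp
    qed (use R in simp)
    ultimately have "bij_betw (\<lambda>_. S) ?R ?S" by simp
    then show ?thesis by blast
  qed
qed

end
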